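(* Let $p$ be a prime and let $k$ be a field of characteristic $p$. If $G$ is a group of order $p^r$ with $r\ge 1$, then the ghost number of $kG$ is at least $(r-1)(p-1)+1$.
   Context: Let $G$ be a finite group and $k$ a field whose characteristic divides $|G|$. $\mathrm{StMod}(kG)$ is the stable module category: objects are left $kG$-modules, morphisms are $[M,N] = \mathrm{Hom}_{kG}(M,N)$ modulo maps factoring through a projective. It is triangulated, with desuspension $\Omega M$ the kernel of a surjection from a projective onto $M$, and $\Sigma=\Omega^{-1}$. $\mathrm{Thick}\langle k\rangle$ is the smallest full triangulated subcategory closed under retracts and containing the trivial module $k$. A ghost is a map $f$ in $\mathrm{StMod}(kG)$ that induces zero on Tate cohomology, i.e. $[\Omega^n k,f]=0$ for all $n\in\mathbb{Z}$. The ghost length of $M\in\mathrm{Thick}\langle k\rangle$ is the smallest $n\ge 0$ such that every composite of $n$ ghosts between objects of $\mathrm{Thick}\langle k\rangle$ with domain $M$ is zero in $\mathrm{StMod}(kG)$ (a composite of $0$ ghosts being any map). The ghost number of $kG$ is the least upper bound of the ghost lengths of modules in $\mathrm{Thick}\langle k\rangle$. *)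

theory Defs
  imports "HOL-Algebra.Module" "HOL-Algebra.Coset" "HOL-Computational_Algebra.Primes"
    "HOL-Library.Extended_Nat"
begin

definition has_characteristic :: "('k, 'c) ring_scheme \<Rightarrow> nat \<Rightarrow> bool" where
  "has_characteristic K p \<longleftrightarrow> (\<forall>n::nat. [n] \<cdot>\<^bsub>K\<^esub> \<one>\<^bsub>K\<^esub> = \<zero>\<^bsub>K\<^esub> \<longleftrightarrow> p dvd n)"


section \<open>Left modules over a ring that need not be commutative\<close>

text \<open>
  The library locale \<open>module\<close> requires a commutative ring of scalars. We keep its record type,
  whose fields \<open>mult\<close> and \<open>one\<close> carry no information for a module. All modules over \<open>R\<close> that
  are compared with each other have their elements in one type \<open>'u\<close>, which plays the role of the
  universe in which the module category is formed.
\<close>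

locale left_module = R?: ring R + M?: abelian_group M
  for R :: "('r, 'x) ring_scheme" (structure) and M :: "('r, 'u) module" (structure) +
  assumes smult_closed: "\<lbrakk>a \<in> carrier R; x \<in> carrier M\<rbrakk> \<Longrightarrow> a \<odot>\<^bsub>M\<^esub> x \<in> carrier M"
    and smult_l_distr: "\<lbrakk>a \<in> carrier R; b \<in> carrier R; x \<in> carrier M\<rbrakk> \<Longrightarrow>
      (a \<oplus>\<^bsub>R\<^esub> b) \<odot>\<^bsub>M\<^esub> x = a \<odot>\<^bsub>M\<^esub> x \<oplus>\<^bsub>M\<^esub> b \<odot>\<^bsub>M\<^esub> x"
    and smult_r_distr: "\<lbrakk>a \<in> carrier R; x \<in> carrier M; y \<in> carrier M\<rbrakk> \<Longrightarrow>
      a \<odot>\<^bsub>M\<^esub> (x \<oplus>\<^bsub>M\<^esub> y) = a \<odot>\<^bsub>M\<^esub> x \<oplus>\<^bsub>M\<^esub> a \<odot>\<^bsub>M\<^esub> y"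
    and smult_assoc: "\<lbrakk>a \<in> carrier R; b \<in> carrier R; x \<in> carrier M\<rbrakk> \<Longrightarrow>
      (a \<otimes>\<^bsub>R\<^esub> b) \<odot>\<^bsub>M\<^esub> x = a \<odot>\<^bsub>M\<^esub> (b \<odot>\<^bsub>M\<^esub> x)"
    and smult_one: "x \<in> carrier M \<Longrightarrow> \<one>\<^bsub>R\<^esub> \<odot>\<^bsub>M\<^esub> x = x"

definition mod_hom ::
  "('r, 'x) ring_scheme \<Rightarrow> ('r, 'a) module \<Rightarrow> ('r, 'b) module \<Rightarrow> ('a \<Rightarrow> 'b) set" where
  "mod_hom R M N = {f \<in> carrier M \<rightarrow> carrier N.
     (\<forall>x\<in>carrier M. \<forall>y\<in>carrier M. f (x \<oplus>\<^bsub>M\<^esub> y) = f x \<oplus>\<^bsub>N\<^esub> f y) \<and>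
     (\<forall>a\<in>carrier R. \<forall>x\<in>carrier M. f (a \<odot>\<^bsub>M\<^esub> x) = a \<odot>\<^bsub>N\<^esub> f x)}"

definition projective_module :: "('r, 'x) ring_scheme \<Rightarrow> ('r, 'u) module \<Rightarrow> bool" where
  "projective_module R P \<longleftrightarrow> left_module R P \<and>
     (\<forall>(A :: ('r, 'u) module) (B :: ('r, 'u) module) g f.
        left_module R A \<longrightarrow> left_module R B \<longrightarrow> g \<in> mod_hom R A B \<longrightarrow>
        g ` carrier A = carrier B \<longrightarrow> f \<in> mod_hom R P B \<longrightarrow>
        (\<exists>h\<in>mod_hom R P A. \<forall>x\<in>carrier P. g (h x) = f x))"

definition short_exact ::
  "('r, 'x) ring_scheme \<Rightarrow> ('r, 'u) module \<Rightarrow> ('u \<Rightarrow> 'u) \<Rightarrow> ('r, 'u) module \<Rightarrow>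
    ('u \<Rightarrow> 'u) \<Rightarrow> ('r, 'u) module \<Rightarrow> bool" where
  "short_exact R A f B g C \<longleftrightarrow>
     left_module R A \<and> left_module R B \<and> left_module R C \<and>
     f \<in> mod_hom R A B \<and> g \<in> mod_hom R B C \<and>
     inj_on f (carrier A) \<and>
     f ` carrier A = {b \<in> carrier B. g b = \<zero>\<^bsub>C\<^esub>} \<and>
     g ` carrier B = carrier C"


section \<open>The stable module category\<close>

text \<open>
  A morphism of the stable category is represented by a module homomorphism; two representatives
  are the same morphism if they are related by \<open>stably_eq\<close>. All notions below are invariant
  under the choice of representatives.
\<close>

definition stably_zero ::
  "('r, 'x) ring_scheme \<Rightarrow> ('r, 'u) module \<Rightarrow> ('r, 'u) module \<Rightarrow> ('u \<Rightarrow> 'u) \<Rightarrow> bool" where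
  "stably_zero R M N f \<longleftrightarrow>
     (\<exists>(P :: ('r, 'u) module) a b. projective_module R P \<and>
        a \<in> mod_hom R M P \<and> b \<in> mod_hom R P N \<and>
        (\<forall>x\<in>carrier M. f x = b (a x)))"

definition stably_eq ::
  "('r, 'x) ring_scheme \<Rightarrow> ('r, 'u) module \<Rightarrow> ('r, 'u) module \<Rightarrow>
    ('u \<Rightarrow> 'u) \<Rightarrow> ('u \<Rightarrow> 'u) \<Rightarrow> bool" where
  "stably_eq R M N f g \<longleftrightarrow> stably_zero R M N (\<lambda>x. f x \<ominus>\<^bsub>N\<^esub> g x)"

definition stable_iso ::
  "('r, 'x) ring_scheme \<Rightarrow> ('r, 'u) module \<Rightarrow> ('r, 'u) module \<Rightarrow> ('u \<Rightarrow> 'u) \<Rightarrow> bool" where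
  "stable_iso R M N f \<longleftrightarrow> f \<in> mod_hom R M N \<and>
     (\<exists>g\<in>mod_hom R N M. stably_eq R M M (g \<circ> f) id \<and> stably_eq R N N (f \<circ> g) id)"

definition stable_retract ::
  "('r, 'x) ring_scheme \<Rightarrow> ('r, 'u) module \<Rightarrow> ('r, 'u) module \<Rightarrow> bool" where
  "stable_retract R N M \<longleftrightarrow>
     (\<exists>s\<in>mod_hom R N M. \<exists>t\<in>mod_hom R M N. stably_eq R N N (t \<circ> s) id)"

text \<open>
  The sequence \<open>0 \<rightarrow> X \<rightarrow> J \<rightarrow> S \<rightarrow> 0\<close> with \<open>J\<close> projective exhibits \<open>X\<close> as the
  desuspension of \<open>S\<close> and \<open>S\<close> as the suspension of \<open>X\<close>. Both are unique
  only up to stable isomorphism, so they are treated as relations, and a triangle carries the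
  sequence that identifies its last object with the suspension of its first.
\<close>

definition suspension_seq ::
  "('r, 'x) ring_scheme \<Rightarrow> ('r, 'u) module \<Rightarrow> ('u \<Rightarrow> 'u) \<Rightarrow> ('r, 'u) module \<Rightarrow>
    ('u \<Rightarrow> 'u) \<Rightarrow> ('r, 'u) module \<Rightarrow> bool" where
  "suspension_seq R X j J q S \<longleftrightarrow> short_exact R X j J q S \<and> projective_module R J"

text \<open>\<open>syzygy R M N\<close>: the module \<open>N\<close> is an \<open>\<Omega>M\<close>.\<close>

definition syzygy :: "('r, 'x) ring_scheme \<Rightarrow> ('r, 'u) module \<Rightarrow> ('r, 'u) module \<Rightarrow> bool" where
  "syzygy R M N \<longleftrightarrow> (\<exists>j P q. suspension_seq R N j P q M)"

text \<open>\<open>Omega_power R n M N\<close>: the module \<open>N\<close> is an \<open>\<Omega>\<close>-power of \<open>M\<close> with exponent \<open>n\<close>.\<close>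

definition Omega_power ::
  "('r, 'x) ring_scheme \<Rightarrow> int \<Rightarrow> ('r, 'u) module \<Rightarrow> ('r, 'u) module \<Rightarrow> bool" where
  "Omega_power R n M N \<longleftrightarrow>
     (if n \<ge> 0 then (syzygy R ^^ nat n) M N else (syzygy R ^^ nat (- n)) N M)"

text \<open>\<open>s\<close> represents the suspension of \<open>a\<close>, with respect to the given sequences.\<close>

definition suspends ::
  "('r, 'x) ring_scheme \<Rightarrow>
    ('r, 'u) module \<Rightarrow> ('u \<Rightarrow> 'u) \<Rightarrow> ('r, 'u) module \<Rightarrow> ('u \<Rightarrow> 'u) \<Rightarrow> ('r, 'u) module \<Rightarrow>
    ('r, 'u) module \<Rightarrow> ('u \<Rightarrow> 'u) \<Rightarrow> ('r, 'u) module \<Rightarrow> ('u \<Rightarrow> 'u) \<Rightarrow> ('r, 'u) module \<Rightarrow>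
    ('u \<Rightarrow> 'u) \<Rightarrow> ('u \<Rightarrow> 'u) \<Rightarrow> bool" where
  "suspends R X j J q S X' j' J' q' S' a s \<longleftrightarrow>
     a \<in> mod_hom R X X' \<and> s \<in> mod_hom R S S' \<and>
     (\<exists>e\<in>mod_hom R J J'. (\<forall>x\<in>carrier X. e (j x) = j' (a x)) \<and>
        (\<forall>y\<in>carrier J. s (q y) = q' (e y)))"

text \<open>
  The triangle \<open>A \<rightarrow> B \<rightarrow> C \<rightarrow> S\<close> of a short exact sequence: \<open>e\<close> extends \<open>i\<close> from
  \<open>A\<close> to \<open>B\<close>, and \<open>h\<close> is, up to sign, the map it induces on cokernels. The sign makes
  these triangles isomorphic to the mapping cone triangles obtained from pushouts.
\<close>

definition standard_triangle ::
  "('r, 'x) ring_scheme \<Rightarrow> ('r, 'u) module \<Rightarrow> ('u \<Rightarrow> 'u) \<Rightarrow> ('r, 'u) module \<Rightarrow> ('u \<Rightarrow> 'u) \<Rightarrow>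
    ('r, 'u) module \<Rightarrow> ('u \<Rightarrow> 'u) \<Rightarrow> ('u \<Rightarrow> 'u) \<Rightarrow> ('r, 'u) module \<Rightarrow> ('u \<Rightarrow> 'u) \<Rightarrow>
    ('r, 'u) module \<Rightarrow> bool" where
  "standard_triangle R A f B g C h i I q S \<longleftrightarrow>
     short_exact R A f B g C \<and> suspension_seq R A i I q S \<and> h \<in> mod_hom R C S \<and>
     (\<exists>e\<in>mod_hom R B I. (\<forall>x\<in>carrier A. e (f x) = i x) \<and>
        (\<forall>y\<in>carrier B. h (g y) = \<ominus>\<^bsub>S\<^esub> q (e y)))"

definition distinguished_triangle ::
  "('r, 'x) ring_scheme \<Rightarrow> ('r, 'u) module \<Rightarrow> ('u \<Rightarrow> 'u) \<Rightarrow> ('r, 'u) module \<Rightarrow> ('u \<Rightarrow> 'u) \<Rightarrow>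
    ('r, 'u) module \<Rightarrow> ('u \<Rightarrow> 'u) \<Rightarrow> ('u \<Rightarrow> 'u) \<Rightarrow> ('r, 'u) module \<Rightarrow> ('u \<Rightarrow> 'u) \<Rightarrow>
    ('r, 'u) module \<Rightarrow> bool" where
  "distinguished_triangle R X u Y v Z w j J r S \<longleftrightarrow>
     left_module R Y \<and> left_module R Z \<and> suspension_seq R X j J r S \<and>
     u \<in> mod_hom R X Y \<and> v \<in> mod_hom R Y Z \<and> w \<in> mod_hom R Z S \<and>
     (\<exists>A f B g C h i I q T a b c d.
        standard_triangle R A f B g C h i I q T \<and>
        stable_iso R A X a \<and> stable_iso R B Y b \<and> stable_iso R C Z c \<and>
        suspends R A i I q T X j J r S a d \<and>
        stably_eq R A Y (b \<circ> f) (u \<circ> a) \<and>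
        stably_eq R B Z (c \<circ> g) (v \<circ> b) \<and>
        stably_eq R C S (d \<circ> h) (w \<circ> c))"

definition thick_subcategory :: "('r, 'x) ring_scheme \<Rightarrow> ('r, 'u) module set \<Rightarrow> bool" where
  "thick_subcategory R T \<longleftrightarrow>
     (\<forall>M\<in>T. left_module R M) \<and>
     (\<forall>M N. syzygy R M N \<longrightarrow> (M \<in> T \<longleftrightarrow> N \<in> T)) \<and>
     (\<forall>X u Y v Z w j J r S. distinguished_triangle R X u Y v Z w j J r S \<longrightarrow>
        (X \<in> T \<and> Y \<in> T \<longrightarrow> Z \<in> T) \<and> (Y \<in> T \<and> Z \<in> T \<longrightarrow> X \<in> T) \<and>
        (X \<in> T \<and> Z \<in> T \<longrightarrow> Y \<in> T)) \<and>
     (\<forall>M N. M \<in> T \<and> left_module R N \<and> stable_retract R N M \<longrightarrow> N \<in> T)"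

definition Thick :: "('r, 'x) ring_scheme \<Rightarrow> ('r, 'u) module set \<Rightarrow> ('r, 'u) module set" where
  "Thick R S = \<Inter>{T. thick_subcategory R T \<and> S \<subseteq> T}"


section \<open>Group algebras, ghosts and the ghost number\<close>

definition group_algebra ::
  "('k, 'c) ring_scheme \<Rightarrow> ('g, 'd) monoid_scheme \<Rightarrow> ('g \<Rightarrow> 'k) ring" where
  "group_algebra K G = \<lparr>
     carrier = carrier G \<rightarrow>\<^sub>E carrier K,
     monoid.mult = (\<lambda>a b. \<lambda>x\<in>carrier G. \<Oplus>\<^bsub>K\<^esub>y\<in>carrier G. a y \<otimes>\<^bsub>K\<^esub> b (inv\<^bsub>G\<^esub> y \<otimes>\<^bsub>G\<^esub> x)),
     monoid.one = (\<lambda>x\<in>carrier G. if x = \<one>\<^bsub>G\<^esub> then \<one>\<^bsub>K\<^esub> else \<zero>\<^bsub>K\<^esub>),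
     ring.zero = (\<lambda>x\<in>carrier G. \<zero>\<^bsub>K\<^esub>),
     ring.add = (\<lambda>a b. \<lambda>x\<in>carrier G. a x \<oplus>\<^bsub>K\<^esub> b x)\<rparr>"

definition trivial_module ::
  "('k, 'c) ring_scheme \<Rightarrow> ('g, 'd) monoid_scheme \<Rightarrow> ('g \<Rightarrow> 'k, 'k) module" where
  "trivial_module K G = \<lparr>
     carrier = carrier K, monoid.mult = monoid.mult K, monoid.one = \<one>\<^bsub>K\<^esub>,
     ring.zero = \<zero>\<^bsub>K\<^esub>, ring.add = ring.add K,
     smult = (\<lambda>a x. (\<Oplus>\<^bsub>K\<^esub>g\<in>carrier G. a g) \<otimes>\<^bsub>K\<^esub> x)\<rparr>"

text \<open>The copies of the trivial module in the universe \<open>'u\<close>.\<close>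

definition trivial_modules ::
  "('k, 'c) ring_scheme \<Rightarrow> ('g, 'd) monoid_scheme \<Rightarrow> ('g \<Rightarrow> 'k, 'u) module set" where
  "trivial_modules K G = {M. left_module (group_algebra K G) M \<and>
     (\<exists>f\<in>mod_hom (group_algebra K G) (trivial_module K G) M.
        bij_betw f (carrier (trivial_module K G)) (carrier M))}"

definition Thick_k ::
  "('k, 'c) ring_scheme \<Rightarrow> ('g, 'd) monoid_scheme \<Rightarrow> ('g \<Rightarrow> 'k, 'u) module set" where
  "Thick_k K G = Thick (group_algebra K G) (trivial_modules K G)"

definition ghost ::
  "('k, 'c) ring_scheme \<Rightarrow> ('g, 'd) monoid_scheme \<Rightarrow>
    ('g \<Rightarrow> 'k, 'u) module \<Rightarrow> ('g \<Rightarrow> 'k, 'u) module \<Rightarrow> ('u \<Rightarrow> 'u) \<Rightarrow> bool" where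
  "ghost K G M N f \<longleftrightarrow> f \<in> mod_hom (group_algebra K G) M N \<and>
     (\<forall>(n::int) T W. T \<in> trivial_modules K G \<longrightarrow> Omega_power (group_algebra K G) n T W \<longrightarrow>
        (\<forall>g\<in>mod_hom (group_algebra K G) W M. stably_zero (group_algebra K G) W N (f \<circ> g)))"

text \<open>\<open>ghost_composite K G n M N f\<close>: the map \<open>f\<close> from \<open>M\<close> to \<open>N\<close> is a composite of \<open>n\<close> ghosts
  between objects of \<open>Thick_k K G\<close>.\<close>

inductive ghost_composite ::
  "('k, 'c) ring_scheme \<Rightarrow> ('g, 'd) monoid_scheme \<Rightarrow> nat \<Rightarrow>
    ('g \<Rightarrow> 'k, 'u) module \<Rightarrow> ('g \<Rightarrow> 'k, 'u) module \<Rightarrow> ('u \<Rightarrow> 'u) \<Rightarrow> bool"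
  for K :: "('k, 'c) ring_scheme" and G :: "('g, 'd) monoid_scheme" where
  none: "\<lbrakk>M \<in> Thick_k K G; N \<in> Thick_k K G; f \<in> mod_hom (group_algebra K G) M N\<rbrakk>
    \<Longrightarrow> ghost_composite K G 0 M N f"
| single: "\<lbrakk>M \<in> Thick_k K G; N \<in> Thick_k K G; ghost K G M N f\<rbrakk>
    \<Longrightarrow> ghost_composite K G 1 M N f"
| step: "\<lbrakk>ghost_composite K G n M N f; n \<ge> 1; L \<in> Thick_k K G; ghost K G N L g\<rbrakk>
    \<Longrightarrow> ghost_composite K G (Suc n) M L (g \<circ> f)"

text \<open>The infimum of the empty set is \<open>\<infinity>\<close>, so the value is \<open>\<infinity>\<close> if no \<open>n\<close> qualifies.\<close>

definition ghost_length ::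
  "('k, 'c) ring_scheme \<Rightarrow> ('g, 'd) monoid_scheme \<Rightarrow> ('g \<Rightarrow> 'k, 'u) module \<Rightarrow> enat" where
  "ghost_length K G M = Inf {enat n | n.
     \<forall>N f. ghost_composite K G n M N f \<longrightarrow> stably_zero (group_algebra K G) M N f}"

definition ghost_number ::
  "'u itself \<Rightarrow> ('k, 'c) ring_scheme \<Rightarrow> ('g, 'd) monoid_scheme \<Rightarrow> enat" where
  "ghost_number _ K G = (SUP M \<in> (Thick_k K G :: ('g \<Rightarrow> 'k, 'u) module set). ghost_length K G M)"

text \<open>
  A type is large enough to serve as universe if it is infinite and contains a copy of \<open>k\<close>. For
  finite \<open>G\<close> it then contains a copy of the free module on every module it contains, so that
  projectivity and syzygies have their usual meaning.
\<close>

definition module_universe :: "'u itself \<Rightarrow> ('k, 'c) ring_scheme \<Rightarrow> bool" where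
  "module_universe _ K \<longleftrightarrow>
     infinite (UNIV :: 'u set) \<and> (\<exists>i :: 'k \<Rightarrow> 'u. inj_on i (carrier K))"

end

theory Submission
  imports Defs "HOL-Algebra.Group_Action" "HOL-Algebra.Multiplicative_Group"
begin

text \<open>
  Why the theorem holds. Let \<open>R = kG\<close>. A \<open>p\<close>-group has a series \<open>1 = H\<^sub>0 < \<dots> < H\<^sub>r = G\<close> of normal
  subgroups such that \<open>H\<^sub>j\<^sub>+\<^sub>1\<close> is obtained from \<open>H\<^sub>j\<close> by adjoining one element \<open>x\<^sub>j\<close> that is central
  modulo \<open>H\<^sub>j\<close> and has \<open>p\<close>-th power in \<open>H\<^sub>j\<close> (\<open>central_series_exists\<close>). Write \<open>\<N> H\<close> for the sum of the
  elements of \<open>H\<close>. In characteristic \<open>p\<close> one has \<open>1 + x + \<dots> + x\<^sup>p\<^sup>-\<^sup>1 = (x - 1)\<^sup>p\<^sup>-\<^sup>1\<close>, and therefore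
  \<open>\<N> H\<^sub>j\<^sub>+\<^sub>1 = \<N> H\<^sub>j (x\<^sub>j - 1)\<^sup>p\<^sup>-\<^sup>1\<close> (\<open>norm_extension\<close>).

  The group \<open>H = H\<^sub>1\<close> is central and cyclic of order \<open>p\<close>. The module that witnesses the bound is the
  left ideal \<open>M = R \<N> H\<close>, that is, the trivial module induced from \<open>H\<close> to \<open>G\<close>. Right multiplication by
  \<open>y - 1\<close>, for \<open>y \<in> G\<close>, is a ghost on \<open>M\<close>: the Tate cohomology of \<open>G\<close> in \<open>M\<close> is that of \<open>H\<close> in \<open>k\<close>, and
  on the latter \<open>G\<close> acts trivially because \<open>H\<close> is central (\<open>norm_module_ghost\<close>). A composite of
  \<open>(r - 1)(p - 1)\<close> such ghosts, made from \<open>x\<^sub>1, \<dots>, x\<^sub>r\<^sub>-\<^sub>1\<close> with \<open>p - 1\<close> copies of each, sends \<open>\<N> H\<close> to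
  \<open>\<N> G \<noteq> 0\<close>. On \<open>M\<close> a map that is stably zero is zero (\<open>stably_zero_imp_zero\<close>), so this composite, and
  each of its initial segments, is not stably zero.

  For the cohomological part no cohomology groups are formed. Let \<open>c\<close> generate \<open>H\<close>, and let \<open>a = c - 1\<close>
  and \<open>b = \<N> H = a\<^sup>p\<^sup>-\<^sup>1\<close>. Then \<open>ab = 0\<close>, the Tate cohomology of \<open>H\<close> in a module \<open>W\<close> is given by
  \<open>ker a / im b\<close> and \<open>ker b / im a\<close>, and it vanishes for projective \<open>W\<close> (\<open>projective_kills_homology\<close>). Thus
  it is shifted by one step along a syzygy, and the trivial action of \<open>G\<close> passes from \<open>k\<close> to all
  \<open>\<Omega>\<^sup>nk\<close> (\<open>kills_homology_Omega_power\<close>). Frobenius reciprocity turns this into a factorization through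
  \<open>R\<close> of the maps in question. It uses that every linear functional on \<open>W\<close> is the coordinate at \<open>1\<close> of a
  homomorphism into \<open>R\<close>, and that functionals extend from subspaces, also in infinite dimension, since a
  syzygy may have an infinite free summand.

  That \<open>M\<close> lies in the thick subcategory generated by \<open>k\<close> is shown along the same series: \<open>R \<N> G\<close> is
  the trivial module, and \<open>R \<N> H\<^sub>j\<close> is an iterated extension of copies of \<open>R \<N> H\<^sub>j\<^sub>+\<^sub>1\<close>
  (\<open>thick_norm_module_step\<close>).
\<close>

section \<open>Sums in abelian groups and rings\<close>

lemma (in abelian_group) minus_eq_zero_iff:
  "x \<in> carrier G \<Longrightarrow> y \<in> carrier G \<Longrightarrow> x \<ominus> y = \<zero> \<longleftrightarrow> x = y"
  using add.inv_solve_right'[of "\<zero>" x y] by (auto simp: minus_eq)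

context abelian_monoid
begin

lemma finsum_single:
  assumes "finite A" "i \<in> A" "f i \<in> carrier G" "\<And>j. j \<in> A \<Longrightarrow> j \<noteq> i \<Longrightarrow> f j = \<zero>"
  shows "finsum G f A = f i"
proof -
  have "finsum G f A = (\<Oplus>j\<in>A. if i = j then f j else \<zero>)"
    using assms by (intro finsum_cong') auto
  also have "\<dots> = f i"
    using assms add.finprod_singleton[of i A "\<lambda>_. f i"]
    by (subst finsum_cong'[where g = "\<lambda>j. if i = j then f i else \<zero>"]) auto
  finally show ?thesis .
qed

lemma finsum_swap:
  assumes "finite A" "finite B" "\<And>i j. i \<in> A \<Longrightarrow> j \<in> B \<Longrightarrow> f i j \<in> carrier G"
  shows "(\<Oplus>i\<in>A. \<Oplus>j\<in>B. f i j) = (\<Oplus>j\<in>B. \<Oplus>i\<in>A. f i j)"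
  using assms(1,3)
proof induction
  case empty
  show ?case by simp
next
  case (insert i A)
  have "(\<Oplus>j\<in>B. \<Oplus>k\<in>insert i A. f k j) = (\<Oplus>j\<in>B. f i j \<oplus> (\<Oplus>k\<in>A. f k j))"
    using insert.hyps insert.prems by (intro finsum_cong') auto
  also have "\<dots> = (\<Oplus>j\<in>B. f i j) \<oplus> (\<Oplus>j\<in>B. \<Oplus>k\<in>A. f k j)"
    using insert.prems by (intro finsum_addf) auto
  also have "\<dots> = (\<Oplus>j\<in>B. f i j) \<oplus> (\<Oplus>k\<in>A. \<Oplus>j\<in>B. f k j)"
    using insert by simp
  also have "\<dots> = (\<Oplus>k\<in>insert i A. \<Oplus>j\<in>B. f k j)"
    using insert.hyps insert.prems by (intro finsum_insert[symmetric]) auto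
  finally show ?case by simp
qed

end

lemma additive_finsum:
  assumes "abelian_group A" "abelian_group B"
    and cl: "\<And>x. x \<in> carrier A \<Longrightarrow> h x \<in> carrier B"
    and add: "\<And>x y. x \<in> carrier A \<Longrightarrow> y \<in> carrier A \<Longrightarrow> h (x \<oplus>\<^bsub>A\<^esub> y) = h x \<oplus>\<^bsub>B\<^esub> h y"
    and t: "t \<in> I \<rightarrow> carrier A"
  shows "h (\<Oplus>\<^bsub>A\<^esub>i\<in>I. t i) = (\<Oplus>\<^bsub>B\<^esub>i\<in>I. h (t i))"
proof -
  interpret A: abelian_group A by fact
  interpret B: abelian_group B by fact
  have zero: "h \<zero>\<^bsub>A\<^esub> = \<zero>\<^bsub>B\<^esub>"
    using add[of "\<zero>\<^bsub>A\<^esub>" "\<zero>\<^bsub>A\<^esub>"] cl[of "\<zero>\<^bsub>A\<^esub>"] B.add.l_cancel_one[of "h \<zero>\<^bsub>A\<^esub>" "h \<zero>\<^bsub>A\<^esub>"] by simp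
  show ?thesis using t
    by (induction I rule: infinite_finite_induct) (simp_all add: Pi_iff zero add cl)
qed

lemma (in group) inv_mult_cancel:
  assumes "x \<in> carrier G" "y \<in> carrier G"
  shows "inv x \<otimes> (x \<otimes> y) = y" "x \<otimes> (inv x \<otimes> y) = y"
  using assms by (simp_all add: m_assoc[symmetric])

text \<open>
  Substituting \<open>u = v + 1\<close> into the geometric sum \<open>1 + u + \<dots> + u\<^sup>n\<^sup>-\<^sup>1 = ((v + 1)\<^sup>n - 1) / v\<close> gives this
  expansion. It is proved without division, by the recursion \<open>s\<^sub>n\<^sub>+\<^sub>1 = 1 + u s\<^sub>n\<close> and Pascal's rule; the
  summation bound \<open>m\<close> is kept fixed, as the additional coefficients are zero.
\<close>

lemma (in ring) sum_of_powers_eq: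
  fixes n m :: nat
  assumes v: "v \<in> carrier R" and n: "n \<le> Suc m"
  shows "(\<Oplus>i\<in>{..<n}. (v \<oplus> \<one>) [^] i) = (\<Oplus>j\<in>{..m}. [(n choose Suc j)] \<cdot> (v [^] j))"
  using n
proof (induction n)
  case 0
  have "(\<Oplus>j\<in>{..m}. [(0 choose Suc j)] \<cdot> (v [^] j)) = (\<Oplus>j\<in>{..m}. \<zero>)"
    using v by (intro finsum_cong') auto
  then show ?case by simp
next
  case (Suc n)
  note [simp] = v
  let ?u = "v \<oplus> \<one>"
  have geom: "(\<Oplus>i\<in>{..<Suc k}. ?u [^] i) = \<one> \<oplus> ?u \<otimes> (\<Oplus>i\<in>{..<k}. ?u [^] i)" for k :: nat
  proof (induction k)
    case 0
    show ?case by (simp add: lessThan_Suc)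
  next
    case (Suc k)
    have "(\<Oplus>i\<in>{..<Suc (Suc k)}. ?u [^] i) = ?u [^] Suc k \<oplus> (\<Oplus>i\<in>{..<Suc k}. ?u [^] i)"
      by (subst lessThan_Suc, subst finsum_insert) auto
    also have "\<dots> = \<one> \<oplus> (?u \<otimes> ?u [^] k \<oplus> ?u \<otimes> (\<Oplus>i\<in>{..<k}. ?u [^] i))"
      by (subst Suc, subst nat_pow_Suc2) (simp_all add: a_ac Pi_iff del: nat_pow_Suc)
    also have "?u \<otimes> ?u [^] k \<oplus> ?u \<otimes> (\<Oplus>i\<in>{..<k}. ?u [^] i)
      = ?u \<otimes> (?u [^] k \<oplus> (\<Oplus>i\<in>{..<k}. ?u [^] i))"
      by (subst r_distr) (auto intro!: finsum_closed)
    also have "?u [^] k \<oplus> (\<Oplus>i\<in>{..<k}. ?u [^] i) = (\<Oplus>i\<in>{..<Suc k}. ?u [^] i)"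
      by (subst lessThan_Suc, subst finsum_insert) auto
    finally show ?case .
  qed
  let ?T = "\<Oplus>j\<in>{..m}. [(n choose Suc j)] \<cdot> (v [^] j)"
  have T: "?T \<in> carrier R" by (intro finsum_closed) auto
  have "v \<otimes> ?T \<oplus> \<one> = (\<Oplus>j\<in>{..m}. [(n choose Suc j)] \<cdot> (v [^] Suc j)) \<oplus> [(n choose 0)] \<cdot> (v [^] (0::nat))"
    by (subst finsum_rdistr)
      (auto simp: add_pow_rdistr nat_pow_Suc2[symmetric] simp del: nat_pow_Suc intro!: finsum_cong'
        arg_cong2[where f = "(\<oplus>)"])
  also have "\<dots> = (\<Oplus>j\<in>{..Suc m}. [(n choose j)] \<cdot> (v [^] j))"
    by (intro finsum_Suc2[symmetric]) auto
  also have "\<dots> = [(n choose Suc m)] \<cdot> (v [^] Suc m) \<oplus> (\<Oplus>j\<in>{..m}. [(n choose j)] \<cdot> (v [^] j))"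
    by (intro finsum_Suc) auto
  also have "\<dots> = (\<Oplus>j\<in>{..m}. [(n choose j)] \<cdot> (v [^] j))"
    using Suc.prems by (subst binomial_eq_0) (auto intro!: l_zero finsum_closed)
  finally have shift: "v \<otimes> ?T \<oplus> \<one> = (\<Oplus>j\<in>{..m}. [(n choose j)] \<cdot> (v [^] j))" .
  have "(\<Oplus>i\<in>{..<Suc n}. ?u [^] i) = \<one> \<oplus> ?u \<otimes> ?T"
    using Suc geom[of n] by simp
  also have "\<dots> = (v \<otimes> ?T \<oplus> \<one>) \<oplus> ?T" using T by (simp add: l_distr a_ac)
  also have "\<dots> = (\<Oplus>j\<in>{..m}. [(n choose j)] \<cdot> (v [^] j) \<oplus> [(n choose Suc j)] \<cdot> (v [^] j))"
    unfolding shift by (intro finsum_addf[symmetric]) auto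
  also have "\<dots> = (\<Oplus>j\<in>{..m}. [(Suc n choose Suc j)] \<cdot> (v [^] j))"
    by (intro finsum_cong') (auto simp: add.nat_pow_mult)
  finally show ?case .
qed

text \<open>
  In characteristic \<open>p\<close> the polynomial \<open>1 + X + \<dots> + X\<^sup>p\<^sup>-\<^sup>1\<close> is \<open>(X - 1)\<^sup>p\<^sup>-\<^sup>1\<close>: in powers of
  \<open>v = X - 1\<close> its coefficients are the binomial coefficients of \<open>p\<close> above the first.
\<close>

lemma (in ring) sum_of_powers_prime_char:
  fixes p :: nat
  assumes p: "Factorial_Ring.prime p" and char: "[p] \<cdot> \<one> = \<zero>" and u: "u \<in> carrier R"
  shows "(u \<ominus> \<one>) [^] (p - 1) = (\<Oplus>i\<in>{..<p}. u [^] i)"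
proof -
  define v where "v = u \<ominus> \<one>"
  have v: "v \<in> carrier R" "v \<oplus> \<one> = u" using u by (simp_all add: v_def minus_eq a_assoc l_neg)
  have p1: "1 < p" using p by (rule prime_gt_1_nat)
  have multiple: "[k] \<cdot> x = \<zero>" if "p dvd k" "x \<in> carrier R" for k x
  proof -
    obtain m where "k = p * m" using \<open>p dvd k\<close> by blast
    moreover have "[p] \<cdot> x = \<zero>"
      using char add_pow_ldistr[of \<one> x p] that by simp
    ultimately show ?thesis using that by (simp add: add.nat_pow_pow[symmetric])
  qed
  have "(\<Oplus>i\<in>{..<p}. u [^] i) = (\<Oplus>j\<in>{..p - 1}. [(p choose Suc j)] \<cdot> (v [^] j))"
    using sum_of_powers_eq[OF v(1), of p "p - 1"] by (simp add: v)
  also have "\<dots> = [(p choose Suc (p - 1))] \<cdot> (v [^] (p - 1))"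
  proof (rule finsum_single)
    fix j assume "j \<in> {..p - 1}" "j \<noteq> p - 1"
    then show "[(p choose Suc j)] \<cdot> (v [^] j) = \<zero>"
      using p v p1 by (intro multiple dvd_choose_prime) auto
  qed (use v in auto)
  finally show ?thesis using p1 v by (simp add: v_def[symmetric] nat_pow_closed)
qed

section \<open>Modules over a noncommutative ring\<close>

context left_module
begin

lemma smult_zero_left: "x \<in> carrier M \<Longrightarrow> \<zero>\<^bsub>R\<^esub> \<odot>\<^bsub>M\<^esub> x = \<zero>\<^bsub>M\<^esub>"
  by (metis M.add.l_cancel_one R.l_zero R.zero_closed smult_closed smult_l_distr)

lemma smult_zero_right: "a \<in> carrier R \<Longrightarrow> a \<odot>\<^bsub>M\<^esub> \<zero>\<^bsub>M\<^esub> = \<zero>\<^bsub>M\<^esub>"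
  by (metis M.add.l_cancel_one M.l_zero M.zero_closed smult_closed smult_r_distr)

lemma smult_minus_left:
  "\<lbrakk>a \<in> carrier R; x \<in> carrier M\<rbrakk> \<Longrightarrow> (\<ominus>\<^bsub>R\<^esub> a) \<odot>\<^bsub>M\<^esub> x = \<ominus>\<^bsub>M\<^esub> (a \<odot>\<^bsub>M\<^esub> x)"
  by (metis M.minus_equality R.a_inv_closed R.l_neg smult_closed smult_l_distr smult_zero_left)

lemma smult_minus_right:
  "\<lbrakk>a \<in> carrier R; x \<in> carrier M\<rbrakk> \<Longrightarrow> a \<odot>\<^bsub>M\<^esub> (\<ominus>\<^bsub>M\<^esub> x) = \<ominus>\<^bsub>M\<^esub> (a \<odot>\<^bsub>M\<^esub> x)"
  by (metis M.minus_equality M.a_inv_closed M.l_neg smult_closed smult_r_distr smult_zero_right)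

lemma smult_diff_left:
  "\<lbrakk>a \<in> carrier R; b \<in> carrier R; x \<in> carrier M\<rbrakk>
    \<Longrightarrow> (a \<ominus>\<^bsub>R\<^esub> b) \<odot>\<^bsub>M\<^esub> x = a \<odot>\<^bsub>M\<^esub> x \<ominus>\<^bsub>M\<^esub> b \<odot>\<^bsub>M\<^esub> x"
  by (simp add: a_minus_def smult_l_distr smult_minus_left)

lemma smult_diff_right:
  "\<lbrakk>a \<in> carrier R; x \<in> carrier M; y \<in> carrier M\<rbrakk>
    \<Longrightarrow> a \<odot>\<^bsub>M\<^esub> (x \<ominus>\<^bsub>M\<^esub> y) = a \<odot>\<^bsub>M\<^esub> x \<ominus>\<^bsub>M\<^esub> a \<odot>\<^bsub>M\<^esub> y"
  by (simp add: a_minus_def smult_r_distr smult_minus_right)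

lemma smult_finsum_right:
  assumes "a \<in> carrier R" "f \<in> A \<rightarrow> carrier M"
  shows "a \<odot>\<^bsub>M\<^esub> (\<Oplus>\<^bsub>M\<^esub>i\<in>A. f i) = (\<Oplus>\<^bsub>M\<^esub>i\<in>A. a \<odot>\<^bsub>M\<^esub> f i)"
proof (cases "finite A")
  case True
  then show ?thesis using assms(2)
  proof (induction A)
    case (insert i A)
    then show ?case
      using assms(1) by (simp add: Pi_iff smult_r_distr smult_closed M.finsum_insert)
  qed (simp add: assms(1) smult_zero_right)
qed (simp add: assms(1) smult_zero_right M.finsum_infinite)

lemma smult_finsum_left:
  assumes "x \<in> carrier M" "f \<in> A \<rightarrow> carrier R"
  shows "(\<Oplus>\<^bsub>R\<^esub>i\<in>A. f i) \<odot>\<^bsub>M\<^esub> x = (\<Oplus>\<^bsub>M\<^esub>i\<in>A. f i \<odot>\<^bsub>M\<^esub> x)"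
proof (cases "finite A")
  case True
  then show ?thesis using assms(2)
  proof (induction A)
    case (insert i A)
    then show ?case
      using assms(1) by (simp add: Pi_iff smult_l_distr smult_closed M.finsum_insert R.finsum_insert)
  qed (simp add: assms(1) smult_zero_left)
qed (simp add: assms(1) smult_zero_left M.finsum_infinite R.finsum_infinite)

lemma left_module_submodule:
  assumes "L \<subseteq> carrier M" "\<zero>\<^bsub>M\<^esub> \<in> L"
    and "\<And>x y. x \<in> L \<Longrightarrow> y \<in> L \<Longrightarrow> x \<oplus>\<^bsub>M\<^esub> y \<in> L"
    and "\<And>a x. a \<in> carrier R \<Longrightarrow> x \<in> L \<Longrightarrow> a \<odot>\<^bsub>M\<^esub> x \<in> L"
  shows "left_module R (M\<lparr>carrier := L\<rparr>)"
proof -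
  have "\<exists>y\<in>L. y \<oplus>\<^bsub>M\<^esub> x = \<zero>\<^bsub>M\<^esub>" if "x \<in> L" for x
    using that assms(1) assms(4)[of "\<ominus>\<^bsub>R\<^esub> \<one>\<^bsub>R\<^esub>" x] smult_minus_left[of "\<one>\<^bsub>R\<^esub>" x]
      smult_one[of x] M.l_neg[of x] by (auto intro!: bexI[of _ "\<ominus>\<^bsub>M\<^esub> x"])
  then have "abelian_group (M\<lparr>carrier := L\<rparr>)"
    using assms by (intro abelian_groupI) (auto simp: subset_iff M.a_ac)
  then show ?thesis
    using assms R.ring_axioms unfolding left_module_def left_module_axioms_def
    by (auto simp: subset_iff smult_l_distr smult_r_distr smult_assoc smult_one)
qed

end

lemma left_module_abelian_group: "left_module R M \<Longrightarrow> abelian_group M"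
  by (simp add: left_module_def)

lemma mod_homI:
  assumes "\<And>x. x \<in> carrier M \<Longrightarrow> f x \<in> carrier N"
    and "\<And>x y. x \<in> carrier M \<Longrightarrow> y \<in> carrier M \<Longrightarrow> f (x \<oplus>\<^bsub>M\<^esub> y) = f x \<oplus>\<^bsub>N\<^esub> f y"
    and "\<And>a x. a \<in> carrier R \<Longrightarrow> x \<in> carrier M \<Longrightarrow> f (a \<odot>\<^bsub>M\<^esub> x) = a \<odot>\<^bsub>N\<^esub> f x"
  shows "f \<in> mod_hom R M N"
  using assms by (auto simp: mod_hom_def)

lemma mod_hom_closed: "f \<in> mod_hom R M N \<Longrightarrow> x \<in> carrier M \<Longrightarrow> f x \<in> carrier N"
  and mod_hom_add: "f \<in> mod_hom R M N \<Longrightarrow> x \<in> carrier M \<Longrightarrow> y \<in> carrier M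
    \<Longrightarrow> f (x \<oplus>\<^bsub>M\<^esub> y) = f x \<oplus>\<^bsub>N\<^esub> f y"
  and mod_hom_smult: "f \<in> mod_hom R M N \<Longrightarrow> a \<in> carrier R \<Longrightarrow> x \<in> carrier M
    \<Longrightarrow> f (a \<odot>\<^bsub>M\<^esub> x) = a \<odot>\<^bsub>N\<^esub> f x"
  by (auto simp: mod_hom_def)

lemma mod_hom_comp:
  "f \<in> mod_hom R L M \<Longrightarrow> g \<in> mod_hom R M N \<Longrightarrow> g \<circ> f \<in> mod_hom R L N"
  by (auto simp: mod_hom_def Pi_iff)

lemma mod_hom_id: "id \<in> mod_hom R M M"
  by (auto simp: mod_hom_def)

context
  fixes R :: "('r, 'x) ring_scheme" and M :: "('r, 'a) module" and N :: "('r, 'b) module" and f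
  assumes M: "left_module R M" and N: "left_module R N" and f: "f \<in> mod_hom R M N"
begin

interpretation M: left_module R M by fact
interpretation N: left_module R N by fact

lemma mod_hom_zero: "f \<zero>\<^bsub>M\<^esub> = \<zero>\<^bsub>N\<^esub>"
  by (metis M.R.zero_closed M.smult_zero_left M.M.zero_closed N.smult_zero_left f mod_hom_closed
      mod_hom_smult)

lemma mod_hom_minus: "x \<in> carrier M \<Longrightarrow> f (\<ominus>\<^bsub>M\<^esub> x) = \<ominus>\<^bsub>N\<^esub> f x"
  using mod_hom_add[OF f, of "\<ominus>\<^bsub>M\<^esub> x" x] mod_hom_closed[OF f]
  by (intro N.M.minus_equality[symmetric]) (simp_all add: M.M.l_neg mod_hom_zero)

lemma mod_hom_diff: "x \<in> carrier M \<Longrightarrow> y \<in> carrier M \<Longrightarrow> f (x \<ominus>\<^bsub>M\<^esub> y) = f x \<ominus>\<^bsub>N\<^esub> f y"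
  by (simp add: a_minus_def mod_hom_add[OF f] mod_hom_minus)

lemma mod_hom_eq_iff_diff_kernel:
  "x \<in> carrier M \<Longrightarrow> y \<in> carrier M \<Longrightarrow> f x = f y \<longleftrightarrow> f (x \<ominus>\<^bsub>M\<^esub> y) = \<zero>\<^bsub>N\<^esub>"
  by (simp add: mod_hom_diff mod_hom_closed[OF f] N.M.minus_eq_zero_iff)

end

text \<open>
  A homomorphism carries the module axioms forward to everything in its image. This is how
  isomorphic copies and quotients are obtained.
\<close>

lemma left_module_surjective_image:
  assumes B: "left_module R B" and f: "f \<in> mod_hom R B C" and surj: "f ` carrier B = carrier C"
    and zero: "f \<zero>\<^bsub>B\<^esub> = \<zero>\<^bsub>C\<^esub>"
  shows "left_module R C"
proof -
  interpret B: left_module R B by fact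
  note [simp] = mod_hom_add[OF f, symmetric] mod_hom_smult[OF f, symmetric] zero[symmetric]
  have inv: "\<exists>y\<in>carrier B. f (x \<oplus>\<^bsub>B\<^esub> y) = f \<zero>\<^bsub>B\<^esub>" if "x \<in> carrier B" for x
    using that by (intro bexI[of _ "\<ominus>\<^bsub>B\<^esub> x"]) (auto simp: B.M.r_neg)
  have "abelian_group C"
    by (rule abelian_groupI)
      (auto simp: surj[symmetric] inv B.M.a_ac)
  then show ?thesis
    unfolding left_module_def left_module_axioms_def
    by (auto simp: surj[symmetric] B.R.ring_axioms B.smult_closed B.smult_l_distr B.smult_r_distr
        B.smult_assoc B.smult_one)
qed

text \<open>
  The quotient of \<open>B\<close> by the kernel relation of \<open>\<rho>\<close>, with the values of \<open>\<rho>\<close> as elements. For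
  injective \<open>\<rho>\<close> it is a copy of \<open>B\<close> in another type; if \<open>\<rho>\<close> chooses representatives of cosets,
  it is a quotient module.
\<close>

definition image_module :: "('v \<Rightarrow> 'u) \<Rightarrow> ('r, 'v) module \<Rightarrow> ('r, 'u) module" where
  "image_module \<rho> B = \<lparr>carrier = \<rho> ` carrier B,
     monoid.mult = (\<lambda>x y. x), monoid.one = \<rho> \<zero>\<^bsub>B\<^esub>, ring.zero = \<rho> \<zero>\<^bsub>B\<^esub>,
     ring.add = (\<lambda>x y. \<rho> (inv_into (carrier B) \<rho> x \<oplus>\<^bsub>B\<^esub> inv_into (carrier B) \<rho> y)),
     smult = (\<lambda>a x. \<rho> (a \<odot>\<^bsub>B\<^esub> inv_into (carrier B) \<rho> x))\<rparr>"

lemma carrier_image_module: "carrier (image_module \<rho> B) = \<rho> ` carrier B"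
  and zero_image_module: "\<zero>\<^bsub>image_module \<rho> B\<^esub> = \<rho> \<zero>\<^bsub>B\<^esub>"
  by (simp_all add: image_module_def)

lemma image_module:
  assumes B: "left_module R B"
    and add: "\<And>x x' y y'. \<lbrakk>x \<in> carrier B; x' \<in> carrier B; y \<in> carrier B; y' \<in> carrier B;
        \<rho> x = \<rho> x'; \<rho> y = \<rho> y'\<rbrakk> \<Longrightarrow> \<rho> (x \<oplus>\<^bsub>B\<^esub> y) = \<rho> (x' \<oplus>\<^bsub>B\<^esub> y')"
    and smult: "\<And>a x x'. \<lbrakk>a \<in> carrier R; x \<in> carrier B; x' \<in> carrier B; \<rho> x = \<rho> x'\<rbrakk>
        \<Longrightarrow> \<rho> (a \<odot>\<^bsub>B\<^esub> x) = \<rho> (a \<odot>\<^bsub>B\<^esub> x')"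
  shows "left_module R (image_module \<rho> B)" "\<rho> \<in> mod_hom R B (image_module \<rho> B)"
proof -
  have inv: "inv_into (carrier B) \<rho> (\<rho> x) \<in> carrier B" "\<rho> (inv_into (carrier B) \<rho> (\<rho> x)) = \<rho> x"
    if "x \<in> carrier B" for x
    using that by (auto intro: inv_into_into f_inv_into_f)
  show \<rho>: "\<rho> \<in> mod_hom R B (image_module \<rho> B)"
    by (rule mod_homI) (auto simp: image_module_def inv intro!: add smult)
  show "left_module R (image_module \<rho> B)"
    by (rule left_module_surjective_image[OF B \<rho>])
      (simp_all add: carrier_image_module zero_image_module)
qed

lemma image_module_inj:
  assumes B: "left_module R B" and inj: "inj_on \<rho> (carrier B)"
  shows "left_module R (image_module \<rho> B)" "\<rho> \<in> mod_hom R B (image_module \<rho> B)"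
    "inv_into (carrier B) \<rho> \<in> mod_hom R (image_module \<rho> B) B"
proof -
  have eq: "x = x'" if "x \<in> carrier B" "x' \<in> carrier B" "\<rho> x = \<rho> x'" for x x'
    using that inj by (simp add: inj_on_eq_iff)
  have *: "left_module R (image_module \<rho> B) \<and> \<rho> \<in> mod_hom R B (image_module \<rho> B)"
    by (intro conjI image_module[OF B]) (metis eq)+
  then show "left_module R (image_module \<rho> B)" "\<rho> \<in> mod_hom R B (image_module \<rho> B)" by auto
  interpret B: left_module R B by fact
  show "inv_into (carrier B) \<rho> \<in> mod_hom R (image_module \<rho> B) B"
    by (rule mod_homI)
      (auto simp: carrier_image_module inj mod_hom_add[OF conjunct2[OF *], symmetric]
        mod_hom_smult[OF conjunct2[OF *], symmetric] B.smult_closed)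
qed

text \<open>
  The quotient has coset representatives as its elements, which keeps it in the type of \<open>J\<close> and hence in
  the universe of modules that the stable category is formed from.
\<close>

lemma quotient_module_exists:
  fixes J :: "('r, 'u) module"
  assumes J: "left_module R J" and L: "L \<subseteq> carrier J" and LJ: "left_module R (J\<lparr>carrier := L\<rparr>)"
  obtains S :: "('r, 'u) module" and q where "left_module R S" "q \<in> mod_hom R J S"
    "q ` carrier J = carrier S" "{y \<in> carrier J. q y = \<zero>\<^bsub>S\<^esub>} = L"
proof -
  interpret J: left_module R J by fact
  interpret L: left_module R "J\<lparr>carrier := L\<rparr>" by fact
  have L0: "\<zero>\<^bsub>J\<^esub> \<in> L" and Ladd: "\<And>x y. x \<in> L \<Longrightarrow> y \<in> L \<Longrightarrow> x \<oplus>\<^bsub>J\<^esub> y \<in> L"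
    and Lsm: "\<And>a x. a \<in> carrier R \<Longrightarrow> x \<in> L \<Longrightarrow> a \<odot>\<^bsub>J\<^esub> x \<in> L"
    using L.M.zero_closed L.M.a_closed L.smult_closed by auto
  have Lneg: "\<ominus>\<^bsub>J\<^esub> x \<in> L" if "x \<in> L" for x
    using Lsm[of "\<ominus>\<^bsub>R\<^esub> \<one>\<^bsub>R\<^esub>" x] J.smult_minus_left[of "\<one>\<^bsub>R\<^esub>" x] J.smult_one[of x] that L by auto
  define \<rho> where "\<rho> = (\<lambda>v. SOME u. u \<in> carrier J \<and> u \<ominus>\<^bsub>J\<^esub> v \<in> L)"
  have some: "\<rho> v \<in> carrier J" "\<rho> v \<ominus>\<^bsub>J\<^esub> v \<in> L" if "v \<in> carrier J" for v
    using someI[of "\<lambda>u. u \<in> carrier J \<and> u \<ominus>\<^bsub>J\<^esub> v \<in> L" v] that L0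
    by (auto simp: \<rho>_def J.M.minus_eq J.M.r_neg)
  have split: "u \<ominus>\<^bsub>J\<^esub> w = (u \<ominus>\<^bsub>J\<^esub> v) \<oplus>\<^bsub>J\<^esub> (v \<ominus>\<^bsub>J\<^esub> w)" "v \<ominus>\<^bsub>J\<^esub> u = \<ominus>\<^bsub>J\<^esub> (u \<ominus>\<^bsub>J\<^esub> v)"
    if "u \<in> carrier J" "v \<in> carrier J" "w \<in> carrier J" for u v w
    using that by (simp_all add: J.M.minus_eq J.M.minus_add J.M.a_ac J.M.r_neg2 J.M.r_neg1)
  have eq_iff: "\<rho> u = \<rho> v \<longleftrightarrow> u \<ominus>\<^bsub>J\<^esub> v \<in> L" if uv: "u \<in> carrier J" "v \<in> carrier J" for u v
  proof
    assume "\<rho> u = \<rho> v"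
    then have "u \<ominus>\<^bsub>J\<^esub> v = \<ominus>\<^bsub>J\<^esub> (\<rho> u \<ominus>\<^bsub>J\<^esub> u) \<oplus>\<^bsub>J\<^esub> (\<rho> v \<ominus>\<^bsub>J\<^esub> v)"
      using split uv some(1) by metis
    then show "u \<ominus>\<^bsub>J\<^esub> v \<in> L" using some(2) uv Ladd Lneg by simp
  next
    assume *: "u \<ominus>\<^bsub>J\<^esub> v \<in> L"
    have "w \<ominus>\<^bsub>J\<^esub> u \<in> L \<longleftrightarrow> w \<ominus>\<^bsub>J\<^esub> v \<in> L" if "w \<in> carrier J" for w
      using split[of w u v] split[of w v u] split(2)[of u v u] * uv that Ladd Lneg by metis
    then show "\<rho> u = \<rho> v" unfolding \<rho>_def by (metis)
  qed
  have swap: "(x \<oplus>\<^bsub>J\<^esub> y) \<ominus>\<^bsub>J\<^esub> (x' \<oplus>\<^bsub>J\<^esub> y') = (x \<ominus>\<^bsub>J\<^esub> x') \<oplus>\<^bsub>J\<^esub> (y \<ominus>\<^bsub>J\<^esub> y')"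
    if "x \<in> carrier J" "x' \<in> carrier J" "y \<in> carrier J" "y' \<in> carrier J" for x x' y y'
    using that by (simp add: J.M.minus_eq J.M.minus_add J.M.a_ac)
  have *: "left_module R (image_module \<rho> J)" "\<rho> \<in> mod_hom R J (image_module \<rho> J)"
    by (rule image_module[OF J];
        simp add: eq_iff J.smult_closed J.smult_diff_right[symmetric] Lsm swap Ladd)+
  have "y \<ominus>\<^bsub>J\<^esub> \<zero>\<^bsub>J\<^esub> = y" if "y \<in> carrier J" for y
    using that by (simp add: J.M.minus_eq)
  then have "{y \<in> carrier J. \<rho> y = \<zero>\<^bsub>image_module \<rho> J\<^esub>} = L"
    using L by (auto simp: zero_image_module eq_iff)
  with * show ?thesis
    by (intro that[of "image_module \<rho> J" \<rho>]) (simp_all add: carrier_image_module)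
qed

definition regular_module :: "('r, 'x) ring_scheme \<Rightarrow> ('r, 'r) module" where
  "regular_module R = \<lparr>carrier = carrier R, monoid.mult = monoid.mult R, monoid.one = \<one>\<^bsub>R\<^esub>,
     ring.zero = \<zero>\<^bsub>R\<^esub>, ring.add = ring.add R, smult = monoid.mult R\<rparr>"

lemma regular_module_simps [simp]:
  "carrier (regular_module R) = carrier R" "\<zero>\<^bsub>regular_module R\<^esub> = \<zero>\<^bsub>R\<^esub>"
  "x \<oplus>\<^bsub>regular_module R\<^esub> y = x \<oplus>\<^bsub>R\<^esub> y" "x \<odot>\<^bsub>regular_module R\<^esub> y = x \<otimes>\<^bsub>R\<^esub> y"
  by (simp_all add: regular_module_def)

lemma finsum_regular_module [simp]: "finsum (regular_module R) f A = finsum R f A"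
  by (simp add: finsum_def regular_module_def finprod_def)

lemma (in ring) left_module_regular: "left_module R (regular_module R)"
proof -
  have "abelian_group (regular_module R)"
    by (rule abelian_groupI) (auto simp: a_ac intro!: bexI[of _ "\<ominus> _"] l_neg)
  then show ?thesis
    using ring_axioms by (simp add: left_module_def left_module_axioms_def l_distr r_distr m_assoc)
qed

text \<open>
  A homomorphism from the regular module is determined by the image of \<open>1\<close>, which can be lifted along
  a surjection.
\<close>

lemma (in ring) projective_regular_copy:
  fixes \<rho> :: "'a \<Rightarrow> 'u"
  assumes inj: "inj_on \<rho> (carrier R)"
  shows "projective_module R (image_module \<rho> (regular_module R))"
  unfolding projective_module_def
proof (intro conjI allI impI)
  let ?P = "image_module \<rho> (regular_module R)"
  have inj': "inj_on \<rho> (carrier (regular_module R))" using inj by simp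
  note copy = image_module_inj[OF left_module_regular inj']
  show "left_module R ?P" by (rule copy(1))
  fix A B :: "('a, 'u) module" and g f
  assume A: "left_module R A" and B: "left_module R B" and g: "g \<in> mod_hom R A B"
    and surj: "g ` carrier A = carrier B" and f: "f \<in> mod_hom R ?P B"
  interpret A: left_module R A by fact
  have 1: "\<rho> \<one> \<in> carrier ?P" by (simp add: carrier_image_module)
  then obtain a where a: "a \<in> carrier A" "g a = f (\<rho> \<one>)"
    using mod_hom_closed[OF f] surj by (metis imageE)
  define h where "h = (\<lambda>x. inv_into (carrier R) \<rho> x \<odot>\<^bsub>A\<^esub> a)"
  have inv: "inv_into (carrier R) \<rho> \<in> mod_hom R ?P (regular_module R)" using copy(3) by simp
  have "h \<in> mod_hom R ?P A"
    using mod_hom_closed[OF inv] mod_hom_add[OF inv] mod_hom_smult[OF inv] a(1)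
    by (intro mod_homI) (auto simp: h_def A.smult_l_distr A.smult_assoc A.smult_closed)
  moreover have "g (h x) = f x" if x: "x \<in> carrier ?P" for x
  proof -
    have r: "inv_into (carrier R) \<rho> x \<in> carrier R" using mod_hom_closed[OF inv x] by simp
    have "f x = f (\<rho> (inv_into (carrier R) \<rho> x \<otimes> \<one>))"
      using x r by (simp add: carrier_image_module f_inv_into_f)
    also have "\<dots> = inv_into (carrier R) \<rho> x \<odot>\<^bsub>B\<^esub> f (\<rho> \<one>)"
      using mod_hom_smult[OF f r 1] mod_hom_smult[OF copy(2), of "inv_into (carrier R) \<rho> x" \<one>] r
      by simp
    also have "\<dots> = g (h x)" using r a by (simp add: h_def mod_hom_smult[OF g])
    finally show ?thesis ..
  qed
  ultimately show "\<exists>h\<in>mod_hom R ?P A. \<forall>x\<in>carrier ?P. g (h x) = f x" by blast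
qed

section \<open>Extensions in thick subcategories\<close>

lemma mod_hom_const_zero: "left_module R N \<Longrightarrow> (\<lambda>_. \<zero>\<^bsub>N\<^esub>) \<in> mod_hom R M N"
  by (rule mod_homI)
    (simp_all add: left_module.smult_zero_right abelian_group.axioms left_module_abelian_group
      abelian_monoid.zero_closed abelian_monoid.l_zero)

text \<open>
  The difference of two equal maps is zero, and it is stably zero as soon as there is any projective
  module \<open>P\<close> for the zero map to factor through.
\<close>

lemma stably_eq_of_eq:
  fixes M N P :: "('r, 'u) module"
  assumes "left_module R N" "projective_module R P"
    and "\<And>x. x \<in> carrier M \<Longrightarrow> f x = g x \<and> g x \<in> carrier N"
  shows "stably_eq R M N f g"
proof -
  interpret N: left_module R N by fact
  have "\<forall>x\<in>carrier M. f x \<ominus>\<^bsub>N\<^esub> g x = \<zero>\<^bsub>N\<^esub>"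
    using assms(3) by (simp add: N.M.minus_eq N.M.r_neg)
  moreover have "left_module R P" using assms(2) by (simp add: projective_module_def)
  ultimately show ?thesis
    unfolding stably_eq_def stably_zero_def
    using assms(2) mod_hom_const_zero[OF assms(1)] mod_hom_const_zero[of R P M] by blast
qed

lemma stable_iso_id:
  fixes M P :: "('r, 'u) module"
  shows "left_module R M \<Longrightarrow> projective_module R P \<Longrightarrow> stable_iso R M M id"
  unfolding stable_iso_def using mod_hom_id[of R M]
  by (auto intro!: bexI[of _ id] stably_eq_of_eq)

lemma standard_imp_distinguished_triangle:
  assumes "standard_triangle R A f B g C h i I q S"
  shows "distinguished_triangle R A f B g C h i I q S"
proof -
  have ex: "short_exact R A f B g C" and su: "suspension_seq R A i I q S"
    and h: "h \<in> mod_hom R C S"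
    using assms by (auto simp: standard_triangle_def)
  have I: "projective_module R I" and left: "left_module R A" "left_module R B" "left_module R C"
      "left_module R S" and f: "f \<in> mod_hom R A B" and g: "g \<in> mod_hom R B C"
    using ex su by (auto simp: short_exact_def suspension_seq_def)
  have "suspends R A i I q S A i I q S id id"
    using mod_hom_id by (auto simp: suspends_def intro!: bexI[of _ id])
  moreover have "stably_eq R A B (id \<circ> f) (f \<circ> id)" "stably_eq R B C (id \<circ> g) (g \<circ> id)"
      "stably_eq R C S (id \<circ> h) (h \<circ> id)"
    using mod_hom_closed[OF f] mod_hom_closed[OF g] mod_hom_closed[OF h]
    by (auto intro!: stably_eq_of_eq[OF _ I] left)
  ultimately show ?thesis
    unfolding distinguished_triangle_def
    using assms left su f g h stable_iso_id[OF _ I] by blast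
qed

lemma factor_through_surjection:
  assumes B: "left_module R B" and C: "left_module R C" and S: "left_module R S"
    and g: "g \<in> mod_hom R B C" and surj: "g ` carrier B = carrier C" and k: "k \<in> mod_hom R B S"
    and ker: "\<And>y. y \<in> carrier B \<Longrightarrow> g y = \<zero>\<^bsub>C\<^esub> \<Longrightarrow> k y = \<zero>\<^bsub>S\<^esub>"
  obtains h where "h \<in> mod_hom R C S" "\<And>y. y \<in> carrier B \<Longrightarrow> h (g y) = k y"
proof -
  interpret B: left_module R B by fact
  define h where "h = k \<circ> inv_into (carrier B) g"
  have hg: "h (g y) = k y" if y: "y \<in> carrier B" for y
  proof -
    let ?y = "inv_into (carrier B) g (g y)"
    have "?y \<in> carrier B" "g ?y = g y" using y by (auto intro: inv_into_into f_inv_into_f)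
    then show ?thesis
      using y ker[of "?y \<ominus>\<^bsub>B\<^esub> y"] mod_hom_eq_iff_diff_kernel[OF B C g, of ?y y]
        mod_hom_eq_iff_diff_kernel[OF B S k, of ?y y] by (simp add: h_def)
  qed
  have "h \<in> mod_hom R C S"
  proof (rule mod_homI)
    fix x y assume "x \<in> carrier C" "y \<in> carrier C"
    then obtain u v where uv: "u \<in> carrier B" "x = g u" "v \<in> carrier B" "y = g v"
      using surj by blast
    then have "h (g (u \<oplus>\<^bsub>B\<^esub> v)) = h (g u) \<oplus>\<^bsub>S\<^esub> h (g v)" by (simp add: hg mod_hom_add[OF k])
    then show "h (x \<oplus>\<^bsub>C\<^esub> y) = h x \<oplus>\<^bsub>S\<^esub> h y" using uv by (simp add: mod_hom_add[OF g])
  next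
    fix a x assume a: "a \<in> carrier R" and "x \<in> carrier C"
    then obtain u where u: "u \<in> carrier B" "x = g u" using surj by blast
    then have "h (g (a \<odot>\<^bsub>B\<^esub> u)) = a \<odot>\<^bsub>S\<^esub> h (g u)"
      using a by (simp add: hg mod_hom_smult[OF k] B.smult_closed)
    then show "h (a \<odot>\<^bsub>C\<^esub> x) = a \<odot>\<^bsub>S\<^esub> h x" using u a by (simp add: mod_hom_smult[OF g])
  next
    fix x assume "x \<in> carrier C"
    then obtain u where "u \<in> carrier B" "x = g u" using surj by blast
    then show "h x \<in> carrier S" using mod_hom_closed[OF k] by (simp add: hg)
  qed
  then show ?thesis using hg that by blast
qed

text \<open>
  A short exact sequence gives a triangle once its first term is embedded compatibly in a
  projective module, because the cokernel of that embedding is the suspension.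
\<close>

lemma thick_subcategory_extension:
  fixes A B C J :: "('r, 'u) module"
  assumes T: "thick_subcategory R T" and J: "projective_module R J"
    and ex: "short_exact R A f B g C" and e: "e \<in> mod_hom R B J" and inj: "inj_on e (f ` carrier A)"
    and "A \<in> T" "C \<in> T"
  shows "B \<in> T"
proof -
  have A: "left_module R A" and B: "left_module R B" and C: "left_module R C"
    and f: "f \<in> mod_hom R A B" and g: "g \<in> mod_hom R B C" and injf: "inj_on f (carrier A)"
    and im: "f ` carrier A = {b \<in> carrier B. g b = \<zero>\<^bsub>C\<^esub>}" and surj: "g ` carrier B = carrier C"
    using ex by (auto simp: short_exact_def)
  have J': "left_module R J" using J by (simp add: projective_module_def)
  interpret A: left_module R A by fact
  interpret J: left_module R J by fact
  define i where "i = e \<circ> f"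
  have i: "i \<in> mod_hom R A J" unfolding i_def by (rule mod_hom_comp[OF f e])
  have "left_module R (J\<lparr>carrier := i ` carrier A\<rparr>)"
  proof (rule J.left_module_submodule)
    show "i ` carrier A \<subseteq> carrier J" using mod_hom_closed[OF i] by auto
    show "\<zero>\<^bsub>J\<^esub> \<in> i ` carrier A" using mod_hom_zero[OF A J' i] by (metis A.M.zero_closed image_eqI)
    show "x \<oplus>\<^bsub>J\<^esub> y \<in> i ` carrier A" if "x \<in> i ` carrier A" "y \<in> i ` carrier A" for x y
      using that by (auto simp: mod_hom_add[OF i, symmetric])
    show "a \<odot>\<^bsub>J\<^esub> x \<in> i ` carrier A" if "a \<in> carrier R" "x \<in> i ` carrier A" for a x
      using that by (auto simp: mod_hom_smult[OF i, symmetric] A.smult_closed)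
  qed
  then obtain S :: "('r, 'u) module" and q where S: "left_module R S" and q: "q \<in> mod_hom R J S"
    and qs: "q ` carrier J = carrier S" and kerq: "{y \<in> carrier J. q y = \<zero>\<^bsub>S\<^esub>} = i ` carrier A"
    using mod_hom_closed[OF i] by (elim quotient_module_exists[OF J', rotated]) auto
  interpret S: left_module R S by fact
  have "inj_on i (carrier A)" unfolding i_def by (rule comp_inj_on[OF injf inj])
  then have su: "suspension_seq R A i J q S"
    using A J J' S i q qs kerq by (simp add: suspension_seq_def short_exact_def)
  define k where "k = (\<lambda>y. \<ominus>\<^bsub>S\<^esub> q (e y))"
  have k: "k \<in> mod_hom R B S"
    using mod_hom_closed[OF e] mod_hom_closed[OF q]
    by (intro mod_homI) (auto simp: k_def mod_hom_add[OF e] mod_hom_add[OF q] mod_hom_smult[OF e]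
        mod_hom_smult[OF q] S.M.minus_add S.smult_minus_right)
  have "k y = \<zero>\<^bsub>S\<^esub>" if y: "y \<in> carrier B" "g y = \<zero>\<^bsub>C\<^esub>" for y
  proof -
    have "y \<in> f ` carrier A" using y im by blast
    then have "e y \<in> {y \<in> carrier J. q y = \<zero>\<^bsub>S\<^esub>}" unfolding kerq i_def by auto
    then show ?thesis by (simp add: k_def)
  qed
  then obtain h where "h \<in> mod_hom R C S" "\<And>y. y \<in> carrier B \<Longrightarrow> h (g y) = k y"
    using factor_through_surjection[OF B C S g surj k] by metis
  then have "standard_triangle R A f B g C h i J q S"
    unfolding standard_triangle_def using ex su e by (auto simp: k_def i_def)
  then have "distinguished_triangle R A f B g C h i J q S"
    by (rule standard_imp_distinguished_triangle)
  then show ?thesis using T \<open>A \<in> T\<close> \<open>C \<in> T\<close> unfolding thick_subcategory_def by blast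
qed

section \<open>Principal left ideals\<close>

definition copy_map :: "('v \<Rightarrow> 'u) \<Rightarrow> ('r, 'v) module \<Rightarrow> ('v \<Rightarrow> 'v) \<Rightarrow> 'u \<Rightarrow> 'u" where
  "copy_map \<iota> B h = \<iota> \<circ> h \<circ> inv_into (carrier B) \<iota>"

lemma copy_map_apply:
  "inj_on \<iota> (carrier B) \<Longrightarrow> x \<in> carrier B \<Longrightarrow> copy_map \<iota> B h (\<iota> x) = \<iota> (h x)"
  by (simp add: copy_map_def)

lemma copy_map_hom:
  assumes "left_module R B" "left_module R C" "inj_on \<iota> (carrier B)" "inj_on \<iota> (carrier C)"
    and "h \<in> mod_hom R B C"
  shows "copy_map \<iota> B h \<in> mod_hom R (image_module \<iota> B) (image_module \<iota> C)"
  unfolding copy_map_def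
  using image_module_inj(3)[OF assms(1,3)] image_module_inj(2)[OF assms(2,4)] assms(5)
  by (metis mod_hom_comp)

definition principal_left_module :: "('r, 'x) ring_scheme \<Rightarrow> 'r \<Rightarrow> ('r, 'r) module" where
  "principal_left_module R e = regular_module R\<lparr>carrier := (\<lambda>r. r \<otimes>\<^bsub>R\<^esub> e) ` carrier R\<rparr>"

lemma carrier_principal_left_module:
  "carrier (principal_left_module R e) = (\<lambda>r. r \<otimes>\<^bsub>R\<^esub> e) ` carrier R"
  by (simp add: principal_left_module_def)

lemma principal_left_module_ops [simp]:
  "\<zero>\<^bsub>principal_left_module R e\<^esub> = \<zero>\<^bsub>R\<^esub>"
  "x \<oplus>\<^bsub>principal_left_module R e\<^esub> y = x \<oplus>\<^bsub>R\<^esub> y"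
  "a \<odot>\<^bsub>principal_left_module R e\<^esub> x = a \<otimes>\<^bsub>R\<^esub> x"
  by (simp_all add: principal_left_module_def)

context ring
begin

lemma left_module_principal:
  assumes e: "e \<in> carrier R"
  shows "left_module R (principal_left_module R e)"
  unfolding principal_left_module_def
proof (rule left_module.left_module_submodule[OF left_module_regular])
  show "\<zero>\<^bsub>regular_module R\<^esub> \<in> (\<lambda>r. r \<otimes> e) ` carrier R"
    using e by (auto intro!: image_eqI[of _ _ \<zero>])
  show "x \<oplus>\<^bsub>regular_module R\<^esub> y \<in> (\<lambda>r. r \<otimes> e) ` carrier R"
    if "x \<in> (\<lambda>r. r \<otimes> e) ` carrier R" "y \<in> (\<lambda>r. r \<otimes> e) ` carrier R" for x y
    using that e by (auto simp: l_distr[symmetric])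
  show "a \<odot>\<^bsub>regular_module R\<^esub> x \<in> (\<lambda>r. r \<otimes> e) ` carrier R"
    if "a \<in> carrier R" "x \<in> (\<lambda>r. r \<otimes> e) ` carrier R" for a x
    using that e by (auto simp: m_assoc[symmetric])
qed (use e in auto)

lemma principal_left_module_subset:
  "e \<in> carrier R \<Longrightarrow> carrier (principal_left_module R e) \<subseteq> carrier R"
  by (auto simp: carrier_principal_left_module)

lemma self_mem_principal: "e \<in> carrier R \<Longrightarrow> e \<in> carrier (principal_left_module R e)"
  by (auto simp: carrier_principal_left_module intro!: image_eqI[of _ _ \<one>])

lemma right_mult_hom:
  assumes "e \<in> carrier R" "d \<in> carrier R" "e' \<in> carrier R"
    and ed: "e \<otimes> d \<in> carrier (principal_left_module R e')"
  shows "(\<lambda>x. x \<otimes> d) \<in> mod_hom R (principal_left_module R e) (principal_left_module R e')"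
proof (rule mod_homI)
  obtain s where s: "s \<in> carrier R" "e \<otimes> d = s \<otimes> e'"
    using ed by (auto simp: carrier_principal_left_module)
  fix x assume "x \<in> carrier (principal_left_module R e)"
  then obtain r where "r \<in> carrier R" "x = r \<otimes> e" by (auto simp: carrier_principal_left_module)
  then have "x \<otimes> d = (r \<otimes> s) \<otimes> e'" using assms s by (simp add: m_assoc)
  then show "x \<otimes> d \<in> carrier (principal_left_module R e')"
    using s \<open>r \<in> carrier R\<close> by (auto simp: carrier_principal_left_module)
qed (use assms principal_left_module_subset[OF assms(1)] in \<open>auto simp: subset_iff l_distr m_assoc\<close>)

text \<open>
  Right multiplication by \<open>d\<close> maps \<open>Re\<close> onto \<open>Red\<close>. If its kernel is again principal, this is a
  short exact sequence inside the regular module.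
\<close>

lemma principal_extension:
  fixes \<iota> :: "'a \<Rightarrow> 'u"
  assumes inj: "inj_on \<iota> (carrier R)" and e: "e \<in> carrier R" "d \<in> carrier R" "e' \<in> carrier R"
    and ker: "\<And>y. y \<in> carrier (principal_left_module R e) \<and> y \<otimes> d = \<zero> \<longleftrightarrow>
      y \<in> carrier (principal_left_module R e')"
    and T: "thick_subcategory R T"
    and sub: "image_module \<iota> (principal_left_module R e') \<in> T"
    and quot: "image_module \<iota> (principal_left_module R (e \<otimes> d)) \<in> T"
  shows "image_module \<iota> (principal_left_module R e) \<in> T"
proof -
  let ?P = "principal_left_module R"
  have inj': "inj_on \<iota> (carrier (?P x))" if "x \<in> carrier R" for x
    using inj principal_left_module_subset[OF that] by (rule inj_on_subset)
  have ed: "e \<otimes> d \<in> carrier R" using e by simp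
  note P = left_module_principal
  note copies = image_module_inj[OF P inj']
  have reg: "left_module R (regular_module R)" "inj_on \<iota> (carrier (regular_module R))"
    using inj by (simp_all add: left_module_regular)
  let ?f = "copy_map \<iota> (?P e') id" and ?g = "copy_map \<iota> (?P e) (\<lambda>x. x \<otimes> d)"
    and ?h = "copy_map \<iota> (?P e) id"
  have ff: "?f (\<iota> x) = \<iota> x" if "x \<in> carrier (?P e')" for x
    using copy_map_apply[OF inj'[OF e(3)] that] by simp
  have hh: "?h (\<iota> x) = \<iota> x" if "x \<in> carrier (?P e)" for x
    using copy_map_apply[OF inj'[OF e(1)] that] by simp
  have gg: "?g (\<iota> x) = \<iota> (x \<otimes> d)" if "x \<in> carrier (?P e)" for x
    using copy_map_apply[OF inj'[OF e(1)] that] by simp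
  have e'e: "carrier (?P e') \<subseteq> carrier (?P e)" using ker by blast
  have f: "?f \<in> mod_hom R (image_module \<iota> (?P e')) (image_module \<iota> (?P e))"
    using e'e by (intro copy_map_hom P e inj' mod_homI) auto
  have g: "?g \<in> mod_hom R (image_module \<iota> (?P e)) (image_module \<iota> (?P (e \<otimes> d)))"
    using self_mem_principal[OF ed] by (intro copy_map_hom P e ed inj' right_mult_hom)
  have h: "?h \<in> mod_hom R (image_module \<iota> (?P e)) (image_module \<iota> (regular_module R))"
    using principal_left_module_subset[OF e(1)]
    by (intro copy_map_hom P e inj' reg mod_homI) auto
  have "short_exact R (image_module \<iota> (?P e')) ?f (image_module \<iota> (?P e)) ?g
      (image_module \<iota> (?P (e \<otimes> d)))"
    unfolding short_exact_def
  proof (intro conjI f g copies(1) e ed)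
    show "inj_on ?f (carrier (image_module \<iota> (?P e')))"
      by (auto simp: carrier_image_module inj_on_def ff)
    have z: "\<iota> (x \<otimes> d) = \<iota> \<zero> \<longleftrightarrow> x \<otimes> d = \<zero>" if "x \<in> carrier (?P e)" for x
      using inj that principal_left_module_subset[OF e(1)] e by (auto simp: inj_on_eq_iff subset_iff)
    show "?f ` carrier (image_module \<iota> (?P e'))
        = {b \<in> carrier (image_module \<iota> (?P e)). ?g b = \<zero>\<^bsub>image_module \<iota> (?P (e \<otimes> d))\<^esub>}"
    proof (intro equalityI subsetI)
      fix b assume "b \<in> ?f ` carrier (image_module \<iota> (?P e'))"
      then obtain x where x: "x \<in> carrier (?P e')" "b = \<iota> x"
        using ff by (auto simp: carrier_image_module)
      then show "b \<in> {b \<in> carrier (image_module \<iota> (?P e)). ?g b = \<zero>\<^bsub>image_module \<iota> (?P (e \<otimes> d))\<^esub>}"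
        using ker[of x] gg[of x] by (simp add: carrier_image_module zero_image_module)
    next
      fix b assume "b \<in> {b \<in> carrier (image_module \<iota> (?P e)). ?g b = \<zero>\<^bsub>image_module \<iota> (?P (e \<otimes> d))\<^esub>}"
      then obtain x where x: "x \<in> carrier (?P e)" "b = \<iota> x" "\<iota> (x \<otimes> d) = \<iota> \<zero>"
        using gg by (auto simp: carrier_image_module zero_image_module)
      then have "x \<in> carrier (?P e')" using ker[of x] z by blast
      then show "b \<in> ?f ` carrier (image_module \<iota> (?P e'))"
        using ff[of x] x by (metis carrier_image_module image_eqI)
    qed
    show "?g ` carrier (image_module \<iota> (?P e)) = carrier (image_module \<iota> (?P (e \<otimes> d)))"
    proof (intro equalityI subsetI)
      fix b assume "b \<in> ?g ` carrier (image_module \<iota> (?P e))"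
      then show "b \<in> carrier (image_module \<iota> (?P (e \<otimes> d)))" using mod_hom_closed[OF g] by blast
    next
      fix b assume "b \<in> carrier (image_module \<iota> (?P (e \<otimes> d)))"
      then obtain r where r: "r \<in> carrier R" "b = \<iota> (r \<otimes> (e \<otimes> d))"
        by (auto simp: carrier_image_module carrier_principal_left_module)
      then have re: "r \<otimes> e \<in> carrier (?P e)" by (auto simp: carrier_principal_left_module)
      have "b = ?g (\<iota> (r \<otimes> e))" using gg[OF re] r e by (simp add: m_assoc)
      then show "b \<in> ?g ` carrier (image_module \<iota> (?P e))"
        using re by (metis carrier_image_module image_eqI)
    qed
  qed
  then show ?thesis
  proof (rule thick_subcategory_extension[OF T projective_regular_copy[OF inj] _ h _ sub quot])
    show "inj_on ?h (?f ` carrier (image_module \<iota> (?P e')))"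
      using e'e by (auto simp: carrier_image_module inj_on_def ff hh subset_iff)
  qed
qed

end

section \<open>Homology of a pair of ring elements with product zero\<close>

text \<open>
  If \<open>ab = ba = 0\<close>, then multiplication by \<open>a\<close> and \<open>b\<close> turns a module into a two-periodic
  complex. The predicate says that \<open>d\<close> is zero on \<open>ker a / im b\<close>; for \<open>d = 1\<close> it says that this
  homology group is zero.
\<close>

definition kills_homology ::
  "('r, 'x) ring_scheme \<Rightarrow> 'r \<Rightarrow> 'r \<Rightarrow> 'r \<Rightarrow> ('r, 'u) module \<Rightarrow> bool" where
  "kills_homology R d a b W \<longleftrightarrow>
     (\<forall>w\<in>carrier W. a \<odot>\<^bsub>W\<^esub> w = \<zero>\<^bsub>W\<^esub> \<longrightarrow> (\<exists>u\<in>carrier W. d \<odot>\<^bsub>W\<^esub> w = b \<odot>\<^bsub>W\<^esub> u))"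

lemma kills_homologyD:
  assumes "kills_homology R d a b W" "w \<in> carrier W" "a \<odot>\<^bsub>W\<^esub> w = \<zero>\<^bsub>W\<^esub>"
  obtains u where "u \<in> carrier W" "d \<odot>\<^bsub>W\<^esub> w = b \<odot>\<^bsub>W\<^esub> u"
  using assms unfolding kills_homology_def by blast

context
  fixes R :: "('r, 'x) ring_scheme" and a b d :: 'r
    and X J S :: "('r, 'u) module" and j q :: "'u \<Rightarrow> 'u"
  assumes R: "a \<in> carrier R" "b \<in> carrier R" "d \<in> carrier R"
    and ab: "a \<otimes>\<^bsub>R\<^esub> b = \<zero>\<^bsub>R\<^esub>"
    and da: "d \<otimes>\<^bsub>R\<^esub> a = a \<otimes>\<^bsub>R\<^esub> d" and db: "d \<otimes>\<^bsub>R\<^esub> b = b \<otimes>\<^bsub>R\<^esub> d"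
    and ex: "short_exact R X j J q S" and J0: "kills_homology R \<one>\<^bsub>R\<^esub> b a J"
begin

text \<open>
  The long exact homology sequence of \<open>0 \<rightarrow> X \<rightarrow> J \<rightarrow> S \<rightarrow> 0\<close>: as \<open>ker b / im a\<close> is zero for
  \<open>J\<close>, the connecting map onto \<open>ker b / im a\<close> of \<open>X\<close> is surjective and the one that starts at
  \<open>ker b / im a\<close> of \<open>S\<close> is injective. Both commute with \<open>d\<close>.
\<close>

lemma kills_homology_kernel:
  assumes S0: "kills_homology R d a b S"
  shows "kills_homology R d b a X"
  unfolding kills_homology_def
proof (intro ballI impI)
  have X: "left_module R X" and J: "left_module R J" and S: "left_module R S"
    and j: "j \<in> mod_hom R X J" and q: "q \<in> mod_hom R J S" and inj: "inj_on j (carrier X)"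
    and im: "j ` carrier X = {y \<in> carrier J. q y = \<zero>\<^bsub>S\<^esub>}" and surj: "q ` carrier J = carrier S"
    using ex by (auto simp: short_exact_def)
  interpret X: left_module R X by fact
  interpret J: left_module R J by fact
  interpret S: left_module R S by fact
  note [simp] = R J.smult_closed X.smult_closed S.smult_closed
  fix w assume w: "w \<in> carrier X" "b \<odot>\<^bsub>X\<^esub> w = \<zero>\<^bsub>X\<^esub>"
  have jw: "j w \<in> carrier J" using mod_hom_closed[OF j w(1)] .
  have "b \<odot>\<^bsub>J\<^esub> j w = \<zero>\<^bsub>J\<^esub>"
    using w mod_hom_smult[OF j R(2) w(1)] mod_hom_zero[OF X J j] by simp
  then obtain y where y: "y \<in> carrier J" "j w = a \<odot>\<^bsub>J\<^esub> y"
    using kills_homologyD[OF J0 jw] by (metis J.smult_one jw)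
  have "q (j w) = \<zero>\<^bsub>S\<^esub>" using im w(1) by blast
  then have "a \<odot>\<^bsub>S\<^esub> q y = \<zero>\<^bsub>S\<^esub>" using y by (simp add: mod_hom_smult[OF q, symmetric])
  then obtain s where s: "s \<in> carrier S" "d \<odot>\<^bsub>S\<^esub> q y = b \<odot>\<^bsub>S\<^esub> s"
    using kills_homologyD[OF S0 mod_hom_closed[OF q y(1)]] by blast
  obtain y' where y': "y' \<in> carrier J" "s = q y'" using surj s(1) by blast
  have "q (d \<odot>\<^bsub>J\<^esub> y \<ominus>\<^bsub>J\<^esub> b \<odot>\<^bsub>J\<^esub> y') = \<zero>\<^bsub>S\<^esub>"
    using s y y' mod_hom_closed[OF q]
    by (simp add: mod_hom_diff[OF J S q] mod_hom_smult[OF q] S.M.minus_eq_zero_iff)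
  then have "d \<odot>\<^bsub>J\<^esub> y \<ominus>\<^bsub>J\<^esub> b \<odot>\<^bsub>J\<^esub> y' \<in> j ` carrier X" using im y y' by simp
  then obtain z where z: "z \<in> carrier X" "j z = d \<odot>\<^bsub>J\<^esub> y \<ominus>\<^bsub>J\<^esub> b \<odot>\<^bsub>J\<^esub> y'" by auto
  have "j (a \<odot>\<^bsub>X\<^esub> z) = a \<odot>\<^bsub>J\<^esub> (d \<odot>\<^bsub>J\<^esub> y) \<ominus>\<^bsub>J\<^esub> a \<odot>\<^bsub>J\<^esub> (b \<odot>\<^bsub>J\<^esub> y')"
    using z y y' by (simp add: mod_hom_smult[OF j] J.smult_diff_right)
  also have "\<dots> = d \<odot>\<^bsub>J\<^esub> (a \<odot>\<^bsub>J\<^esub> y)"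
    using y y' by (simp add: J.smult_assoc[symmetric] da ab J.smult_zero_left J.M.minus_eq)
  also have "\<dots> = j (d \<odot>\<^bsub>X\<^esub> w)" using w y by (simp add: mod_hom_smult[OF j])
  finally have "d \<odot>\<^bsub>X\<^esub> w = a \<odot>\<^bsub>X\<^esub> z" using inj w z by (simp add: inj_on_eq_iff)
  then show "\<exists>z\<in>carrier X. d \<odot>\<^bsub>X\<^esub> w = a \<odot>\<^bsub>X\<^esub> z" using z(1) by blast
qed

lemma kills_homology_cokernel:
  assumes X0: "kills_homology R d a b X"
  shows "kills_homology R d b a S"
  unfolding kills_homology_def
proof (intro ballI impI)
  have X: "left_module R X" and J: "left_module R J" and S: "left_module R S"
    and j: "j \<in> mod_hom R X J" and q: "q \<in> mod_hom R J S" and inj: "inj_on j (carrier X)"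
    and im: "j ` carrier X = {y \<in> carrier J. q y = \<zero>\<^bsub>S\<^esub>}" and surj: "q ` carrier J = carrier S"
    using ex by (auto simp: short_exact_def)
  interpret X: left_module R X by fact
  interpret J: left_module R J by fact
  interpret S: left_module R S by fact
  note [simp] = R J.smult_closed X.smult_closed S.smult_closed
  fix s assume s: "s \<in> carrier S" "b \<odot>\<^bsub>S\<^esub> s = \<zero>\<^bsub>S\<^esub>"
  obtain y where y: "y \<in> carrier J" "s = q y" using surj s(1) by blast
  have "q (b \<odot>\<^bsub>J\<^esub> y) = \<zero>\<^bsub>S\<^esub>" using s y by (simp add: mod_hom_smult[OF q])
  then have "b \<odot>\<^bsub>J\<^esub> y \<in> j ` carrier X" using im y by simp
  then obtain w where w: "w \<in> carrier X" "j w = b \<odot>\<^bsub>J\<^esub> y" by auto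
  have "j (a \<odot>\<^bsub>X\<^esub> w) = j \<zero>\<^bsub>X\<^esub>"
    using w y by (simp add: mod_hom_smult[OF j] J.smult_assoc[symmetric] ab J.smult_zero_left
        mod_hom_zero[OF X J j])
  then have "a \<odot>\<^bsub>X\<^esub> w = \<zero>\<^bsub>X\<^esub>" using inj w by (simp add: inj_on_eq_iff)
  then obtain z where z: "z \<in> carrier X" "d \<odot>\<^bsub>X\<^esub> w = b \<odot>\<^bsub>X\<^esub> z"
    using kills_homologyD[OF X0 w(1)] by blast
  have jz: "j z \<in> carrier J" using mod_hom_closed[OF j z(1)] .
  have "b \<odot>\<^bsub>J\<^esub> (d \<odot>\<^bsub>J\<^esub> y) = j (d \<odot>\<^bsub>X\<^esub> w)"
    using w y by (simp add: mod_hom_smult[OF j] J.smult_assoc[symmetric] db)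
  also have "\<dots> = b \<odot>\<^bsub>J\<^esub> j z" using z by (simp add: mod_hom_smult[OF j])
  finally have "b \<odot>\<^bsub>J\<^esub> (d \<odot>\<^bsub>J\<^esub> y \<ominus>\<^bsub>J\<^esub> j z) = \<zero>\<^bsub>J\<^esub>"
    using y jz by (simp add: J.smult_diff_right J.M.minus_eq_zero_iff)
  moreover have m: "d \<odot>\<^bsub>J\<^esub> y \<ominus>\<^bsub>J\<^esub> j z \<in> carrier J" using y jz by simp
  ultimately obtain y' where y': "y' \<in> carrier J" "d \<odot>\<^bsub>J\<^esub> y \<ominus>\<^bsub>J\<^esub> j z = a \<odot>\<^bsub>J\<^esub> y'"
    using kills_homologyD[OF J0 m] by (metis J.smult_one m)
  have "q (j z) = \<zero>\<^bsub>S\<^esub>" using im z(1) by blast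
  then have "d \<odot>\<^bsub>S\<^esub> s = q (d \<odot>\<^bsub>J\<^esub> y \<ominus>\<^bsub>J\<^esub> j z)"
    using y jz mod_hom_closed[OF q] by (simp add: mod_hom_diff[OF J S q] mod_hom_smult[OF q] S.M.minus_eq)
  also have "\<dots> = a \<odot>\<^bsub>S\<^esub> q y'" using y' by (simp add: mod_hom_smult[OF q])
  finally show "\<exists>u\<in>carrier S. d \<odot>\<^bsub>S\<^esub> s = a \<odot>\<^bsub>S\<^esub> u" using mod_hom_closed[OF q y'(1)] by blast
qed

end

lemma Omega_power_left_module:
  assumes T: "left_module R T" and W: "Omega_power R n T W"
  shows "left_module R W"
proof -
  have syz: "left_module R M \<and> left_module R N" if "syzygy R M N" for M N
    using that by (auto simp: syzygy_def suspension_seq_def short_exact_def)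
  have *: "left_module R M \<longleftrightarrow> left_module R N" if "(syzygy R ^^ m) M N" for m M N
    using that
  proof (induction m arbitrary: N)
    case (Suc m)
    from Suc.prems obtain L where "(syzygy R ^^ m) M L" "syzygy R L N" by (rule relpowp_Suc_E)
    then show ?case using Suc.IH[of L] syz[of L N] by blast
  qed simp
  then show ?thesis using W T unfolding Omega_power_def by (auto split: if_splits)
qed

text \<open>
  Each syzygy step exchanges the two homology groups, and it can be reversed; so a condition on both of
  them passes to all positive and negative powers of \<open>\<Omega>\<close>.
\<close>

lemma kills_homology_Omega_power:
  fixes T W :: "('r, 'u) module"
  assumes R: "a \<in> carrier R" "b \<in> carrier R" "d \<in> carrier R"
    and zero: "a \<otimes>\<^bsub>R\<^esub> b = \<zero>\<^bsub>R\<^esub>" "b \<otimes>\<^bsub>R\<^esub> a = \<zero>\<^bsub>R\<^esub>"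
    and comm: "d \<otimes>\<^bsub>R\<^esub> a = a \<otimes>\<^bsub>R\<^esub> d" "d \<otimes>\<^bsub>R\<^esub> b = b \<otimes>\<^bsub>R\<^esub> d"
    and proj: "\<And>J :: ('r, 'u) module. projective_module R J \<Longrightarrow>
      kills_homology R \<one>\<^bsub>R\<^esub> a b J \<and> kills_homology R \<one>\<^bsub>R\<^esub> b a J"
    and T: "kills_homology R d a b T \<and> kills_homology R d b a T"
    and W: "Omega_power R n T W"
  shows "kills_homology R d a b W \<and> kills_homology R d b a W"
proof -
  let ?P = "\<lambda>M :: ('r, 'u) module. kills_homology R d a b M \<and> kills_homology R d b a M"
  have iff: "?P M \<longleftrightarrow> ?P N" if "syzygy R M N" for M N
  proof -
    obtain j J q where ex: "short_exact R N j J q M" and J: "projective_module R J"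
      using \<open>syzygy R M N\<close> by (auto simp: syzygy_def suspension_seq_def)
    note J0 = proj[OF J]
    show ?thesis
      using kills_homology_kernel[OF R zero(1) comm ex conjunct2[OF J0]]
        kills_homology_kernel[OF R(2,1,3) zero(2) comm(2,1) ex conjunct1[OF J0]]
        kills_homology_cokernel[OF R zero(1) comm ex conjunct2[OF J0]]
        kills_homology_cokernel[OF R(2,1,3) zero(2) comm(2,1) ex conjunct1[OF J0]]
      by blast
  qed
  have "?P M \<longleftrightarrow> ?P N" if "(syzygy R ^^ m) M N" for m M N
    using that
  proof (induction m arbitrary: N)
    case (Suc m)
    from Suc.prems obtain L where "(syzygy R ^^ m) M L" "syzygy R L N" by (rule relpowp_Suc_E)
    then show ?case using Suc.IH[of L] iff[of L N] by blast
  qed simp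
  then show ?thesis using W T unfolding Omega_power_def by (auto split: if_splits)
qed

text \<open>
  A projective quotient of \<open>F\<close> is a direct summand of \<open>F\<close>, so its homology is a summand of
  that of \<open>F\<close>.
\<close>

lemma kills_homology_projective:
  fixes F J :: "('r, 'u) module"
  assumes R: "d \<in> carrier R" "a \<in> carrier R" "b \<in> carrier R"
    and J: "projective_module R J" and F: "left_module R F"
    and q: "q \<in> mod_hom R F J" "q ` carrier F = carrier J" and F0: "kills_homology R d a b F"
  shows "kills_homology R d a b J"
  unfolding kills_homology_def
proof (intro ballI impI)
  have J': "left_module R J" using J by (simp add: projective_module_def)
  interpret J: left_module R J by fact
  interpret F: left_module R F by fact
  obtain s where s: "s \<in> mod_hom R J F" "\<And>x. x \<in> carrier J \<Longrightarrow> q (s x) = x"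
  proof -
    have "\<exists>h\<in>mod_hom R J F. \<forall>x\<in>carrier J. q (h x) = id x"
      using J F J' q mod_hom_id[of R J] unfolding projective_module_def by blast
    then show thesis using that by auto
  qed
  fix w assume w: "w \<in> carrier J" "a \<odot>\<^bsub>J\<^esub> w = \<zero>\<^bsub>J\<^esub>"
  have "a \<odot>\<^bsub>F\<^esub> s w = \<zero>\<^bsub>F\<^esub>"
    using w mod_hom_smult[OF s(1) R(2) w(1)] mod_hom_zero[OF J' F s(1)] by simp
  then obtain u where u: "u \<in> carrier F" "d \<odot>\<^bsub>F\<^esub> s w = b \<odot>\<^bsub>F\<^esub> u"
    using kills_homologyD[OF F0 mod_hom_closed[OF s(1) w(1)]] by blast
  have "d \<odot>\<^bsub>J\<^esub> w = q (d \<odot>\<^bsub>F\<^esub> s w)"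
    using w R mod_hom_closed[OF s(1) w(1)] by (simp add: mod_hom_smult[OF q(1)] s(2))
  also have "\<dots> = b \<odot>\<^bsub>J\<^esub> q u" using u R by (simp add: mod_hom_smult[OF q(1)])
  finally show "\<exists>u\<in>carrier J. d \<odot>\<^bsub>J\<^esub> w = b \<odot>\<^bsub>J\<^esub> u" using mod_hom_closed[OF q(1) u(1)] by blast
qed

lemma kills_homology_copy:
  assumes R: "d \<in> carrier R" "a \<in> carrier R" "b \<in> carrier R" and B: "left_module R B"
    and inj: "inj_on \<iota> (carrier B)" and k: "kills_homology R d a b B"
  shows "kills_homology R d a b (image_module \<iota> B)"
  unfolding kills_homology_def
proof (intro ballI impI)
  interpret B: left_module R B by fact
  note \<iota> = image_module_inj(2)[OF B inj]
  fix w assume w: "w \<in> carrier (image_module \<iota> B)"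
    "a \<odot>\<^bsub>image_module \<iota> B\<^esub> w = \<zero>\<^bsub>image_module \<iota> B\<^esub>"
  then obtain v where v: "v \<in> carrier B" "w = \<iota> v" by (auto simp: carrier_image_module)
  have "\<iota> (a \<odot>\<^bsub>B\<^esub> v) = \<iota> \<zero>\<^bsub>B\<^esub>" using w v R by (simp add: mod_hom_smult[OF \<iota>] zero_image_module)
  then have "a \<odot>\<^bsub>B\<^esub> v = \<zero>\<^bsub>B\<^esub>" using inj v R by (simp add: inj_on_eq_iff B.smult_closed)
  then obtain u where u: "u \<in> carrier B" "d \<odot>\<^bsub>B\<^esub> v = b \<odot>\<^bsub>B\<^esub> u"
    using kills_homologyD[OF k v(1)] by blast
  then have "d \<odot>\<^bsub>image_module \<iota> B\<^esub> w = b \<odot>\<^bsub>image_module \<iota> B\<^esub> \<iota> u"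
    using v R by (simp add: mod_hom_smult[OF \<iota>, symmetric])
  then show "\<exists>u\<in>carrier (image_module \<iota> B).
      d \<odot>\<^bsub>image_module \<iota> B\<^esub> w = b \<odot>\<^bsub>image_module \<iota> B\<^esub> u"
    using u(1) by (auto simp: carrier_image_module)
qed

text \<open>
  When \<open>b\<close> is a power of \<open>a\<close>, one of the two homology groups controls the other: if the kernel
  of \<open>a\<close> lies in the image of \<open>a\<^sup>m\<close>, then the kernel of \<open>a\<^sup>i\<close> lies in the image of
  \<open>a\<^sup>m\<^sup>+\<^sup>1\<^sup>-\<^sup>i\<close>, by induction on \<open>i\<close>.
\<close>

lemma kills_homology_power_swap:
  assumes M: "left_module R M" and a: "a \<in> carrier R"
    and M0: "kills_homology R \<one>\<^bsub>R\<^esub> a (a [^]\<^bsub>R\<^esub> (m::nat)) M"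
  shows "kills_homology R \<one>\<^bsub>R\<^esub> (a [^]\<^bsub>R\<^esub> m) a M"
proof -
  interpret M: left_module R M by fact
  note [simp] = a M.smult_closed M.smult_one
  have "\<exists>u\<in>carrier M. v = a [^]\<^bsub>R\<^esub> (m + 1 - i) \<odot>\<^bsub>M\<^esub> u"
    if "i \<le> m" "v \<in> carrier M" "a [^]\<^bsub>R\<^esub> i \<odot>\<^bsub>M\<^esub> v = \<zero>\<^bsub>M\<^esub>" for i v
    using that
  proof (induction i arbitrary: v)
    case 0
    then show ?case by (auto intro!: bexI[of _ "\<zero>\<^bsub>M\<^esub>"] simp: M.smult_zero_right)
  next
    case (Suc i)
    have "a \<odot>\<^bsub>M\<^esub> (a [^]\<^bsub>R\<^esub> i \<odot>\<^bsub>M\<^esub> v) = \<zero>\<^bsub>M\<^esub>"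
      using Suc.prems by (metis M.R.nat_pow_Suc2 M.R.nat_pow_closed M.smult_assoc a)
    then obtain u where u: "u \<in> carrier M" "a [^]\<^bsub>R\<^esub> i \<odot>\<^bsub>M\<^esub> v = a [^]\<^bsub>R\<^esub> m \<odot>\<^bsub>M\<^esub> u"
      using kills_homologyD[OF M0, of "a [^]\<^bsub>R\<^esub> i \<odot>\<^bsub>M\<^esub> v"] Suc.prems by auto
    let ?v = "v \<ominus>\<^bsub>M\<^esub> a [^]\<^bsub>R\<^esub> (m - i) \<odot>\<^bsub>M\<^esub> u"
    have "a [^]\<^bsub>R\<^esub> i \<odot>\<^bsub>M\<^esub> ?v = \<zero>\<^bsub>M\<^esub>"
      using u Suc.prems by (simp add: M.smult_diff_right M.smult_assoc[symmetric] M.R.nat_pow_mult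
          M.M.minus_eq_zero_iff)
    moreover have "?v \<in> carrier M" using u Suc.prems by simp
    ultimately obtain u' where u': "u' \<in> carrier M" "?v = a [^]\<^bsub>R\<^esub> (m + 1 - i) \<odot>\<^bsub>M\<^esub> u'"
      using Suc by (metis Suc_leD)
    have "v = ?v \<oplus>\<^bsub>M\<^esub> a [^]\<^bsub>R\<^esub> (m - i) \<odot>\<^bsub>M\<^esub> u"
      using u Suc.prems by (simp add: M.M.minus_eq M.M.a_assoc M.M.l_neg)
    also have "\<dots> = a [^]\<^bsub>R\<^esub> (m - i) \<odot>\<^bsub>M\<^esub> (a \<odot>\<^bsub>M\<^esub> u' \<oplus>\<^bsub>M\<^esub> u)"
      using u u' Suc.prems
      by (simp add: M.smult_r_distr M.smult_assoc[symmetric] Suc_diff_le)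
    finally show ?case using u u' by (metis M.M.a_closed M.smult_closed Suc_eq_plus1 a diff_Suc_Suc)
  qed
  from this[of m] show ?thesis unfolding kills_homology_def by simp
qed

text \<open>
  A map factoring through a projective module vanishes if \<open>a\<close> is zero on its source and \<open>b\<close> on
  its target: in the projective module, elements killed by \<open>a\<close> are multiples of \<open>b\<close>.
\<close>

lemma stably_zero_imp_zero:
  fixes M N :: "('r, 'u) module"
  assumes M: "left_module R M" and N: "left_module R N" and R: "a \<in> carrier R" "b \<in> carrier R"
    and aM: "\<And>x. x \<in> carrier M \<Longrightarrow> a \<odot>\<^bsub>M\<^esub> x = \<zero>\<^bsub>M\<^esub>"
    and bN: "\<And>x. x \<in> carrier N \<Longrightarrow> b \<odot>\<^bsub>N\<^esub> x = \<zero>\<^bsub>N\<^esub>"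
    and proj: "\<And>J :: ('r, 'u) module. projective_module R J \<Longrightarrow> kills_homology R \<one>\<^bsub>R\<^esub> a b J"
    and f: "stably_zero R M N f" and x: "x \<in> carrier M"
  shows "f x = \<zero>\<^bsub>N\<^esub>"
proof -
  obtain P :: "('r, 'u) module" and s t where P: "projective_module R P"
    and s: "s \<in> mod_hom R M P" and t: "t \<in> mod_hom R P N" and fx: "f x = t (s x)"
    using f x unfolding stably_zero_def by blast
  have P': "left_module R P" using P by (simp add: projective_module_def)
  interpret P: left_module R P by fact
  have sx: "s x \<in> carrier P" using mod_hom_closed[OF s x] .
  have "a \<odot>\<^bsub>P\<^esub> s x = \<zero>\<^bsub>P\<^esub>"
    using mod_hom_smult[OF s R(1) x] mod_hom_zero[OF M P' s] aM[OF x] by simp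
  then obtain u where u: "u \<in> carrier P" "s x = b \<odot>\<^bsub>P\<^esub> u"
    using kills_homologyD[OF proj[OF P] sx] by (metis P.smult_one sx)
  then show ?thesis
    using mod_hom_smult[OF t R(2) u(1)] bN[OF mod_hom_closed[OF t u(1)]] fx by simp
qed

section \<open>Linear functionals on vector spaces of arbitrary dimension\<close>

text \<open>
  A maximal subspace that contains \<open>U\<^sub>0\<close> but not \<open>e\<close> is a complement of the line through \<open>e\<close>;
  the functional is the coordinate along this line.
\<close>

lemma linear_functional_exists:
  fixes K :: "('k, 'c) ring_scheme" and V :: "('k, 'v) module"
  assumes "field K" and V: "left_module K V" and e: "e \<in> carrier V" and U\<^sub>0: "U\<^sub>0 \<subseteq> carrier V"
    "\<zero>\<^bsub>V\<^esub> \<in> U\<^sub>0" "\<And>x y. x \<in> U\<^sub>0 \<Longrightarrow> y \<in> U\<^sub>0 \<Longrightarrow> x \<oplus>\<^bsub>V\<^esub> y \<in> U\<^sub>0"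
    "\<And>a x. a \<in> carrier K \<Longrightarrow> x \<in> U\<^sub>0 \<Longrightarrow> a \<odot>\<^bsub>V\<^esub> x \<in> U\<^sub>0"
    and eU: "e \<notin> U\<^sub>0"
  obtains l where "l \<in> mod_hom K V (regular_module K)" "l e = \<one>\<^bsub>K\<^esub>"
    "\<And>u. u \<in> U\<^sub>0 \<Longrightarrow> l u = \<zero>\<^bsub>K\<^esub>"
proof -
  interpret K: field K by fact
  interpret V: left_module K V by fact
  note [simp] = e V.smult_closed V.smult_one V.smult_zero_left V.smult_zero_right
  have [simp]: "\<ominus>\<^bsub>V\<^esub> \<zero>\<^bsub>V\<^esub> = \<zero>\<^bsub>V\<^esub>" by (rule V.M.minus_equality) auto
  define subspace where "subspace = (\<lambda>U. U \<subseteq> carrier V \<and> \<zero>\<^bsub>V\<^esub> \<in> U \<and>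
    (\<forall>x\<in>U. \<forall>y\<in>U. x \<oplus>\<^bsub>V\<^esub> y \<in> U) \<and> (\<forall>a\<in>carrier K. \<forall>x\<in>U. a \<odot>\<^bsub>V\<^esub> x \<in> U))"
  define \<A> where "\<A> = {U. subspace U \<and> U\<^sub>0 \<subseteq> U \<and> e \<notin> U}"
  have "U\<^sub>0 \<in> \<A>" using U\<^sub>0 eU by (auto simp: \<A>_def subspace_def)
  then have "\<exists>U\<in>\<A>. \<forall>X\<in>\<A>. U \<subseteq> X \<longrightarrow> X = U"
  proof (intro subset_Zorn_nonempty)
    fix \<C> assume ne: "\<C> \<noteq> {}" and chain: "subset.chain \<A> \<C>"
    have sub: "subspace U" "U\<^sub>0 \<subseteq> U" "e \<notin> U" if "U \<in> \<C>" for U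
      using that chain by (auto simp: subset.chain_def \<A>_def)
    have "x \<oplus>\<^bsub>V\<^esub> y \<in> \<Union>\<C>" if xy: "x \<in> \<Union>\<C>" "y \<in> \<Union>\<C>" for x y
    proof -
      obtain X Y where XY: "X \<in> \<C>" "x \<in> X" "Y \<in> \<C>" "y \<in> Y" using xy by blast
      then have "X \<subseteq> Y \<or> Y \<subseteq> X" using chain by (auto simp: subset.chain_def)
      then have "\<exists>Z\<in>\<C>. x \<in> Z \<and> y \<in> Z" using XY by blast
      then show ?thesis using sub(1) unfolding subspace_def by blast
    qed
    moreover have "\<Union>\<C> \<subseteq> carrier V" using sub(1) unfolding subspace_def by blast
    moreover have "\<zero>\<^bsub>V\<^esub> \<in> \<Union>\<C>" using sub(1) ne unfolding subspace_def by blast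
    moreover have "a \<odot>\<^bsub>V\<^esub> x \<in> \<Union>\<C>" if "a \<in> carrier K" "x \<in> \<Union>\<C>" for a x
      using sub(1) that unfolding subspace_def by blast
    ultimately have "subspace (\<Union>\<C>)" unfolding subspace_def by blast
    moreover have "U\<^sub>0 \<subseteq> \<Union>\<C>" using sub(2) ne by blast
    ultimately show "\<Union>\<C> \<in> \<A>" using sub(3) by (auto simp: \<A>_def)
  qed auto
  then obtain U where U: "U \<in> \<A>" and max: "\<And>X. X \<in> \<A> \<Longrightarrow> U \<subseteq> X \<Longrightarrow> X = U" by blast
  have sU: "U \<subseteq> carrier V" "\<zero>\<^bsub>V\<^esub> \<in> U" "\<And>x y. x \<in> U \<Longrightarrow> y \<in> U \<Longrightarrow> x \<oplus>\<^bsub>V\<^esub> y \<in> U"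
    "\<And>a x. a \<in> carrier K \<Longrightarrow> x \<in> U \<Longrightarrow> a \<odot>\<^bsub>V\<^esub> x \<in> U" and UU: "U\<^sub>0 \<subseteq> U" "e \<notin> U"
    using U by (auto simp: \<A>_def subspace_def)
  have ex: "\<exists>a\<in>carrier K. w \<ominus>\<^bsub>V\<^esub> a \<odot>\<^bsub>V\<^esub> e \<in> U" if w: "w \<in> carrier V" for w
  proof (cases "w \<in> U")
    case True
    then show ?thesis using w by (auto intro!: bexI[of _ "\<zero>\<^bsub>K\<^esub>"] simp: V.M.minus_eq)
  next
    case False
    define X where "X = {u \<oplus>\<^bsub>V\<^esub> a \<odot>\<^bsub>V\<^esub> w | u a. u \<in> U \<and> a \<in> carrier K}"
    have XI: "u \<oplus>\<^bsub>V\<^esub> a \<odot>\<^bsub>V\<^esub> w \<in> X" if "u \<in> U" "a \<in> carrier K" for u a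
      using that unfolding X_def by blast
    have UX: "u \<in> X" if "u \<in> U" for u
      using XI[OF that K.zero_closed] that sU(1) w by (auto simp: subset_iff)
    have "w \<in> X" using XI[OF sU(2) K.one_closed] w by simp
    have "x \<oplus>\<^bsub>V\<^esub> y \<in> X" if xy: "x \<in> X" "y \<in> X" for x y
    proof -
      obtain u a v b where *: "u \<in> U" "a \<in> carrier K" "x = u \<oplus>\<^bsub>V\<^esub> a \<odot>\<^bsub>V\<^esub> w"
        "v \<in> U" "b \<in> carrier K" "y = v \<oplus>\<^bsub>V\<^esub> b \<odot>\<^bsub>V\<^esub> w" using xy unfolding X_def by blast
      then have "x \<oplus>\<^bsub>V\<^esub> y = (u \<oplus>\<^bsub>V\<^esub> v) \<oplus>\<^bsub>V\<^esub> (a \<oplus>\<^bsub>K\<^esub> b) \<odot>\<^bsub>V\<^esub> w"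
        using w sU(1) by (auto simp: subset_iff V.smult_l_distr V.M.a_ac)
      then show ?thesis using XI * sU(3) by simp
    qed
    moreover have "b \<odot>\<^bsub>V\<^esub> x \<in> X" if b: "b \<in> carrier K" and x: "x \<in> X" for b x
    proof -
      obtain u a where *: "u \<in> U" "a \<in> carrier K" "x = u \<oplus>\<^bsub>V\<^esub> a \<odot>\<^bsub>V\<^esub> w"
        using x unfolding X_def by blast
      then have "b \<odot>\<^bsub>V\<^esub> x = b \<odot>\<^bsub>V\<^esub> u \<oplus>\<^bsub>V\<^esub> (b \<otimes>\<^bsub>K\<^esub> a) \<odot>\<^bsub>V\<^esub> w"
        using w b sU(1) by (auto simp: subset_iff V.smult_r_distr V.smult_assoc)
      then show ?thesis using XI * sU(4) b by simp
    qed
    moreover have "X \<subseteq> carrier V" using sU(1) w by (auto simp: X_def)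
    ultimately have "subspace X" using UX sU(2) unfolding subspace_def by blast
    then have "e \<in> X" using max[of X] UX UU \<open>w \<in> X\<close> False unfolding \<A>_def by blast
    then obtain u a where ua: "u \<in> U" "a \<in> carrier K" "e = u \<oplus>\<^bsub>V\<^esub> a \<odot>\<^bsub>V\<^esub> w"
      unfolding X_def by blast
    have u: "u \<in> carrier V" using ua sU(1) by blast
    have "a \<noteq> \<zero>\<^bsub>K\<^esub>" using ua UU w u by auto
    then have inv: "inv\<^bsub>K\<^esub> a \<in> carrier K" "inv\<^bsub>K\<^esub> a \<otimes>\<^bsub>K\<^esub> a = \<one>\<^bsub>K\<^esub>"
      using ua K.field_Units by auto
    have "w \<ominus>\<^bsub>V\<^esub> inv\<^bsub>K\<^esub> a \<odot>\<^bsub>V\<^esub> e = w \<ominus>\<^bsub>V\<^esub> (inv\<^bsub>K\<^esub> a \<odot>\<^bsub>V\<^esub> u \<oplus>\<^bsub>V\<^esub> w)"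
      unfolding ua(3) using inv ua u w by (simp add: V.smult_r_distr V.smult_assoc[symmetric])
    also have "\<dots> = (\<ominus>\<^bsub>K\<^esub> (inv\<^bsub>K\<^esub> a)) \<odot>\<^bsub>V\<^esub> u"
      using inv u w by (simp add: V.M.minus_eq V.M.minus_add V.smult_minus_left V.M.a_ac V.M.r_neg1
          V.M.r_neg2 V.M.r_neg)
    finally have "w \<ominus>\<^bsub>V\<^esub> inv\<^bsub>K\<^esub> a \<odot>\<^bsub>V\<^esub> e \<in> U" using sU(4) inv ua(1) by simp
    then show ?thesis using inv(1) by blast
  qed
  have unique: "a = b" if ab: "a \<in> carrier K" "b \<in> carrier K" "w \<in> carrier V"
    "w \<ominus>\<^bsub>V\<^esub> a \<odot>\<^bsub>V\<^esub> e \<in> U" "w \<ominus>\<^bsub>V\<^esub> b \<odot>\<^bsub>V\<^esub> e \<in> U" for a b w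
  proof (rule ccontr)
    assume "a \<noteq> b"
    have "(\<ominus>\<^bsub>K\<^esub> \<one>\<^bsub>K\<^esub>) \<odot>\<^bsub>V\<^esub> (w \<ominus>\<^bsub>V\<^esub> a \<odot>\<^bsub>V\<^esub> e) \<oplus>\<^bsub>V\<^esub> (w \<ominus>\<^bsub>V\<^esub> b \<odot>\<^bsub>V\<^esub> e) \<in> U"
      using sU(3,4) ab by simp
    then have "(a \<ominus>\<^bsub>K\<^esub> b) \<odot>\<^bsub>V\<^esub> e \<in> U"
      using ab by (simp add: V.smult_minus_left V.M.minus_eq V.M.minus_add V.M.a_ac V.M.r_neg1
          V.M.r_neg2 V.smult_diff_left)
    moreover have "a \<ominus>\<^bsub>K\<^esub> b \<in> Units K"
      using ab \<open>a \<noteq> b\<close> by (simp add: K.field_Units K.minus_eq_zero_iff)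
    ultimately have "(inv\<^bsub>K\<^esub> (a \<ominus>\<^bsub>K\<^esub> b) \<otimes>\<^bsub>K\<^esub> (a \<ominus>\<^bsub>K\<^esub> b)) \<odot>\<^bsub>V\<^esub> e \<in> U"
      using sU(4)[of "inv\<^bsub>K\<^esub> (a \<ominus>\<^bsub>K\<^esub> b)" "(a \<ominus>\<^bsub>K\<^esub> b) \<odot>\<^bsub>V\<^esub> e"] ab by (simp add: V.smult_assoc[symmetric])
    then show False using UU \<open>a \<ominus>\<^bsub>K\<^esub> b \<in> Units K\<close> by (simp add: K.Units_l_inv)
  qed
  define l where "l = (\<lambda>w. THE a. a \<in> carrier K \<and> w \<ominus>\<^bsub>V\<^esub> a \<odot>\<^bsub>V\<^esub> e \<in> U)"
  have l_eq: "l w = a" if "w \<in> carrier V" "a \<in> carrier K" "w \<ominus>\<^bsub>V\<^esub> a \<odot>\<^bsub>V\<^esub> e \<in> U" for w a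
    unfolding l_def using that unique by (intro the_equality) blast+
  have l: "l w \<in> carrier K" "w \<ominus>\<^bsub>V\<^esub> l w \<odot>\<^bsub>V\<^esub> e \<in> U" if "w \<in> carrier V" for w
    using ex[OF that] l_eq[OF that] by auto
  have "l \<in> mod_hom K V (regular_module K)"
  proof (rule mod_homI)
    fix x y assume xy: "x \<in> carrier V" "y \<in> carrier V"
    have "(x \<oplus>\<^bsub>V\<^esub> y) \<ominus>\<^bsub>V\<^esub> (l x \<oplus>\<^bsub>K\<^esub> l y) \<odot>\<^bsub>V\<^esub> e
      = (x \<ominus>\<^bsub>V\<^esub> l x \<odot>\<^bsub>V\<^esub> e) \<oplus>\<^bsub>V\<^esub> (y \<ominus>\<^bsub>V\<^esub> l y \<odot>\<^bsub>V\<^esub> e)"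
      using xy l by (simp add: V.M.minus_eq V.M.minus_add V.smult_l_distr V.M.a_ac)
    then show "l (x \<oplus>\<^bsub>V\<^esub> y) = l x \<oplus>\<^bsub>regular_module K\<^esub> l y"
      using xy l sU(3) by (simp add: l_eq)
  next
    fix a x assume ax: "a \<in> carrier K" "x \<in> carrier V"
    have "a \<odot>\<^bsub>V\<^esub> x \<ominus>\<^bsub>V\<^esub> (a \<otimes>\<^bsub>K\<^esub> l x) \<odot>\<^bsub>V\<^esub> e = a \<odot>\<^bsub>V\<^esub> (x \<ominus>\<^bsub>V\<^esub> l x \<odot>\<^bsub>V\<^esub> e)"
      using ax l by (simp add: V.smult_diff_right V.smult_assoc)
    then show "l (a \<odot>\<^bsub>V\<^esub> x) = a \<odot>\<^bsub>regular_module K\<^esub> l x"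
      using ax l sU(4) by (simp add: l_eq)
  qed (use l in auto)
  moreover have "l e = \<one>\<^bsub>K\<^esub>" using sU(2) by (simp add: l_eq V.M.minus_eq V.M.r_neg)
  moreover have "l u = \<zero>\<^bsub>K\<^esub>" if "u \<in> U\<^sub>0" for u
  proof (rule l_eq)
    show "u \<in> carrier V" using that U\<^sub>0 by blast
    then show "u \<ominus>\<^bsub>V\<^esub> \<zero>\<^bsub>K\<^esub> \<odot>\<^bsub>V\<^esub> e \<in> U" using that UU by (auto simp: V.M.minus_eq)
  qed simp
  ultimately show ?thesis by (rule that)
qed

text \<open>
  Unless \<open>\<psi>\<close> is zero, there is \<open>v\<^sub>0\<close> with \<open>\<psi> v\<^sub>0 = 1\<close>. A functional that is \<open>1\<close> at \<open>s v\<^sub>0\<close> and vanishes on the image of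
  \<open>ker \<psi>\<close> pulls back to \<open>\<psi>\<close>; the inclusion \<open>ker s \<subseteq> ker \<psi>\<close> says that \<open>s v\<^sub>0\<close> is outside that image.
\<close>

lemma linear_functional_factors:
  assumes "field K" and V: "left_module K V" and W: "left_module K W" and s: "s \<in> mod_hom K V W"
    and \<psi>: "\<psi> \<in> mod_hom K V (regular_module K)"
    and ker: "\<And>v. v \<in> carrier V \<Longrightarrow> s v = \<zero>\<^bsub>W\<^esub> \<Longrightarrow> \<psi> v = \<zero>\<^bsub>K\<^esub>"
  obtains l where "l \<in> mod_hom K W (regular_module K)" "\<And>v. v \<in> carrier V \<Longrightarrow> l (s v) = \<psi> v"
proof (cases "\<forall>v\<in>carrier V. \<psi> v = \<zero>\<^bsub>K\<^esub>")
  case True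
  interpret K: field K by fact
  have "(\<lambda>_. \<zero>\<^bsub>K\<^esub>) \<in> mod_hom K W (regular_module K)"
    by (rule mod_homI) auto
  then show ?thesis using True that[of "\<lambda>_. \<zero>\<^bsub>K\<^esub>"] by simp
next
  case False
  interpret K: field K by fact
  interpret V: left_module K V by fact
  interpret W: left_module K W by fact
  note [simp] = V.smult_closed W.smult_closed
  have KK: "left_module K (regular_module K)" by (rule K.left_module_regular)
  obtain v1 where v1: "v1 \<in> carrier V" "\<psi> v1 \<noteq> \<zero>\<^bsub>K\<^esub>" using False by blast
  have p1: "\<psi> v1 \<in> Units K" using v1 mod_hom_closed[OF \<psi> v1(1)] by (simp add: K.field_Units)
  define v0 where "v0 = inv\<^bsub>K\<^esub> (\<psi> v1) \<odot>\<^bsub>V\<^esub> v1"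
  have v0: "v0 \<in> carrier V" "\<psi> v0 = \<one>\<^bsub>K\<^esub>"
    using v1 p1 by (simp_all add: v0_def mod_hom_smult[OF \<psi>] K.Units_l_inv)
  define U where "U = s ` {v \<in> carrier V. \<psi> v = \<zero>\<^bsub>K\<^esub>}"
  have "s v0 \<notin> U"
  proof
    assume "s v0 \<in> U"
    then obtain v where v: "v \<in> carrier V" "\<psi> v = \<zero>\<^bsub>K\<^esub>" "s v0 = s v" unfolding U_def by auto
    then have "\<psi> (v0 \<ominus>\<^bsub>V\<^esub> v) = \<zero>\<^bsub>K\<^esub>"
      using ker v0 mod_hom_eq_iff_diff_kernel[OF V W s, of v0 v] by simp
    then have "\<psi> v0 = \<psi> v" using v v0 mod_hom_eq_iff_diff_kernel[OF V KK \<psi>, of v0 v] by simp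
    then show False using v v0 by simp
  qed
  moreover have "U \<subseteq> carrier W" using mod_hom_closed[OF s] by (auto simp: U_def)
  moreover have "\<zero>\<^bsub>W\<^esub> \<in> U"
    using mod_hom_zero[OF V W s] mod_hom_zero[OF V KK \<psi>] by (force simp: U_def)
  moreover have "x \<oplus>\<^bsub>W\<^esub> y \<in> U" if "x \<in> U" "y \<in> U" for x y
    using that by (force simp: U_def mod_hom_add[OF s, symmetric] mod_hom_add[OF \<psi>])
  moreover have "a \<odot>\<^bsub>W\<^esub> x \<in> U" if "a \<in> carrier K" "x \<in> U" for a x
    using that by (force simp: U_def mod_hom_smult[OF s, symmetric] mod_hom_smult[OF \<psi>])
  ultimately obtain l where l: "l \<in> mod_hom K W (regular_module K)" "l (s v0) = \<one>\<^bsub>K\<^esub>"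
    "\<And>u. u \<in> U \<Longrightarrow> l u = \<zero>\<^bsub>K\<^esub>"
    using linear_functional_exists[OF \<open>field K\<close> W mod_hom_closed[OF s v0(1)], of U] by metis
  have "l (s v) = \<psi> v" if v: "v \<in> carrier V" for v
  proof -
    have c: "\<psi> v \<in> carrier K" using mod_hom_closed[OF \<psi> v] by simp
    let ?v = "v \<ominus>\<^bsub>V\<^esub> \<psi> v \<odot>\<^bsub>V\<^esub> v0"
    have "\<psi> ?v = \<psi> v \<ominus>\<^bsub>regular_module K\<^esub> \<psi> v"
      using v c v0 by (simp add: mod_hom_diff[OF V KK \<psi>] mod_hom_smult[OF \<psi>])
    then have "\<psi> ?v = \<zero>\<^bsub>K\<^esub>"
      using abelian_group.minus_eq_zero_iff[OF left_module_abelian_group[OF KK], of "\<psi> v" "\<psi> v"] c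
      by simp
    then have "l (s ?v) = \<zero>\<^bsub>K\<^esub>" using v c v0 by (intro l(3)) (auto simp: U_def)
    then have "l (s v) = l (s (\<psi> v \<odot>\<^bsub>V\<^esub> v0))"
      using v v0 c mod_hom_eq_iff_diff_kernel[OF V KK mod_hom_comp[OF s l(1)]] by simp
    also have "\<dots> = \<psi> v" using c v0 mod_hom_closed[OF s] l
      by (simp add: mod_hom_smult[OF s] mod_hom_smult[OF l(1)])
    finally show ?thesis .
  qed
  then show ?thesis using l(1) that by blast
qed

section \<open>Encoding functions on a finite set\<close>

text \<open>
  An infinite type is in bijection with its square, so finite powers of it can be embedded into it. This
  makes room in the universe for the free module on any module of the universe.
\<close>

lemma finite_power_embedding:
  assumes inf: "infinite (UNIV :: 'u set)" and "finite A"
  obtains \<iota> :: "('g \<Rightarrow> 'u) \<Rightarrow> 'u" where "inj_on \<iota> (A \<rightarrow>\<^sub>E UNIV)"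
proof -
  obtain \<pi> :: "'u \<times> 'u \<Rightarrow> 'u" where \<pi>: "inj \<pi>"
    using card_of_Times_same_infinite[OF inf]
    by (auto simp: card_of_ordIso[symmetric] bij_betw_def)
  have "\<exists>\<iota> :: ('g \<Rightarrow> 'u) \<Rightarrow> 'u. inj_on \<iota> (A \<rightarrow>\<^sub>E UNIV)"
    using \<open>finite A\<close>
  proof induction
    case empty
    show ?case by simp
  next
    case (insert a A)
    then obtain \<iota> :: "('g \<Rightarrow> 'u) \<Rightarrow> 'u" where \<iota>: "inj_on \<iota> (A \<rightarrow>\<^sub>E UNIV)" by blast
    have "inj_on (\<lambda>f. \<pi> (f a, \<iota> (restrict f A))) (insert a A \<rightarrow>\<^sub>E UNIV)"
    proof (rule inj_onI)
      fix f g assume fg: "f \<in> insert a A \<rightarrow>\<^sub>E UNIV" "g \<in> insert a A \<rightarrow>\<^sub>E UNIV"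
        and eq: "\<pi> (f a, \<iota> (restrict f A)) = \<pi> (g a, \<iota> (restrict g A))"
      have "f a = g a" "\<iota> (restrict f A) = \<iota> (restrict g A)" using injD[OF \<pi> eq] by auto
      moreover have "restrict f A = restrict g A" using calculation(2) by (intro inj_onD[OF \<iota>]) auto
      ultimately have "f x = g x" if "x \<in> insert a A" for x
        using that by (metis insertE restrict_apply')
      then show "f = g" using fg by (intro PiE_ext)
    qed
    then show ?case by blast
  qed
  then show ?thesis using that by blast
qed

section \<open>Group algebras and their modules\<close>

text \<open>
  The induced module \<open>kG \<otimes> V\<close>, written as functions from \<open>G\<close> to \<open>V\<close>: the value at \<open>x\<close> is the
  coefficient of \<open>x\<close>. For \<open>V = k\<close> the action is the multiplication of the group algebra, which is how
  the ring axioms for \<open>kG\<close> are obtained below.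
\<close>

definition fun_module ::
  "('k, 'c) ring_scheme \<Rightarrow> ('g, 'd) monoid_scheme \<Rightarrow> ('k, 'v) module \<Rightarrow> ('g \<Rightarrow> 'k, 'g \<Rightarrow> 'v) module"
  where "fun_module K G V = \<lparr>carrier = carrier G \<rightarrow>\<^sub>E carrier V,
     monoid.mult = (\<lambda>f g. f), monoid.one = (\<lambda>x\<in>carrier G. \<zero>\<^bsub>V\<^esub>),
     ring.zero = (\<lambda>x\<in>carrier G. \<zero>\<^bsub>V\<^esub>), ring.add = (\<lambda>f g. \<lambda>x\<in>carrier G. f x \<oplus>\<^bsub>V\<^esub> g x),
     smult = (\<lambda>a f. \<lambda>x\<in>carrier G. \<Oplus>\<^bsub>V\<^esub>y\<in>carrier G. a y \<odot>\<^bsub>V\<^esub> f (inv\<^bsub>G\<^esub> y \<otimes>\<^bsub>G\<^esub> x))\<rparr>"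

definition monomial :: "('k, 'c) ring_scheme \<Rightarrow> ('g, 'd) monoid_scheme \<Rightarrow> 'k \<Rightarrow> 'g \<Rightarrow> 'g \<Rightarrow> 'k" where
  "monomial K G a g = (\<lambda>x\<in>carrier G. if x = g then a else \<zero>\<^bsub>K\<^esub>)"

definition subset_sum :: "('k, 'c) ring_scheme \<Rightarrow> ('g, 'd) monoid_scheme \<Rightarrow> 'g set \<Rightarrow> 'g \<Rightarrow> 'k" where
  "subset_sum K G H = (\<lambda>x\<in>carrier G. if x \<in> H then \<one>\<^bsub>K\<^esub> else \<zero>\<^bsub>K\<^esub>)"

locale finite_group_algebra = K: field K + G: group G
  for K :: "('k, 'c) ring_scheme" and G :: "('g, 'd) monoid_scheme" +
  assumes finite_G: "finite (carrier G)"
begin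

abbreviation R where "R \<equiv> group_algebra K G"
abbreviation \<delta> where "\<delta> g \<equiv> monomial K G \<one>\<^bsub>K\<^esub> g"
abbreviation \<N> where "\<N> H \<equiv> subset_sum K G H"
abbreviation G_mult (infixl \<open>\<bullet>\<close> 70) where "g \<bullet> h \<equiv> g \<otimes>\<^bsub>G\<^esub> h"
abbreviation R_mult (infixl \<open>\<star>\<close> 70) where "a \<star> b \<equiv> a \<otimes>\<^bsub>R\<^esub> b"

lemma carrier_R: "carrier R = carrier G \<rightarrow>\<^sub>E carrier K"
  by (simp add: group_algebra_def)

lemma R_value [simp]: "a \<in> carrier R \<Longrightarrow> x \<in> carrier G \<Longrightarrow> a x \<in> carrier K"
  by (auto simp: carrier_R)

lemma R_eqI: "\<lbrakk>a \<in> carrier R; b \<in> carrier R; \<And>x. x \<in> carrier G \<Longrightarrow> a x = b x\<rbrakk> \<Longrightarrow> a = b"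
  by (auto simp: carrier_R intro: PiE_ext)

lemma add_R: "x \<in> carrier G \<Longrightarrow> (a \<oplus>\<^bsub>R\<^esub> b) x = a x \<oplus>\<^bsub>K\<^esub> b x"
  and zero_R: "x \<in> carrier G \<Longrightarrow> \<zero>\<^bsub>R\<^esub> x = \<zero>\<^bsub>K\<^esub>"
  and one_R: "\<one>\<^bsub>R\<^esub> = \<delta> \<one>\<^bsub>G\<^esub>"
  and mult_R: "x \<in> carrier G \<Longrightarrow>
    (a \<star> b) x = (\<Oplus>\<^bsub>K\<^esub>y\<in>carrier G. a y \<otimes>\<^bsub>K\<^esub> b (inv\<^bsub>G\<^esub> y \<bullet> x))"
  by (simp_all add: group_algebra_def monomial_def)

lemma monomial_closed [simp]: "a \<in> carrier K \<Longrightarrow> monomial K G a g \<in> carrier R"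
  by (auto simp: carrier_R monomial_def)

lemma subset_sum_closed [simp]: "\<N> H \<in> carrier R"
  by (auto simp: carrier_R subset_sum_def)

lemma mult_R_closed: "a \<in> carrier R \<Longrightarrow> b \<in> carrier R \<Longrightarrow> a \<star> b \<in> carrier R"
  by (auto simp: carrier_R group_algebra_def intro!: K.finsum_closed)

lemma finsum_translate:
  assumes "abelian_group V" "z \<in> carrier G" "\<And>y. y \<in> carrier G \<Longrightarrow> f y \<in> carrier V"
  shows "(\<Oplus>\<^bsub>V\<^esub>y\<in>carrier G. f y) = (\<Oplus>\<^bsub>V\<^esub>y\<in>carrier G. f (z \<bullet> y))"
proof -
  interpret V: abelian_group V by fact
  show ?thesis
    using V.finsum_reindex[of f "\<lambda>y. z \<bullet> y" "carrier G"] assms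
    by (simp add: G.surj_const_mult G.inj_on_cmult Pi_iff)
qed

context
  fixes V :: "('k, 'v) module"
  assumes V: "left_module K V"
begin

interpretation V: left_module K V by fact

abbreviation F where "F \<equiv> fun_module K G V"

lemma carrier_F: "carrier F = carrier G \<rightarrow>\<^sub>E carrier V"
  by (simp add: fun_module_def)

lemma F_value [simp]: "f \<in> carrier F \<Longrightarrow> x \<in> carrier G \<Longrightarrow> f x \<in> carrier V"
  by (auto simp: carrier_F)

lemma F_eqI: "\<lbrakk>a \<in> carrier F; b \<in> carrier F; \<And>x. x \<in> carrier G \<Longrightarrow> a x = b x\<rbrakk> \<Longrightarrow> a = b"
  by (auto simp: carrier_F intro: PiE_ext)

lemma add_F: "x \<in> carrier G \<Longrightarrow> (f \<oplus>\<^bsub>F\<^esub> g) x = f x \<oplus>\<^bsub>V\<^esub> g x"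
  and zero_F: "x \<in> carrier G \<Longrightarrow> \<zero>\<^bsub>F\<^esub> x = \<zero>\<^bsub>V\<^esub>"
  and smult_F: "x \<in> carrier G \<Longrightarrow>
    (a \<odot>\<^bsub>F\<^esub> f) x = (\<Oplus>\<^bsub>V\<^esub>y\<in>carrier G. a y \<odot>\<^bsub>V\<^esub> f (inv\<^bsub>G\<^esub> y \<bullet> x))"
  by (simp_all add: fun_module_def)

lemma add_F_closed: "f \<in> carrier F \<Longrightarrow> g \<in> carrier F \<Longrightarrow> f \<oplus>\<^bsub>F\<^esub> g \<in> carrier F"
  and zero_F_closed: "\<zero>\<^bsub>F\<^esub> \<in> carrier F"
  by (auto simp: fun_module_def)

lemma smult_F_closed: "a \<in> carrier R \<Longrightarrow> f \<in> carrier F \<Longrightarrow> a \<odot>\<^bsub>F\<^esub> f \<in> carrier F"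
  by (auto simp: fun_module_def carrier_R Pi_iff PiE_iff intro!: V.M.finsum_closed V.smult_closed)

lemma abelian_group_F: "abelian_group F"
proof (rule abelian_groupI)
  fix f assume f: "f \<in> carrier F"
  have "(\<lambda>x\<in>carrier G. \<ominus>\<^bsub>V\<^esub> f x) \<in> carrier F" using f by (auto simp: carrier_F)
  moreover have "(\<lambda>x\<in>carrier G. \<ominus>\<^bsub>V\<^esub> f x) \<oplus>\<^bsub>F\<^esub> f = \<zero>\<^bsub>F\<^esub>"
    using f calculation
    by (intro F_eqI add_F_closed zero_F_closed) (auto simp: add_F zero_F V.M.l_neg)
  ultimately show "\<exists>g\<in>carrier F. g \<oplus>\<^bsub>F\<^esub> f = \<zero>\<^bsub>F\<^esub>" by blast
qed (auto intro!: F_eqI simp: add_F_closed zero_F_closed add_F zero_F V.M.a_ac)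

lemma smult_F_assoc:
  assumes a: "a \<in> carrier R" and b: "b \<in> carrier R" and f: "f \<in> carrier F"
  shows "(a \<star> b) \<odot>\<^bsub>F\<^esub> f = a \<odot>\<^bsub>F\<^esub> (b \<odot>\<^bsub>F\<^esub> f)"
proof (rule F_eqI)
  fix x assume x: "x \<in> carrier G"
  note [simp] = a b f x finite_G V.smult_closed Pi_iff
  have "((a \<star> b) \<odot>\<^bsub>F\<^esub> f) x
    = (\<Oplus>\<^bsub>V\<^esub>y\<in>carrier G. (\<Oplus>\<^bsub>K\<^esub>z\<in>carrier G. a z \<otimes>\<^bsub>K\<^esub> b (inv\<^bsub>G\<^esub> z \<bullet> y)) \<odot>\<^bsub>V\<^esub> f (inv\<^bsub>G\<^esub> y \<bullet> x))"
    unfolding smult_F[OF x] by (intro V.M.finsum_cong') (auto simp: mult_R)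
  also have "\<dots> = (\<Oplus>\<^bsub>V\<^esub>y\<in>carrier G. \<Oplus>\<^bsub>V\<^esub>z\<in>carrier G.
      a z \<odot>\<^bsub>V\<^esub> (b (inv\<^bsub>G\<^esub> z \<bullet> y) \<odot>\<^bsub>V\<^esub> f (inv\<^bsub>G\<^esub> y \<bullet> x)))"
    by (auto simp: V.smult_finsum_left V.smult_assoc intro!: V.M.finsum_cong' V.M.finsum_closed)
  also have "\<dots> = (\<Oplus>\<^bsub>V\<^esub>z\<in>carrier G. \<Oplus>\<^bsub>V\<^esub>y\<in>carrier G.
      a z \<odot>\<^bsub>V\<^esub> (b (inv\<^bsub>G\<^esub> z \<bullet> y) \<odot>\<^bsub>V\<^esub> f (inv\<^bsub>G\<^esub> y \<bullet> x)))"
    by (intro V.M.finsum_swap) auto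
  also have "\<dots> = (\<Oplus>\<^bsub>V\<^esub>z\<in>carrier G. \<Oplus>\<^bsub>V\<^esub>y\<in>carrier G.
      a z \<odot>\<^bsub>V\<^esub> (b y \<odot>\<^bsub>V\<^esub> f (inv\<^bsub>G\<^esub> y \<bullet> (inv\<^bsub>G\<^esub> z \<bullet> x))))"
  proof (rule V.M.finsum_cong')
    fix z assume z: "z \<in> carrier G"
    note [simp] = z
    show "(\<Oplus>\<^bsub>V\<^esub>y\<in>carrier G. a z \<odot>\<^bsub>V\<^esub> (b (inv\<^bsub>G\<^esub> z \<bullet> y) \<odot>\<^bsub>V\<^esub> f (inv\<^bsub>G\<^esub> y \<bullet> x)))
      = (\<Oplus>\<^bsub>V\<^esub>y\<in>carrier G. a z \<odot>\<^bsub>V\<^esub> (b y \<odot>\<^bsub>V\<^esub> f (inv\<^bsub>G\<^esub> y \<bullet> (inv\<^bsub>G\<^esub> z \<bullet> x))))"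
      by (subst finsum_translate[OF V.M.abelian_group_axioms z])
        (auto intro!: V.M.finsum_cong' simp: G.m_assoc[symmetric] G.inv_mult_group)
  qed auto
  also have "\<dots> = (\<Oplus>\<^bsub>V\<^esub>z\<in>carrier G. a z \<odot>\<^bsub>V\<^esub> (b \<odot>\<^bsub>F\<^esub> f) (inv\<^bsub>G\<^esub> z \<bullet> x))"
    by (intro V.M.finsum_cong') (auto simp: smult_F V.smult_finsum_right intro!: V.M.finsum_closed)
  also have "\<dots> = (a \<odot>\<^bsub>F\<^esub> (b \<odot>\<^bsub>F\<^esub> f)) x" by (simp add: smult_F)
  finally show "((a \<star> b) \<odot>\<^bsub>F\<^esub> f) x = (a \<odot>\<^bsub>F\<^esub> (b \<odot>\<^bsub>F\<^esub> f)) x" .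
qed (simp_all add: assms smult_F_closed mult_R_closed)

lemma monomial_smult_F:
  assumes "a \<in> carrier K" "g \<in> carrier G" "f \<in> carrier F" "x \<in> carrier G"
  shows "(monomial K G a g \<odot>\<^bsub>F\<^esub> f) x = a \<odot>\<^bsub>V\<^esub> f (inv\<^bsub>G\<^esub> g \<bullet> x)"
proof -
  have "(\<Oplus>\<^bsub>V\<^esub>y\<in>carrier G. monomial K G a g y \<odot>\<^bsub>V\<^esub> f (inv\<^bsub>G\<^esub> y \<bullet> x))
    = monomial K G a g g \<odot>\<^bsub>V\<^esub> f (inv\<^bsub>G\<^esub> g \<bullet> x)"
    using assms finite_G
    by (intro V.M.finsum_single) (auto simp: monomial_def V.smult_closed V.smult_zero_left)
  then show ?thesis using assms by (simp add: smult_F monomial_def)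
qed

lemma smult_F_l_distr:
  assumes "a \<in> carrier R" "b \<in> carrier R" "f \<in> carrier F"
  shows "(a \<oplus>\<^bsub>R\<^esub> b) \<odot>\<^bsub>F\<^esub> f = a \<odot>\<^bsub>F\<^esub> f \<oplus>\<^bsub>F\<^esub> b \<odot>\<^bsub>F\<^esub> f"
proof (rule F_eqI)
  have ab: "a \<oplus>\<^bsub>R\<^esub> b \<in> carrier R" using assms by (auto simp: group_algebra_def)
  then show "(a \<oplus>\<^bsub>R\<^esub> b) \<odot>\<^bsub>F\<^esub> f \<in> carrier F" "a \<odot>\<^bsub>F\<^esub> f \<oplus>\<^bsub>F\<^esub> b \<odot>\<^bsub>F\<^esub> f \<in> carrier F"
    using assms by (auto intro!: smult_F_closed add_F_closed)
  fix x assume x: "x \<in> carrier G"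
  have "((a \<oplus>\<^bsub>R\<^esub> b) \<odot>\<^bsub>F\<^esub> f) x
    = (\<Oplus>\<^bsub>V\<^esub>y\<in>carrier G. a y \<odot>\<^bsub>V\<^esub> f (inv\<^bsub>G\<^esub> y \<bullet> x) \<oplus>\<^bsub>V\<^esub> b y \<odot>\<^bsub>V\<^esub> f (inv\<^bsub>G\<^esub> y \<bullet> x))"
    unfolding smult_F[OF x] using assms x
    by (intro V.M.finsum_cong') (auto simp: add_R V.smult_l_distr V.smult_closed)
  also have "\<dots> = (\<Oplus>\<^bsub>V\<^esub>y\<in>carrier G. a y \<odot>\<^bsub>V\<^esub> f (inv\<^bsub>G\<^esub> y \<bullet> x)) \<oplus>\<^bsub>V\<^esub> (\<Oplus>\<^bsub>V\<^esub>y\<in>carrier G. b y \<odot>\<^bsub>V\<^esub> f (inv\<^bsub>G\<^esub> y \<bullet> x))"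
    using assms x by (intro V.M.finsum_addf) (auto simp: V.smult_closed)
  finally show "((a \<oplus>\<^bsub>R\<^esub> b) \<odot>\<^bsub>F\<^esub> f) x = (a \<odot>\<^bsub>F\<^esub> f \<oplus>\<^bsub>F\<^esub> b \<odot>\<^bsub>F\<^esub> f) x"
    using x by (simp add: smult_F add_F)
qed

lemma smult_F_r_distr:
  assumes "a \<in> carrier R" "f \<in> carrier F" "g \<in> carrier F"
  shows "a \<odot>\<^bsub>F\<^esub> (f \<oplus>\<^bsub>F\<^esub> g) = a \<odot>\<^bsub>F\<^esub> f \<oplus>\<^bsub>F\<^esub> a \<odot>\<^bsub>F\<^esub> g"
proof (rule F_eqI)
  show "a \<odot>\<^bsub>F\<^esub> (f \<oplus>\<^bsub>F\<^esub> g) \<in> carrier F" "a \<odot>\<^bsub>F\<^esub> f \<oplus>\<^bsub>F\<^esub> a \<odot>\<^bsub>F\<^esub> g \<in> carrier F"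
    using assms by (auto intro!: smult_F_closed add_F_closed)
  fix x assume x: "x \<in> carrier G"
  have "(a \<odot>\<^bsub>F\<^esub> (f \<oplus>\<^bsub>F\<^esub> g)) x
    = (\<Oplus>\<^bsub>V\<^esub>y\<in>carrier G. a y \<odot>\<^bsub>V\<^esub> f (inv\<^bsub>G\<^esub> y \<bullet> x) \<oplus>\<^bsub>V\<^esub> a y \<odot>\<^bsub>V\<^esub> g (inv\<^bsub>G\<^esub> y \<bullet> x))"
    unfolding smult_F[OF x] using assms x
    by (intro V.M.finsum_cong') (auto simp: add_F V.smult_r_distr V.smult_closed)
  also have "\<dots> = (\<Oplus>\<^bsub>V\<^esub>y\<in>carrier G. a y \<odot>\<^bsub>V\<^esub> f (inv\<^bsub>G\<^esub> y \<bullet> x)) \<oplus>\<^bsub>V\<^esub> (\<Oplus>\<^bsub>V\<^esub>y\<in>carrier G. a y \<odot>\<^bsub>V\<^esub> g (inv\<^bsub>G\<^esub> y \<bullet> x))"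
    using assms x by (intro V.M.finsum_addf) (auto simp: V.smult_closed)
  finally show "(a \<odot>\<^bsub>F\<^esub> (f \<oplus>\<^bsub>F\<^esub> g)) x = (a \<odot>\<^bsub>F\<^esub> f \<oplus>\<^bsub>F\<^esub> a \<odot>\<^bsub>F\<^esub> g) x"
    using x by (simp add: smult_F add_F)
qed

lemma smult_F_one: "f \<in> carrier F \<Longrightarrow> \<one>\<^bsub>R\<^esub> \<odot>\<^bsub>F\<^esub> f = f"
  by (rule F_eqI) (auto simp: one_R smult_F_closed monomial_smult_F V.smult_one)

end

lemma fun_module_regular:
  "carrier R = carrier (fun_module K G (regular_module K))"
  "ring.add R = ring.add (fun_module K G (regular_module K))"
  "\<zero>\<^bsub>R\<^esub> = \<zero>\<^bsub>fun_module K G (regular_module K)\<^esub>"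
  "monoid.mult R = smult (fun_module K G (regular_module K))"
  by (simp_all add: group_algebra_def fun_module_def fun_eq_iff)

lemma ring_R: "ring R"
proof -
  have reg: "left_module K (regular_module K)" by (rule K.left_module_regular)
  let ?F = "fun_module K G (regular_module K)"
  interpret F: abelian_group ?F by (rule abelian_group_F[OF reg])
  note eq = fun_module_regular
  have "abelian_group R"
    by (rule abelian_groupI) (auto simp: eq F.a_ac intro!: bexI[of _ "\<ominus>\<^bsub>?F\<^esub> _"] F.l_neg)
  moreover have "a \<star> \<one>\<^bsub>R\<^esub> = a" if a: "a \<in> carrier R" for a
  proof (rule R_eqI)
    fix x assume x: "x \<in> carrier G"
    have "inv\<^bsub>G\<^esub> y \<bullet> x = \<one>\<^bsub>G\<^esub> \<longleftrightarrow> y = x" if "y \<in> carrier G" for y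
      using that x G.inv_solve_left'[of "\<one>\<^bsub>G\<^esub>" y x] by auto
    then show "(a \<star> \<one>\<^bsub>R\<^esub>) x = a x"
      unfolding mult_R[OF x] using a x finite_G
      by (subst K.finsum_single[of _ x]) (auto simp: one_R monomial_def)
  qed (simp_all add: a one_R mult_R_closed)
  moreover have "monoid R"
    using smult_F_assoc[OF reg, folded eq] smult_F_one[OF reg, folded eq] calculation(2)
    by (intro monoidI) (auto simp: mult_R_closed one_R)
  ultimately show ?thesis
    using smult_F_l_distr[OF reg, folded eq] smult_F_r_distr[OF reg, folded eq]
    by (intro ringI) auto
qed

sublocale R: ring R by (rule ring_R)

lemma left_module_F:
  assumes V: "left_module K V"
  shows "left_module R (fun_module K G V)"
  unfolding left_module_def left_module_axioms_def
  using ring_R abelian_group_F[OF V] smult_F_closed[OF V] smult_F_l_distr[OF V]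
    smult_F_r_distr[OF V] smult_F_assoc[OF V] smult_F_one[OF V] by blast

lemma finsum_R_value:
  assumes "t \<in> A \<rightarrow> carrier R" "x \<in> carrier G"
  shows "(\<Oplus>\<^bsub>R\<^esub>i\<in>A. t i) x = (\<Oplus>\<^bsub>K\<^esub>i\<in>A. t i x)"
  using assms
  by (intro additive_finsum[OF R.abelian_group_axioms K.abelian_group_axioms]) (auto simp: add_R)

lemma monomial_mult_left:
  assumes "a \<in> carrier K" "g \<in> carrier G" "r \<in> carrier R" "x \<in> carrier G"
  shows "(monomial K G a g \<star> r) x = a \<otimes>\<^bsub>K\<^esub> r (inv\<^bsub>G\<^esub> g \<bullet> x)"
  using monomial_smult_F[OF K.left_module_regular] assms by (simp add: fun_module_regular)

lemma monomial_mult_right: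
  assumes "a \<in> carrier K" "g \<in> carrier G" "r \<in> carrier R" "x \<in> carrier G"
  shows "(r \<star> monomial K G a g) x = r (x \<bullet> inv\<^bsub>G\<^esub> g) \<otimes>\<^bsub>K\<^esub> a"
proof -
  have iff: "inv\<^bsub>G\<^esub> y \<bullet> x = g \<longleftrightarrow> y = x \<bullet> inv\<^bsub>G\<^esub> g" if "y \<in> carrier G" for y
    using that assms by (metis G.inv_closed G.inv_equality G.inv_inv G.inv_mult_group G.inv_solve_left
        G.inv_solve_right)
  have "(\<Oplus>\<^bsub>K\<^esub>y\<in>carrier G. r y \<otimes>\<^bsub>K\<^esub> monomial K G a g (inv\<^bsub>G\<^esub> y \<bullet> x))
    = r (x \<bullet> inv\<^bsub>G\<^esub> g) \<otimes>\<^bsub>K\<^esub> monomial K G a g (inv\<^bsub>G\<^esub> (x \<bullet> inv\<^bsub>G\<^esub> g) \<bullet> x)"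
    using assms finite_G by (intro K.finsum_single) (auto simp: monomial_def iff)
  moreover have "inv\<^bsub>G\<^esub> (x \<bullet> inv\<^bsub>G\<^esub> g) \<bullet> x = g" using iff assms by simp
  ultimately show ?thesis using assms by (simp add: mult_R monomial_def)
qed

lemma monomial_mult:
  assumes "a \<in> carrier K" "b \<in> carrier K" "g \<in> carrier G" "h \<in> carrier G"
  shows "monomial K G a g \<star> monomial K G b h = monomial K G (a \<otimes>\<^bsub>K\<^esub> b) (g \<bullet> h)"
proof (rule R_eqI)
  fix x assume x: "x \<in> carrier G"
  have "inv\<^bsub>G\<^esub> g \<bullet> x = h \<longleftrightarrow> x = g \<bullet> h"
    using x assms by (metis G.inv_closed G.inv_inv G.inv_solve_left)
  then show "(monomial K G a g \<star> monomial K G b h) x = monomial K G (a \<otimes>\<^bsub>K\<^esub> b) (g \<bullet> h) x"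
    using x assms by (simp add: monomial_mult_left) (simp add: monomial_def)
qed (use assms in auto)

lemma monomial_add:
  "\<lbrakk>a \<in> carrier K; b \<in> carrier K; g \<in> carrier G\<rbrakk>
    \<Longrightarrow> monomial K G (a \<oplus>\<^bsub>K\<^esub> b) g = monomial K G a g \<oplus>\<^bsub>R\<^esub> monomial K G b g"
  by (rule R_eqI) (simp_all, simp add: add_R monomial_def)

lemma delta_pow: "g \<in> carrier G \<Longrightarrow> \<delta> g [^]\<^bsub>R\<^esub> (n::nat) = \<delta> (g [^]\<^bsub>G\<^esub> n)"
  by (induction n) (auto simp: one_R monomial_mult)

lemma sum_of_monomials: "r \<in> carrier R \<Longrightarrow> r = (\<Oplus>\<^bsub>R\<^esub>g\<in>carrier G. monomial K G (r g) g)"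
proof (rule R_eqI)
  fix x assume r: "r \<in> carrier R" and x: "x \<in> carrier G"
  have "(\<Oplus>\<^bsub>K\<^esub>g\<in>carrier G. monomial K G (r g) g x) = monomial K G (r x) x x"
    using r x finite_G by (intro K.finsum_single) (auto simp: monomial_def)
  then show "r x = (\<Oplus>\<^bsub>R\<^esub>g\<in>carrier G. monomial K G (r g) g) x"
    using r x by (simp add: finsum_R_value Pi_iff) (simp add: monomial_def)
qed (auto intro!: R.finsum_closed)

lemma mod_homI_monomial:
  assumes W: "left_module R W" and W': "left_module R W'"
    and cl: "\<And>w. w \<in> carrier W \<Longrightarrow> h w \<in> carrier W'"
    and add: "\<And>v w. v \<in> carrier W \<Longrightarrow> w \<in> carrier W \<Longrightarrow> h (v \<oplus>\<^bsub>W\<^esub> w) = h v \<oplus>\<^bsub>W'\<^esub> h w"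
    and mon: "\<And>a g w. \<lbrakk>a \<in> carrier K; g \<in> carrier G; w \<in> carrier W\<rbrakk>
      \<Longrightarrow> h (monomial K G a g \<odot>\<^bsub>W\<^esub> w) = monomial K G a g \<odot>\<^bsub>W'\<^esub> h w"
  shows "h \<in> mod_hom R W W'"
proof (rule mod_homI[OF cl add])
  interpret W: left_module R W by fact
  interpret W': left_module R W' by fact
  fix r w assume r: "r \<in> carrier R" and w: "w \<in> carrier W"
  have "h (r \<odot>\<^bsub>W\<^esub> w) = h (\<Oplus>\<^bsub>W\<^esub>g\<in>carrier G. monomial K G (r g) g \<odot>\<^bsub>W\<^esub> w)"
    using r w by (subst sum_of_monomials[OF r], subst W.smult_finsum_left) auto
  also have "\<dots> = (\<Oplus>\<^bsub>W'\<^esub>g\<in>carrier G. h (monomial K G (r g) g \<odot>\<^bsub>W\<^esub> w))"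
    using r w by (intro additive_finsum[OF W.M.abelian_group_axioms W'.M.abelian_group_axioms cl add])
      (auto intro!: W.smult_closed)
  also have "\<dots> = (\<Oplus>\<^bsub>W'\<^esub>g\<in>carrier G. monomial K G (r g) g \<odot>\<^bsub>W'\<^esub> h w)"
    using r w cl by (intro W'.M.finsum_cong') (auto simp: mon intro!: W'.smult_closed)
  also have "\<dots> = r \<odot>\<^bsub>W'\<^esub> h w"
    using r w cl W'.smult_finsum_left[of "h w" "\<lambda>g. monomial K G (r g) g" "carrier G"]
    by (simp add: sum_of_monomials[OF r, symmetric] Pi_iff)
  finally show "h (r \<odot>\<^bsub>W\<^esub> w) = r \<odot>\<^bsub>W'\<^esub> h w" .
qed

end

definition scalar_restriction ::
  "('k, 'c) ring_scheme \<Rightarrow> ('g, 'd) monoid_scheme \<Rightarrow> ('g \<Rightarrow> 'k, 'u) module \<Rightarrow> ('k, 'u) module" where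
  "scalar_restriction K G W = \<lparr>carrier = carrier W, monoid.mult = monoid.mult W,
     monoid.one = \<one>\<^bsub>W\<^esub>, ring.zero = \<zero>\<^bsub>W\<^esub>, ring.add = ring.add W,
     smult = (\<lambda>a x. monomial K G a \<one>\<^bsub>G\<^esub> \<odot>\<^bsub>W\<^esub> x)\<rparr>"

lemma scalar_restriction_simps [simp]:
  "carrier (scalar_restriction K G W) = carrier W"
  "\<zero>\<^bsub>scalar_restriction K G W\<^esub> = \<zero>\<^bsub>W\<^esub>"
  "x \<oplus>\<^bsub>scalar_restriction K G W\<^esub> y = x \<oplus>\<^bsub>W\<^esub> y"
  "a \<odot>\<^bsub>scalar_restriction K G W\<^esub> x = monomial K G a \<one>\<^bsub>G\<^esub> \<odot>\<^bsub>W\<^esub> x"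
  by (simp_all add: scalar_restriction_def)

context finite_group_algebra
begin

lemma left_module_scalar_restriction:
  assumes W: "left_module R W"
  shows "left_module K (scalar_restriction K G W)"
proof -
  interpret W: left_module R W by fact
  have "abelian_group (scalar_restriction K G W)"
    by (rule abelian_groupI) (auto simp: W.M.a_ac intro!: bexI[of _ "\<ominus>\<^bsub>W\<^esub> _"] W.M.l_neg)
  then show ?thesis
    unfolding left_module_def left_module_axioms_def
    by (auto simp: K.ring_axioms W.smult_closed monomial_add W.smult_l_distr W.smult_r_distr
        monomial_mult W.smult_assoc[symmetric] W.smult_one one_R[symmetric])
qed

text \<open>The map is the action \<open>kG \<otimes> J \<rightarrow> J\<close>, where \<open>J\<close> on the left is regarded as a vector space.\<close>

lemma induced_module_cover:
  assumes J: "left_module R J"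
  defines "E \<equiv> fun_module K G (scalar_restriction K G J)"
  obtains q where "q \<in> mod_hom R E J" "q ` carrier E = carrier J"
proof -
  interpret J: left_module R J by fact
  have V: "left_module K (scalar_restriction K G J)" by (rule left_module_scalar_restriction[OF J])
  note [simp] = J.smult_closed finite_G
  note val = F_value[OF V, folded E_def, simplified]
  define q where "q = (\<lambda>f. \<Oplus>\<^bsub>J\<^esub>s\<in>carrier G. \<delta> s \<odot>\<^bsub>J\<^esub> f s)"
  have "q \<in> mod_hom R E J"
  proof (rule mod_homI_monomial)
    show "left_module R E" unfolding E_def by (rule left_module_F[OF V])
    show "left_module R J" by fact
    show "q f \<in> carrier J" if "f \<in> carrier E" for f
      using that val by (auto simp: q_def intro!: J.M.finsum_closed)
    show "q (f \<oplus>\<^bsub>E\<^esub> f') = q f \<oplus>\<^bsub>J\<^esub> q f'" if f: "f \<in> carrier E" "f' \<in> carrier E" for f f'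
    proof -
      have "q (f \<oplus>\<^bsub>E\<^esub> f') = (\<Oplus>\<^bsub>J\<^esub>s\<in>carrier G. \<delta> s \<odot>\<^bsub>J\<^esub> f s \<oplus>\<^bsub>J\<^esub> \<delta> s \<odot>\<^bsub>J\<^esub> f' s)"
        unfolding q_def using f val
        by (intro J.M.finsum_cong') (auto simp: E_def add_F[OF V] J.smult_r_distr)
      then show ?thesis using f val by (simp add: q_def J.M.finsum_addf Pi_iff)
    qed
    show "q (monomial K G a g \<odot>\<^bsub>E\<^esub> f) = monomial K G a g \<odot>\<^bsub>J\<^esub> q f"
      if a: "a \<in> carrier K" and g: "g \<in> carrier G" and f: "f \<in> carrier E" for a g f
    proof -
      let ?m = "monomial K G a g"
      have mf: "?m \<odot>\<^bsub>E\<^esub> f \<in> carrier E"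
        using a f smult_F_closed[OF V, of ?m f] by (simp add: E_def)
      have "q (?m \<odot>\<^bsub>E\<^esub> f) = (\<Oplus>\<^bsub>J\<^esub>s\<in>carrier G. \<delta> (g \<bullet> s) \<odot>\<^bsub>J\<^esub> (?m \<odot>\<^bsub>E\<^esub> f) (g \<bullet> s))"
        unfolding q_def using val[OF mf]
        by (intro finsum_translate[OF J.M.abelian_group_axioms g]) auto
      also have "\<dots> = (\<Oplus>\<^bsub>J\<^esub>s\<in>carrier G. ?m \<odot>\<^bsub>J\<^esub> (\<delta> s \<odot>\<^bsub>J\<^esub> f s))"
      proof (rule J.M.finsum_cong')
        fix s assume s: "s \<in> carrier G"
        have "(?m \<odot>\<^bsub>E\<^esub> f) (g \<bullet> s) = monomial K G a \<one>\<^bsub>G\<^esub> \<odot>\<^bsub>J\<^esub> f s"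
          using monomial_smult_F[OF V a g, of f "g \<bullet> s"] f g s
          by (simp add: E_def G.m_assoc[symmetric])
        then show "\<delta> (g \<bullet> s) \<odot>\<^bsub>J\<^esub> (?m \<odot>\<^bsub>E\<^esub> f) (g \<bullet> s) = ?m \<odot>\<^bsub>J\<^esub> (\<delta> s \<odot>\<^bsub>J\<^esub> f s)"
          using a g s f val by (simp add: J.smult_assoc[symmetric] monomial_mult)
      qed (use a f val in auto)
      also have "\<dots> = ?m \<odot>\<^bsub>J\<^esub> q f"
        unfolding q_def using a f val by (intro J.smult_finsum_right[symmetric]) auto
      finally show ?thesis .
    qed
  qed
  moreover have "v \<in> q ` carrier E" if v: "v \<in> carrier J" for v
  proof -
    let ?f = "\<lambda>x\<in>carrier G. if x = \<one>\<^bsub>G\<^esub> then v else \<zero>\<^bsub>J\<^esub>"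
    have f: "?f \<in> carrier E" using v by (auto simp: E_def carrier_F[OF V])
    have "q ?f = \<delta> \<one>\<^bsub>G\<^esub> \<odot>\<^bsub>J\<^esub> ?f \<one>\<^bsub>G\<^esub>"
      unfolding q_def using v by (intro J.M.finsum_single) (auto simp: J.smult_zero_right)
    then have "q ?f = v" using v by (simp add: one_R[symmetric] J.smult_one)
    then show ?thesis using f by (metis image_eqI)
  qed
  moreover have "q ` carrier E \<subseteq> carrier J" using calculation(1) by (auto simp: mod_hom_closed)
  ultimately show ?thesis using that by blast
qed

text \<open>
  An \<open>H\<close>-invariant function is the sum of the \<open>H\<close>-translates of its restriction to a set of
  coset representatives.
\<close>

lemma invariant_imp_norm_multiple:
  assumes V: "left_module K V" and H: "subgroup H G" and f: "f \<in> carrier (fun_module K G V)"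
    and inv: "\<And>h x. h \<in> H \<Longrightarrow> x \<in> carrier G \<Longrightarrow> f (h \<bullet> x) = f x"
  shows "\<exists>f'\<in>carrier (fun_module K G V). f = \<N> H \<odot>\<^bsub>fun_module K G V\<^esub> f'"
proof -
  let ?F = "fun_module K G V"
  interpret V: left_module K V by fact
  interpret H: subgroup H G by fact
  define rep where "rep = (\<lambda>x. SOME u. u \<in> carrier G \<and> x \<bullet> inv\<^bsub>G\<^esub> u \<in> H)"
  have rep: "rep x \<in> carrier G" "x \<bullet> inv\<^bsub>G\<^esub> rep x \<in> H" if "x \<in> carrier G" for x
    using someI[of "\<lambda>u. u \<in> carrier G \<and> x \<bullet> inv\<^bsub>G\<^esub> u \<in> H" x] that by (auto simp: rep_def)
  have rep_eq: "rep (h \<bullet> x) = rep x" if h: "h \<in> H" and x: "x \<in> carrier G" for h x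
  proof -
    have "h \<bullet> x \<bullet> inv\<^bsub>G\<^esub> u \<in> H \<longleftrightarrow> x \<bullet> inv\<^bsub>G\<^esub> u \<in> H" if u: "u \<in> carrier G" for u
    proof -
      let ?t = "x \<bullet> inv\<^bsub>G\<^esub> u"
      have "h \<bullet> x \<bullet> inv\<^bsub>G\<^esub> u = h \<bullet> ?t" using h x u by (simp add: G.m_assoc)
      moreover have "inv\<^bsub>G\<^esub> h \<bullet> (h \<bullet> ?t) = ?t" using h x u by (intro G.inv_mult_cancel) auto
      ultimately show ?thesis using H.m_closed[OF h, of ?t]
          H.m_closed[OF H.m_inv_closed[OF h], of "h \<bullet> ?t"] by metis
    qed
    then show ?thesis unfolding rep_def by metis
  qed
  define f' where "f' = (\<lambda>x\<in>carrier G. if x = rep x then f x else \<zero>\<^bsub>V\<^esub>)"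
  have f': "f' \<in> carrier ?F" using F_value[OF V f] by (auto simp: f'_def carrier_F[OF V])
  have "f = \<N> H \<odot>\<^bsub>?F\<^esub> f'"
  proof (rule F_eqI[OF V])
    fix x assume x: "x \<in> carrier G"
    let ?y = "x \<bullet> inv\<^bsub>G\<^esub> rep x"
    have y: "?y \<in> H" "rep x \<in> carrier G" "?y \<in> carrier G" using rep[OF x] by auto
    have yx: "inv\<^bsub>G\<^esub> ?y \<bullet> x = rep x"
      using x y by (simp add: G.inv_mult_group G.m_assoc)
    have repy: "rep (rep x) = rep x"
      using rep_eq[of "inv\<^bsub>G\<^esub> ?y" x] y x yx by simp
    have "(\<N> H \<odot>\<^bsub>?F\<^esub> f') x = (\<Oplus>\<^bsub>V\<^esub>y\<in>carrier G. \<N> H y \<odot>\<^bsub>V\<^esub> f' (inv\<^bsub>G\<^esub> y \<bullet> x))"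
      by (rule smult_F[OF V x])
    also have "\<dots> = \<N> H ?y \<odot>\<^bsub>V\<^esub> f' (inv\<^bsub>G\<^esub> ?y \<bullet> x)"
    proof (rule V.M.finsum_single)
      fix z assume z: "z \<in> carrier G" "z \<noteq> ?y"
      show "\<N> H z \<odot>\<^bsub>V\<^esub> f' (inv\<^bsub>G\<^esub> z \<bullet> x) = \<zero>\<^bsub>V\<^esub>"
      proof (cases "z \<in> H")
        case True
        then have "rep (inv\<^bsub>G\<^esub> z \<bullet> x) = rep x" using rep_eq x by simp
        moreover have "inv\<^bsub>G\<^esub> z \<bullet> x \<noteq> rep x"
        proof
          assume "inv\<^bsub>G\<^esub> z \<bullet> x = rep x"
          then have "?y = x \<bullet> inv\<^bsub>G\<^esub> (inv\<^bsub>G\<^esub> z \<bullet> x)" by simp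
          also have "\<dots> = z" using x z by (simp add: G.inv_mult_group G.m_assoc[symmetric])
          finally show False using z by simp
        qed
        ultimately show ?thesis using x z by (simp add: f'_def V.smult_zero_right)
      qed (use z x F_value[OF V f'] in \<open>simp add: subset_sum_def V.smult_zero_left\<close>)
    qed (use finite_G y x F_value[OF V f'] in \<open>auto simp: V.smult_closed\<close>)
    also have "\<dots> = f (rep x)"
      using y repy F_value[OF V f] by (simp add: yx subset_sum_def f'_def V.smult_one)
    also have "\<dots> = f x"
      using inv[of ?y "rep x"] x y by (simp add: G.m_assoc)
    finally show "f x = (\<N> H \<odot>\<^bsub>?F\<^esub> f') x" ..
  qed (use f f' smult_F_closed[OF V] in auto)
  then show ?thesis using f' by blast
qed

section \<open>Norm elements of subgroups\<close>

lemma delta_mult_left: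
  "\<lbrakk>g \<in> carrier G; r \<in> carrier R; x \<in> carrier G\<rbrakk> \<Longrightarrow> (\<delta> g \<star> r) x = r (inv\<^bsub>G\<^esub> g \<bullet> x)"
  by (simp add: monomial_mult_left)

lemma delta_mult_right:
  "\<lbrakk>g \<in> carrier G; r \<in> carrier R; x \<in> carrier G\<rbrakk> \<Longrightarrow> (r \<star> \<delta> g) x = r (x \<bullet> inv\<^bsub>G\<^esub> g)"
  by (simp add: monomial_mult_right)

lemma monomial_zero: "monomial K G \<zero>\<^bsub>K\<^esub> g = \<zero>\<^bsub>R\<^esub>"
  by (auto simp: group_algebra_def monomial_def fun_eq_iff)

lemma central_of_commutes_monomials:
  assumes z: "z \<in> carrier R" and r: "r \<in> carrier R"
    and comm: "\<And>a g. a \<in> carrier K \<Longrightarrow> g \<in> carrier G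
      \<Longrightarrow> monomial K G a g \<star> z = z \<star> monomial K G a g"
  shows "r \<star> z = z \<star> r"
proof -
  have m: "(\<lambda>g. monomial K G (r g) g) \<in> carrier G \<rightarrow> carrier R" using r by auto
  have "r \<star> z = (\<Oplus>\<^bsub>R\<^esub>g\<in>carrier G. monomial K G (r g) g) \<star> z"
    using sum_of_monomials[OF r] by simp
  also have "\<dots> = (\<Oplus>\<^bsub>R\<^esub>g\<in>carrier G. monomial K G (r g) g \<star> z)"
    by (rule R.finsum_ldistr[OF finite_G z m])
  also have "\<dots> = (\<Oplus>\<^bsub>R\<^esub>g\<in>carrier G. z \<star> monomial K G (r g) g)"
    using r z by (intro R.finsum_cong') (auto simp: comm)
  also have "\<dots> = z \<star> (\<Oplus>\<^bsub>R\<^esub>g\<in>carrier G. monomial K G (r g) g)"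
    by (rule R.finsum_rdistr[OF finite_G z m, symmetric])
  finally show ?thesis using sum_of_monomials[OF r] by simp
qed

lemma norm_central:
  assumes H: "H \<lhd> G" and r: "r \<in> carrier R"
  shows "r \<star> \<N> H = \<N> H \<star> r"
proof (rule central_of_commutes_monomials[OF subset_sum_closed r])
  fix a g assume a: "a \<in> carrier K" and g: "g \<in> carrier G"
  show "monomial K G a g \<star> \<N> H = \<N> H \<star> monomial K G a g"
  proof (rule R_eqI)
    fix x assume x: "x \<in> carrier G"
    have "inv\<^bsub>G\<^esub> g \<bullet> x \<in> H \<longleftrightarrow> x \<bullet> inv\<^bsub>G\<^esub> g \<in> H"
      using normal.inv_op_closed1[OF H g, of "x \<bullet> inv\<^bsub>G\<^esub> g"]
        normal.inv_op_closed2[OF H g, of "inv\<^bsub>G\<^esub> g \<bullet> x"] g x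
      by (auto simp: G.m_assoc G.inv_mult_cancel)
    then show "(monomial K G a g \<star> \<N> H) x = (\<N> H \<star> monomial K G a g) x"
      using a g x by (simp add: monomial_mult_left monomial_mult_right) (simp add: subset_sum_def)
  qed (use a in auto)
qed

lemma norm_mult_delta:
  assumes H: "subgroup H G" and h: "h \<in> H"
  shows "\<N> H \<star> \<delta> h = \<N> H"
proof (rule R_eqI)
  interpret H: subgroup H G by fact
  fix x assume x: "x \<in> carrier G"
  have "x \<bullet> inv\<^bsub>G\<^esub> h \<in> H \<longleftrightarrow> x \<in> H"
    using H.m_closed[of "x \<bullet> inv\<^bsub>G\<^esub> h" h] h x by (auto simp: G.m_assoc)
  then show "(\<N> H \<star> \<delta> h) x = \<N> H x"
    using h x by (simp add: delta_mult_right) (simp add: subset_sum_def)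
qed auto

lemma norm_mult_delta_minus_one:
  assumes H: "subgroup H G" and h: "h \<in> H"
  shows "\<N> H \<star> (\<delta> h \<ominus>\<^bsub>R\<^esub> \<one>\<^bsub>R\<^esub>) = \<zero>\<^bsub>R\<^esub>"
  using norm_mult_delta[OF assms] subgroup.mem_carrier[OF assms]
  by (simp add: R.minus_eq R.r_distr R.r_minus R.r_neg)

lemma delta_minus_one_annihilates_iff:
  assumes f: "f \<in> carrier R" and x: "x \<in> carrier G"
  shows "f \<star> (\<delta> x \<ominus>\<^bsub>R\<^esub> \<one>\<^bsub>R\<^esub>) = \<zero>\<^bsub>R\<^esub> \<longleftrightarrow> f \<star> \<delta> x = f"
proof -
  have "f \<star> (\<delta> x \<ominus>\<^bsub>R\<^esub> \<one>\<^bsub>R\<^esub>) = f \<star> \<delta> x \<ominus>\<^bsub>R\<^esub> f"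
    using f x by (simp add: R.minus_eq R.r_distr R.r_minus)
  then show ?thesis using f x by (simp add: R.minus_eq_zero_iff)
qed

lemma right_invariant_imp_norm_multiple:
  assumes H: "H \<lhd> G" and f: "f \<in> carrier R" and inv: "\<And>h. h \<in> H \<Longrightarrow> f \<star> \<delta> h = f"
  shows "f \<in> carrier (principal_left_module R (\<N> H))"
proof -
  have sub: "subgroup H G" using H by (rule normal_imp_subgroup)
  interpret H: subgroup H G by fact
  have right: "f (x \<bullet> h) = f x" if "h \<in> H" "x \<in> carrier G" for h x
    using inv[of "inv\<^bsub>G\<^esub> h"] delta_mult_right[of "inv\<^bsub>G\<^esub> h" f x] that f by simp
  have "f (h \<bullet> x) = f x" if h: "h \<in> H" and x: "x \<in> carrier G" for h x
    using right[OF normal.inv_op_closed1[OF H x h] x] h x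
    by (simp add: G.m_assoc G.inv_mult_cancel)
  then obtain f' where f': "f' \<in> carrier R" "f = \<N> H \<star> f'"
    using invariant_imp_norm_multiple[OF K.left_module_regular sub, of f] f
    by (auto simp: fun_module_regular)
  then show ?thesis
    using norm_central[OF H f'(1)]
    by (auto simp: carrier_principal_left_module intro!: image_eqI[of _ _ f'])
qed

text \<open>
  The norm element of a group grows by the factor \<open>(x - 1)\<^sup>p\<^sup>-\<^sup>1 = 1 + x + \<dots> + x\<^sup>p\<^sup>-\<^sup>1\<close> when the
  powers of \<open>x\<close> are adjoined as coset representatives.
\<close>

lemma norm_extension:
  assumes p: "Factorial_Ring.prime p" and char: "has_characteristic K p" and x: "x \<in> carrier G"
    and ex1: "\<And>s. s \<in> H' \<Longrightarrow> \<exists>!i. i < p \<and> s \<bullet> inv\<^bsub>G\<^esub> (x [^]\<^bsub>G\<^esub> i) \<in> H"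
    and none: "\<And>s i. s \<in> carrier G \<Longrightarrow> i < p \<Longrightarrow> s \<bullet> inv\<^bsub>G\<^esub> (x [^]\<^bsub>G\<^esub> i) \<in> H \<Longrightarrow> s \<in> H'"
  shows "\<N> H \<star> (\<delta> x \<ominus>\<^bsub>R\<^esub> \<one>\<^bsub>R\<^esub>) [^]\<^bsub>R\<^esub> (p - 1) = \<N> H'"
proof -
  have char_R: "[p] \<cdot>\<^bsub>R\<^esub> \<one>\<^bsub>R\<^esub> = \<zero>\<^bsub>R\<^esub>"
  proof -
    have "[n] \<cdot>\<^bsub>R\<^esub> \<one>\<^bsub>R\<^esub> = monomial K G ([n] \<cdot>\<^bsub>K\<^esub> \<one>\<^bsub>K\<^esub>) \<one>\<^bsub>G\<^esub>" for n :: nat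
    proof (induction n)
      case 0
      show ?case by (simp add: monomial_zero)
    next
      case (Suc n)
      then show ?case by (simp add: monomial_add one_R)
    qed
    moreover have "[p] \<cdot>\<^bsub>K\<^esub> \<one>\<^bsub>K\<^esub> = \<zero>\<^bsub>K\<^esub>" using char by (simp add: has_characteristic_def)
    ultimately show ?thesis by (simp add: monomial_zero)
  qed
  have pow: "(\<delta> x \<ominus>\<^bsub>R\<^esub> \<one>\<^bsub>R\<^esub>) [^]\<^bsub>R\<^esub> (p - 1) = (\<Oplus>\<^bsub>R\<^esub>i\<in>{..<p}. \<delta> (x [^]\<^bsub>G\<^esub> i))"
    using R.sum_of_powers_prime_char[OF p char_R, of "\<delta> x"] x by (simp add: delta_pow)
  show ?thesis
  proof (rule R_eqI)
    fix s assume s: "s \<in> carrier G"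
    have "(\<N> H \<star> (\<Oplus>\<^bsub>R\<^esub>i\<in>{..<p}. \<delta> (x [^]\<^bsub>G\<^esub> i))) s
      = (\<Oplus>\<^bsub>K\<^esub>i\<in>{..<p}. \<N> H (s \<bullet> inv\<^bsub>G\<^esub> (x [^]\<^bsub>G\<^esub> i)))"
      using s x
      by (subst R.finsum_rdistr) (auto simp: finsum_R_value Pi_iff delta_mult_right
          intro!: K.finsum_cong' R_value)
    also have "\<dots> = \<N> H' s"
    proof (cases "s \<in> H'")
      case True
      then obtain i where i: "i < p" "s \<bullet> inv\<^bsub>G\<^esub> (x [^]\<^bsub>G\<^esub> i) \<in> H"
        and unique: "\<And>j. j < p \<Longrightarrow> s \<bullet> inv\<^bsub>G\<^esub> (x [^]\<^bsub>G\<^esub> j) \<in> H \<Longrightarrow> j = i"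
        using ex1[OF True] by blast
      have "(\<Oplus>\<^bsub>K\<^esub>i\<in>{..<p}. \<N> H (s \<bullet> inv\<^bsub>G\<^esub> (x [^]\<^bsub>G\<^esub> i))) = \<N> H (s \<bullet> inv\<^bsub>G\<^esub> (x [^]\<^bsub>G\<^esub> i))"
      proof (rule K.finsum_single)
        fix j assume "j \<in> {..<p}" "j \<noteq> i"
        then have "s \<bullet> inv\<^bsub>G\<^esub> (x [^]\<^bsub>G\<^esub> j) \<notin> H" using unique by blast
        then show "\<N> H (s \<bullet> inv\<^bsub>G\<^esub> (x [^]\<^bsub>G\<^esub> j)) = \<zero>\<^bsub>K\<^esub>" using s x by (simp add: subset_sum_def)
      qed (use i s x in auto)
      then show ?thesis using True i s x by (simp add: subset_sum_def)
    next
      case False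
      have "(\<Oplus>\<^bsub>K\<^esub>i\<in>{..<p}. \<N> H (s \<bullet> inv\<^bsub>G\<^esub> (x [^]\<^bsub>G\<^esub> i))) = (\<Oplus>\<^bsub>K\<^esub>i\<in>{..<p}. \<zero>\<^bsub>K\<^esub>)"
        using False none[OF s] s x by (intro K.finsum_cong') (auto simp: subset_sum_def)
      then show ?thesis using False s by (simp add: subset_sum_def)
    qed
    finally show "(\<N> H \<star> (\<delta> x \<ominus>\<^bsub>R\<^esub> \<one>\<^bsub>R\<^esub>) [^]\<^bsub>R\<^esub> (p - 1)) s = \<N> H' s"
      unfolding pow .
  qed (use x in auto)
qed

section \<open>Projective modules have no homology\<close>

text \<open>
  A projective module is a summand of an induced module. There an element fixed by \<open>c\<close> is an
  \<open>H\<close>-invariant function and therefore a multiple of the norm element. The other homology group vanishes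
  because the norm element is a power of \<open>c - 1\<close>.
\<close>

lemma projective_kills_homology:
  fixes J :: "('g \<Rightarrow> 'k, 'u) module"
  assumes inf: "infinite (UNIV :: 'u set)" and J: "projective_module R J"
    and c: "c \<in> carrier G" and H: "subgroup H G" and gen: "\<And>h. h \<in> H \<Longrightarrow> \<exists>i::nat. h = c [^]\<^bsub>G\<^esub> i"
    and N: "\<N> H = (\<delta> c \<ominus>\<^bsub>R\<^esub> \<one>\<^bsub>R\<^esub>) [^]\<^bsub>R\<^esub> (m::nat)"
  shows "kills_homology R \<one>\<^bsub>R\<^esub> (\<delta> c \<ominus>\<^bsub>R\<^esub> \<one>\<^bsub>R\<^esub>) (\<N> H) J \<and>
    kills_homology R \<one>\<^bsub>R\<^esub> (\<N> H) (\<delta> c \<ominus>\<^bsub>R\<^esub> \<one>\<^bsub>R\<^esub>) J"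
proof -
  let ?a = "\<delta> c \<ominus>\<^bsub>R\<^esub> \<one>\<^bsub>R\<^esub>"
  have a: "?a \<in> carrier R" by simp
  have J': "left_module R J" using J by (simp add: projective_module_def)
  define V where "V = scalar_restriction K G J"
  have V: "left_module K V" unfolding V_def by (rule left_module_scalar_restriction[OF J'])
  define E where "E = fun_module K G V"
  have E: "left_module R E" unfolding E_def by (rule left_module_F[OF V])
  interpret E: left_module R E by fact
  obtain q where q: "q \<in> mod_hom R E J" "q ` carrier E = carrier J"
    using induced_module_cover[OF J'] unfolding E_def V_def by blast
  have k1: "kills_homology R \<one>\<^bsub>R\<^esub> ?a (\<N> H) E"
    unfolding kills_homology_def
  proof (intro ballI impI)
    fix f assume f: "f \<in> carrier E" "?a \<odot>\<^bsub>E\<^esub> f = \<zero>\<^bsub>E\<^esub>"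
    then have cf: "\<delta> c \<odot>\<^bsub>E\<^esub> f = f"
      by (simp add: E.smult_diff_left E.smult_one E.smult_closed E.M.minus_eq_zero_iff)
    have step: "f (c \<bullet> x) = f x" if "x \<in> carrier G" for x
      using monomial_smult_F[OF V K.one_closed c, of f "c \<bullet> x"] f(1) c that cf
        F_value[OF V, of f x] left_module.smult_one[OF V]
      by (simp add: E_def G.m_assoc[symmetric])
    have "f (c [^]\<^bsub>G\<^esub> i \<bullet> x) = f x" if "x \<in> carrier G" for x and i :: nat
      using that
    proof (induction i arbitrary: x)
      case (Suc i)
      then show ?case using step[of x] Suc.IH[of "c \<bullet> x"] c by (simp add: G.m_assoc)
    qed simp
    then have "f (h \<bullet> x) = f x" if "h \<in> H" "x \<in> carrier G" for h x
      using gen that by blast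
    then show "\<exists>u\<in>carrier E. \<one>\<^bsub>R\<^esub> \<odot>\<^bsub>E\<^esub> f = \<N> H \<odot>\<^bsub>E\<^esub> u"
      using invariant_imp_norm_multiple[OF V H, of f] f(1) E.smult_one[OF f(1)]
      by (simp add: E_def)
  qed
  then have k2: "kills_homology R \<one>\<^bsub>R\<^esub> (\<N> H) ?a E"
    unfolding N by (rule kills_homology_power_swap[OF E a])
  obtain \<iota> :: "('g \<Rightarrow> 'u) \<Rightarrow> 'u" where "inj_on \<iota> (carrier G \<rightarrow>\<^sub>E UNIV)"
    by (rule finite_power_embedding[OF inf finite_G])
  then have inj: "inj_on \<iota> (carrier E)"
    by (rule inj_on_subset) (auto simp: E_def carrier_F[OF V])
  note copy = image_module_inj[OF E inj]
  let ?q = "q \<circ> inv_into (carrier E) \<iota>"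
  have q': "?q \<in> mod_hom R (image_module \<iota> E) J" by (rule mod_hom_comp[OF copy(3) q(1)])
  have "?q ` carrier (image_module \<iota> E) = carrier J"
    unfolding carrier_image_module image_image using inj q(2) by (simp cong: image_cong_simp)
  note proj = kills_homology_projective[OF R.one_closed _ _ J copy(1) q' this]
  show ?thesis
    using proj[OF a subset_sum_closed] proj[OF subset_sum_closed a]
      kills_homology_copy[OF R.one_closed a subset_sum_closed E inj k1]
      kills_homology_copy[OF R.one_closed subset_sum_closed a E inj k2] by blast
qed

section \<open>Homomorphisms into the group algebra\<close>

text \<open>
  The group algebra is a symmetric algebra with form \<open>r \<mapsto> r 1\<close>: homomorphisms into it are
  determined by this coordinate, because the coordinate of \<open>h w\<close> at \<open>s\<close> is that of \<open>h (s\<^sup>-\<^sup>1 w)\<close> at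
  \<open>1\<close>, and this formula turns any linear functional into a homomorphism.
\<close>

lemma functional_to_hom:
  assumes W: "left_module R W" and l: "l \<in> mod_hom K (scalar_restriction K G W) (regular_module K)"
  obtains h where "h \<in> mod_hom R W (regular_module R)" "\<And>w. w \<in> carrier W \<Longrightarrow> h w \<one>\<^bsub>G\<^esub> = l w"
proof -
  interpret W: left_module R W by fact
  note [simp] = W.smult_closed
  have cl: "l w \<in> carrier K" if "w \<in> carrier W" for w using mod_hom_closed[OF l, of w] that by simp
  have sm: "l (monomial K G a \<one>\<^bsub>G\<^esub> \<odot>\<^bsub>W\<^esub> w) = a \<otimes>\<^bsub>K\<^esub> l w" if "w \<in> carrier W" "a \<in> carrier K" for a w
    using mod_hom_smult[OF l, of a w] that by simp
  define h where "h = (\<lambda>w. \<lambda>s\<in>carrier G. l (\<delta> (inv\<^bsub>G\<^esub> s) \<odot>\<^bsub>W\<^esub> w))"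
  have hR: "h w \<in> carrier R" if "w \<in> carrier W" for w
  proof -
    have "l (\<delta> s \<odot>\<^bsub>W\<^esub> w) \<in> carrier K" for s using that cl by simp
    then show ?thesis by (auto simp: h_def carrier_R)
  qed
  have "h \<in> mod_hom R W (regular_module R)"
  proof (rule mod_homI_monomial[OF W R.left_module_regular])
    show "h (v \<oplus>\<^bsub>W\<^esub> w) = h v \<oplus>\<^bsub>regular_module R\<^esub> h w" if vw: "v \<in> carrier W" "w \<in> carrier W" for v w
    proof -
      have "h (v \<oplus>\<^bsub>W\<^esub> w) s = h v s \<oplus>\<^bsub>K\<^esub> h w s" if s: "s \<in> carrier G" for s
        using s vw mod_hom_add[OF l, of "\<delta> (inv\<^bsub>G\<^esub> s) \<odot>\<^bsub>W\<^esub> v" "\<delta> (inv\<^bsub>G\<^esub> s) \<odot>\<^bsub>W\<^esub> w"]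
        by (simp add: h_def W.smult_r_distr)
      then show ?thesis using vw hR by (intro R_eqI) (auto simp: add_R)
    qed
    show "h (monomial K G a g \<odot>\<^bsub>W\<^esub> w) = monomial K G a g \<odot>\<^bsub>regular_module R\<^esub> h w"
      if agw: "a \<in> carrier K" "g \<in> carrier G" "w \<in> carrier W" for a g w
    proof -
      have "h (monomial K G a g \<odot>\<^bsub>W\<^esub> w) s = (monomial K G a g \<star> h w) s" if s: "s \<in> carrier G" for s
      proof -
        have "\<delta> (inv\<^bsub>G\<^esub> s) \<odot>\<^bsub>W\<^esub> (monomial K G a g \<odot>\<^bsub>W\<^esub> w)
          = monomial K G a \<one>\<^bsub>G\<^esub> \<odot>\<^bsub>W\<^esub> (\<delta> (inv\<^bsub>G\<^esub> (inv\<^bsub>G\<^esub> g \<bullet> s)) \<odot>\<^bsub>W\<^esub> w)"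
          using s agw by (simp add: W.smult_assoc[symmetric] monomial_mult G.inv_mult_group)
        then show ?thesis
          using s agw hR by (simp add: monomial_mult_left) (simp add: h_def sm)
      qed
      then show ?thesis using agw hR by (intro R_eqI) auto
    qed
  qed (use hR in simp)
  moreover have "h w \<one>\<^bsub>G\<^esub> = l w" if "w \<in> carrier W" for w
    using that by (simp add: h_def one_R[symmetric] W.smult_one)
  ultimately show ?thesis using that by blast
qed

lemma hom_to_regular_eqI:
  assumes h: "h \<in> mod_hom R W (regular_module R)" and h': "h' \<in> mod_hom R W (regular_module R)"
    and W: "left_module R W"
    and eq: "\<And>w. w \<in> carrier W \<Longrightarrow> h w \<one>\<^bsub>G\<^esub> = h' w \<one>\<^bsub>G\<^esub>" and w: "w \<in> carrier W"
  shows "h w = h' w"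
proof (rule R_eqI)
  interpret W: left_module R W by fact
  show hw: "h w \<in> carrier R" "h' w \<in> carrier R"
    using mod_hom_closed[OF h w] mod_hom_closed[OF h' w] by simp_all
  fix s assume s: "s \<in> carrier G"
  have "h (\<delta> (inv\<^bsub>G\<^esub> s) \<odot>\<^bsub>W\<^esub> w) \<one>\<^bsub>G\<^esub> = h w s"
    using s w hw mod_hom_smult[OF h, of "\<delta> (inv\<^bsub>G\<^esub> s)" w] by (simp add: delta_mult_left)
  moreover have "h' (\<delta> (inv\<^bsub>G\<^esub> s) \<odot>\<^bsub>W\<^esub> w) \<one>\<^bsub>G\<^esub> = h' w s"
    using s w hw mod_hom_smult[OF h', of "\<delta> (inv\<^bsub>G\<^esub> s)" w] by (simp add: delta_mult_left)
  ultimately show "h w s = h' w s"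
    using eq[of "\<delta> (inv\<^bsub>G\<^esub> s) \<odot>\<^bsub>W\<^esub> w"] s w by (simp add: W.smult_closed)
qed

lemma delta_minus_one_trace:
  assumes g: "g \<in> carrier G" and r: "r \<in> carrier R"
  shows "((\<delta> g \<ominus>\<^bsub>R\<^esub> \<one>\<^bsub>R\<^esub>) \<star> r) \<one>\<^bsub>G\<^esub> = (r \<star> (\<delta> g \<ominus>\<^bsub>R\<^esub> \<one>\<^bsub>R\<^esub>)) \<one>\<^bsub>G\<^esub>"
proof -
  have "(\<delta> g \<ominus>\<^bsub>R\<^esub> \<one>\<^bsub>R\<^esub>) \<star> r = \<delta> g \<star> r \<oplus>\<^bsub>R\<^esub> \<ominus>\<^bsub>R\<^esub> r"
    "r \<star> (\<delta> g \<ominus>\<^bsub>R\<^esub> \<one>\<^bsub>R\<^esub>) = r \<star> \<delta> g \<oplus>\<^bsub>R\<^esub> \<ominus>\<^bsub>R\<^esub> r"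
    using g r by (simp_all add: R.minus_eq R.l_distr R.r_distr R.l_minus R.r_minus)
  then show ?thesis using g r by (simp add: add_R delta_mult_left delta_mult_right)
qed

end

section \<open>Central series of a group of prime power order\<close>

context group
begin

lemma card_orbit_dvd:
  assumes "group_action G E \<phi>" "x \<in> E"
  shows "card (orbit G \<phi> x) dvd order G"
  using group_action.orbit_stabilizer_theorem[OF assms] by (metis dvd_triv_left)

text \<open>
  The orbits of \<open>G\<close> acting on itself by conjugation have sizes that are powers of \<open>p\<close>, with sum divisible
  by \<open>p\<close>. As \<open>{1}\<close> is one of them, another has a single element, and a suitable power of that element
  has order \<open>p\<close>.
\<close>

lemma central_element_exists:
  assumes p: "Factorial_Ring.prime (p::nat)" and ord: "order G = p ^ n" and n: "n > 0"
  obtains z where "z \<in> carrier G" "z \<noteq> \<one>" "z [^] p = \<one>"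
    "\<And>g. g \<in> carrier G \<Longrightarrow> g \<otimes> z = z \<otimes> g"
proof -
  have fin: "finite (carrier G)"
    using ord p by (metis order_gt_0_iff_finite prime_gt_0_nat zero_less_power)
  let ?\<phi> = "\<lambda>g. \<lambda>h\<in>carrier G. g \<otimes> h \<otimes> inv g"
  interpret act: group_action G "carrier G" ?\<phi> by (rule action_by_conjugation)
  have "\<exists>z\<in>carrier G. z \<noteq> \<one> \<and> (\<forall>g\<in>carrier G. g \<otimes> z = z \<otimes> g)"
  proof (rule ccontr)
    assume no: "\<not> ?thesis"
    have fixed: "x = \<one>" if x: "x \<in> carrier G" "orbit G ?\<phi> x = {x}" for x
    proof -
      have "g \<otimes> x = x \<otimes> g" if g: "g \<in> carrier G" for g
      proof -
        have "g \<otimes> x \<otimes> inv g \<in> orbit G ?\<phi> x" using g x(1) by (auto simp: orbit_def)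
        then show ?thesis using x g by (metis inv_closed inv_solve_right m_closed singletonD)
      qed
      then show ?thesis using no x(1) by blast
    qed
    have one: "orbit G ?\<phi> \<one> = {\<one>}"
      by (auto simp: orbit_def intro!: exI[of _ \<one>])
    have p_dvd: "p dvd card orb" if orb: "orb \<in> orbits G (carrier G) ?\<phi>" "orb \<noteq> {\<one>}" for orb
    proof -
      obtain x where x: "x \<in> carrier G" "orb = orbit G ?\<phi> x" using orb(1) by (auto simp: orbits_def)
      have "x \<in> orb" using x act.orbit_refl by simp
      have "card orb \<noteq> 1"
      proof
        assume "card orb = 1"
        then have "orb = {x}" using \<open>x \<in> orb\<close> by (metis card_1_singletonE singletonD)
        then show False using fixed x orb(2) by simp
      qed
      moreover have "card orb dvd p ^ n"
        using card_orbit_dvd[OF act.group_action_axioms x(1)] x(2) ord by simp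
      then obtain i where "card orb = p ^ i" using divides_primepow_nat[OF p] by blast
      ultimately show ?thesis by (cases i) auto
    qed
    have finorb: "finite (orbits G (carrier G) ?\<phi>)"
      using fin by (simp add: orbits_def Setcompr_eq_image)
    have "order G = (\<Sum>orb\<in>orbits G (carrier G) ?\<phi>. card orb)"
      using act.disjoint_sum[OF fin, of "\<lambda>_. 1 :: nat"] by (simp add: order_def)
    also have "\<dots> = card {\<one>} + (\<Sum>orb\<in>orbits G (carrier G) ?\<phi> - {{\<one>}}. card orb)"
      using one by (intro sum.remove[OF finorb]) (force simp: orbits_def)
    finally have sum: "order G = card {\<one>} + (\<Sum>orb\<in>orbits G (carrier G) ?\<phi> - {{\<one>}}. card orb)" .
    have "p dvd (\<Sum>orb\<in>orbits G (carrier G) ?\<phi> - {{\<one>}}. card orb)"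
      using p_dvd by (intro dvd_sum) auto
    moreover have "p dvd order G" using ord n by (simp add: dvd_power)
    ultimately have "p dvd card {\<one>}" by (simp only: sum dvd_add_left_iff)
    then show False using p by auto
  qed
  then obtain z where z: "z \<in> carrier G" "z \<noteq> \<one>" "\<And>g. g \<in> carrier G \<Longrightarrow> g \<otimes> z = z \<otimes> g" by blast
  have "z [^] (p ^ n) = \<one>" using pow_order_eq_1[OF z(1)] ord by simp
  define k where "k = (LEAST k. z [^] (p ^ k) = \<one>)"
  have k: "z [^] (p ^ k) = \<one>" unfolding k_def by (rule LeastI) fact
  have "k \<noteq> 0" using k z by (intro notI) simp
  then obtain l where l: "k = Suc l" by (cases k) auto
  have "z [^] (p ^ l) \<noteq> \<one>" using not_less_Least[of l "\<lambda>k. z [^] (p ^ k) = \<one>"] l k_def by auto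
  moreover have "(z [^] (p ^ l)) [^] p = \<one>" using k z(1) by (simp add: l nat_pow_pow mult.commute)
  moreover have "g \<otimes> z [^] m = z [^] m \<otimes> g" if "g \<in> carrier G" for g and m :: nat
    using group_commutes_pow[of z g m] z that by simp
  ultimately show ?thesis using that z(1) nat_pow_closed by blast
qed

end

text \<open>
  \<open>H'\<close> is the disjoint union of the cosets \<open>Hx\<^sup>i\<close> for \<open>i < p\<close>, and \<open>x\<close> is central modulo \<open>H\<close>.
\<close>

definition adjoins_central ::
  "('g, 'd) monoid_scheme \<Rightarrow> nat \<Rightarrow> 'g \<Rightarrow> 'g set \<Rightarrow> 'g set \<Rightarrow> bool" where
  "adjoins_central G p x H H' \<longleftrightarrow> x \<in> carrier G \<and>
     (\<forall>g\<in>carrier G. g \<otimes>\<^bsub>G\<^esub> x \<otimes>\<^bsub>G\<^esub> inv\<^bsub>G\<^esub> (x \<otimes>\<^bsub>G\<^esub> g) \<in> H) \<and>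
     (\<forall>s\<in>H'. \<exists>!i. i < p \<and> s \<otimes>\<^bsub>G\<^esub> inv\<^bsub>G\<^esub> (x [^]\<^bsub>G\<^esub> i) \<in> H) \<and>
     (\<forall>s\<in>carrier G. \<forall>i<p. s \<otimes>\<^bsub>G\<^esub> inv\<^bsub>G\<^esub> (x [^]\<^bsub>G\<^esub> i) \<in> H \<longrightarrow> s \<in> H')"

context group
begin

text \<open>
  A central element of order \<open>p\<close> in \<open>G/H\<close> generates a normal subgroup, and \<open>H'\<close> is its preimage.
\<close>

lemma central_extension_exists:
  assumes p: "Factorial_Ring.prime p" and ord: "order G = p ^ r" and H: "H \<lhd> G"
    and card: "card H = p ^ j" and j: "j < r"
  shows "\<exists>H'. H' \<lhd> G \<and> card H' = p ^ Suc j \<and> (\<exists>x. adjoins_central G p x H H')"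
proof -
  interpret H: normal H G by fact
  interpret Q: group "G Mod H" by (rule H.factorgroup_is_group)
  note [simp del] = one_FactGroup mult_FactGroup
  have fin: "finite (carrier G)"
    using ord p by (metis order_gt_0_iff_finite prime_gt_0_nat zero_less_power)
  let ?\<pi> = "\<lambda>g. H #> g"
  have \<pi>: "?\<pi> g \<in> carrier (G Mod H)" if "g \<in> carrier G" for g
    using that by (auto simp: FactGroup_def RCOSETS_def)
  have \<pi>_mult: "?\<pi> g \<otimes>\<^bsub>G Mod H\<^esub> ?\<pi> h = ?\<pi> (g \<otimes> h)" if "g \<in> carrier G" "h \<in> carrier G" for g h
    using that H.rcos_sum by (simp add: FactGroup_def)
  have \<pi>_pow: "?\<pi> g [^]\<^bsub>G Mod H\<^esub> (n::nat) = ?\<pi> (g [^] n)" if "g \<in> carrier G" for g n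
    using that by (rule H.FactGroup_pow)
  have \<pi>_eq: "?\<pi> g = ?\<pi> h \<longleftrightarrow> g \<otimes> inv h \<in> H" if gh: "g \<in> carrier G" "h \<in> carrier G" for g h
  proof -
    have "?\<pi> g = ?\<pi> h \<longleftrightarrow> g \<in> H #> h"
      using rcos_self[OF gh(1) H.is_subgroup] repr_independence[OF _ gh(2) H.is_subgroup, of g]
      by auto
    then show ?thesis using H.rcos_module[OF group_axioms gh(2,1)] by simp
  qed
  have \<pi>_one: "\<one>\<^bsub>G Mod H\<^esub> = ?\<pi> \<one>" using H.subset by (simp add: FactGroup_def)
  have "order (G Mod H) * p ^ j = p ^ (r - j) * p ^ j"
    using lagrange[OF H.is_subgroup] ord card j
    by (simp add: order_def FactGroup_def mult.commute power_add[symmetric])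
  then have "order (G Mod H) = p ^ (r - j)" using p by simp
  then obtain z where z: "z \<in> carrier (G Mod H)" "z \<noteq> \<one>\<^bsub>G Mod H\<^esub>" "z [^]\<^bsub>G Mod H\<^esub> p = \<one>\<^bsub>G Mod H\<^esub>"
      "\<And>g. g \<in> carrier (G Mod H) \<Longrightarrow> g \<otimes>\<^bsub>G Mod H\<^esub> z = z \<otimes>\<^bsub>G Mod H\<^esub> g"
    using Q.central_element_exists[OF p] j by (metis zero_less_diff)
  obtain x where x: "x \<in> carrier G" "z = ?\<pi> x"
    using z(1) by (auto simp: FactGroup_def RCOSETS_def)
  have ordz: "Q.ord z = p"
    using z p Q.pow_eq_id[OF z(1), of p] Q.ord_eq_1[OF z(1)] by (metis prime_nat_iff)
  define H' where "H' = {s \<in> carrier G. \<exists>i::nat. ?\<pi> s = z [^]\<^bsub>G Mod H\<^esub> i}"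
  have power: "?\<pi> s = z [^]\<^bsub>G Mod H\<^esub> i \<longleftrightarrow> s \<otimes> inv (x [^] i) \<in> H" if "s \<in> carrier G" for s and i :: nat
    using that x by (simp add: \<pi>_pow \<pi>_eq)
  have zmod: "z [^]\<^bsub>G Mod H\<^esub> i = z [^]\<^bsub>G Mod H\<^esub> (i mod p)" for i :: nat
  proof -
    have "z [^]\<^bsub>G Mod H\<^esub> i = z [^]\<^bsub>G Mod H\<^esub> (p * (i div p)) \<otimes>\<^bsub>G Mod H\<^esub> z [^]\<^bsub>G Mod H\<^esub> (i mod p)"
      using z(1) by (subst Q.nat_pow_mult) simp_all
    then show ?thesis using z by (simp add: Q.nat_pow_pow[symmetric])
  qed
  have ex1: "\<exists>!i. i < p \<and> s \<otimes> inv (x [^] i) \<in> H" if s: "s \<in> H'" for s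
  proof -
    have sG: "s \<in> carrier G" using s by (simp add: H'_def)
    obtain i :: nat where i: "?\<pi> s = z [^]\<^bsub>G Mod H\<^esub> i" using s by (auto simp: H'_def)
    have "i mod p < p" using p by (simp add: prime_gt_0_nat)
    moreover have "k = i mod p" if "k < p" "?\<pi> s = z [^]\<^bsub>G Mod H\<^esub> k" for k
    proof (rule inj_onD[OF Q.ord_inj[OF z(1)]])
      show "z [^]\<^bsub>G Mod H\<^esub> k = z [^]\<^bsub>G Mod H\<^esub> (i mod p)" using that i zmod[of i] by simp
      have "i mod p \<le> p - 1" using \<open>i mod p < p\<close> by linarith
      then show "i mod p \<in> {0..Q.ord z - 1}" by (simp add: ordz)
      show "k \<in> {0..Q.ord z - 1}" using that(1) by (simp add: ordz)
    qed
    ultimately show ?thesis using i zmod[of i] power[OF sG] by metis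
  qed
  have adj: "adjoins_central G p x H H'"
    unfolding adjoins_central_def
  proof (intro conjI ballI allI impI ex1 x(1))
    fix g assume g: "g \<in> carrier G"
    have "?\<pi> (g \<otimes> x) = ?\<pi> (x \<otimes> g)" using z(4)[OF \<pi>[OF g]] g x by (simp add: \<pi>_mult)
    then show "g \<otimes> x \<otimes> inv (x \<otimes> g) \<in> H" using g x by (simp add: \<pi>_eq)
  next
    fix s i assume "s \<in> carrier G" "s \<otimes> inv (x [^] (i::nat)) \<in> H"
    then show "s \<in> H'" using power unfolding H'_def by blast
  qed
  have conj: "?\<pi> (g \<otimes> s \<otimes> inv g) = ?\<pi> s" if g: "g \<in> carrier G" and s: "s \<in> H'" for g s
  proof -
    have sG: "s \<in> carrier G" using s by (simp add: H'_def)
    obtain i :: nat where i: "?\<pi> s = z [^]\<^bsub>G Mod H\<^esub> i" using s by (auto simp: H'_def)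
    have "?\<pi> g \<otimes>\<^bsub>G Mod H\<^esub> ?\<pi> s = ?\<pi> s \<otimes>\<^bsub>G Mod H\<^esub> ?\<pi> g"
      using Q.group_commutes_pow[of z "?\<pi> g" i] z \<pi>[OF g] by (simp add: i)
    then have "?\<pi> (g \<otimes> s) \<otimes>\<^bsub>G Mod H\<^esub> ?\<pi> (inv g) = ?\<pi> (s \<otimes> g) \<otimes>\<^bsub>G Mod H\<^esub> ?\<pi> (inv g)"
      using g sG by (simp add: \<pi>_mult)
    then show ?thesis using g sG by (simp add: \<pi>_mult m_assoc)
  qed
  have sub: "subgroup H' G"
  proof (rule subgroupI)
    show "H' \<subseteq> carrier G" by (auto simp: H'_def)
    have "?\<pi> \<one> = z [^]\<^bsub>G Mod H\<^esub> (0::nat)" using \<pi>_one by simp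
    then have "\<one> \<in> H'" unfolding H'_def by blast
    then show "H' \<noteq> {}" by blast
  next
    fix s t assume "s \<in> H'" "t \<in> H'"
    then obtain i k :: nat where st: "s \<in> carrier G" "t \<in> carrier G"
      "?\<pi> s = z [^]\<^bsub>G Mod H\<^esub> i" "?\<pi> t = z [^]\<^bsub>G Mod H\<^esub> k" by (auto simp: H'_def)
    have "?\<pi> (s \<otimes> t) = z [^]\<^bsub>G Mod H\<^esub> (i + k)"
      using \<pi>_mult[OF st(1,2)] st(3,4) Q.nat_pow_mult[OF z(1), of i k] by simp
    then show "s \<otimes> t \<in> H'" using st(1,2) unfolding H'_def by blast
  next
    fix s assume "s \<in> H'"
    then obtain i :: nat where s: "s \<in> carrier G" "?\<pi> s = z [^]\<^bsub>G Mod H\<^esub> i" by (auto simp: H'_def)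
    have "?\<pi> (inv s) \<otimes>\<^bsub>G Mod H\<^esub> ?\<pi> s = \<one>\<^bsub>G Mod H\<^esub>"
      using \<pi>_mult[of "inv s" s] s(1) by (simp add: \<pi>_one)
    moreover have "z [^]\<^bsub>G Mod H\<^esub> ((p - 1) * i) \<otimes>\<^bsub>G Mod H\<^esub> ?\<pi> s = \<one>\<^bsub>G Mod H\<^esub>"
    proof -
      have "(p - 1) * i + i = p * i" using p by (cases p) auto
      then have "z [^]\<^bsub>G Mod H\<^esub> ((p - 1) * i) \<otimes>\<^bsub>G Mod H\<^esub> ?\<pi> s = z [^]\<^bsub>G Mod H\<^esub> (p * i)"
        using z(1) s(2) by (simp add: Q.nat_pow_mult)
      then show ?thesis using z by (simp add: Q.nat_pow_pow[symmetric])
    qed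
    ultimately have "?\<pi> (inv s) = z [^]\<^bsub>G Mod H\<^esub> ((p - 1) * i)"
      using Q.inv_equality[of _ "?\<pi> s"] s(1) z(1) \<pi> by (metis Q.nat_pow_closed inv_closed)
    then show "inv s \<in> H'" using s(1) by (auto simp: H'_def)
  qed
  have "H' \<lhd> G"
    unfolding normal_inv_iff using sub conj by (auto simp: H'_def)
  moreover have "card H' = card (H \<times> {..<p})"
  proof (rule bij_betw_same_card[symmetric])
    show "bij_betw (\<lambda>(h, i). h \<otimes> x [^] i) (H \<times> {..<p}) H'"
      unfolding bij_betw_def
    proof
      have mem: "h \<otimes> x [^] i \<in> H' \<and> h \<otimes> x [^] i \<otimes> inv (x [^] i) = h" if "h \<in> H" "i < p" for h i
      proof -
        have eq: "h \<otimes> x [^] i \<otimes> inv (x [^] i) = h" using that x(1) by (simp add: m_assoc)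
        then have "h \<otimes> x [^] i \<in> H'"
          using adj that x(1) unfolding adjoins_central_def by (metis H.mem_carrier m_closed nat_pow_closed)
        then show ?thesis using eq by blast
      qed
      show "inj_on (\<lambda>(h, i). h \<otimes> x [^] i) (H \<times> {..<p})"
      proof (rule inj_onI, clarify)
        fix h i h' i' assume hi: "h \<in> H" "i < p" "h' \<in> H" "i' < p" "h \<otimes> x [^] i = h' \<otimes> x [^] i'"
        then have "i = i'" using ex1[of "h \<otimes> x [^] i"] mem[of h i] mem[of h' i'] by metis
        then show "h = h' \<and> i = i'" using hi mem by metis
      qed
      show "(\<lambda>(h, i). h \<otimes> x [^] i) ` (H \<times> {..<p}) = H'"
      proof (intro equalityI subsetI)
        fix s assume s: "s \<in> H'"
        then obtain i where i: "i < p" "s \<otimes> inv (x [^] i) \<in> H" using ex1 by blast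
        have "s = s \<otimes> inv (x [^] i) \<otimes> x [^] i" using s x(1) by (simp add: H'_def m_assoc)
        then show "s \<in> (\<lambda>(h, i). h \<otimes> x [^] i) ` (H \<times> {..<p})" using i by force
      qed (use mem in auto)
    qed
  qed
  then have "card H' = p ^ Suc j" using card by (simp add: card_cartesian_product)
  ultimately show ?thesis using adj by blast
qed

lemma central_series_exists:
  assumes p: "Factorial_Ring.prime p" and ord: "order G = p ^ r"
  obtains H x where "H 0 = {\<one>}" "\<And>j. j \<le> r \<Longrightarrow> H j \<lhd> G" "H r = carrier G"
    "\<And>j. j < r \<Longrightarrow> adjoins_central G p (x j) (H j) (H (Suc j))"
proof -
  have "\<exists>H. \<forall>j. ((j \<le> r \<longrightarrow> H j \<lhd> G \<and> card (H j) = p ^ j) \<and> (j = 0 \<longrightarrow> H j = {\<one>})) \<and>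
      (j < r \<longrightarrow> (\<exists>x. adjoins_central G p x (H j) (H (Suc j))))"
  proof (rule dependent_nat_choice)
    show "\<exists>H. (0 \<le> r \<longrightarrow> H \<lhd> G \<and> card H = p ^ 0) \<and> (0 = (0::nat) \<longrightarrow> H = {\<one>})"
      using one_is_normal by auto
    fix H and j :: nat
    assume "(j \<le> r \<longrightarrow> H \<lhd> G \<and> card H = p ^ j) \<and> (j = 0 \<longrightarrow> H = {\<one>})"
    then show "\<exists>H'. ((Suc j \<le> r \<longrightarrow> H' \<lhd> G \<and> card H' = p ^ Suc j) \<and> (Suc j = 0 \<longrightarrow> H' = {\<one>})) \<and>
        (j < r \<longrightarrow> (\<exists>x. adjoins_central G p x H H'))"
      using central_extension_exists[OF p ord, of H j] by (cases "j < r") auto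
  qed
  then obtain H where H: "\<And>j. j \<le> r \<Longrightarrow> H j \<lhd> G \<and> card (H j) = p ^ j" "H 0 = {\<one>}"
    "\<And>j. j < r \<Longrightarrow> \<exists>x. adjoins_central G p x (H j) (H (Suc j))" by blast
  have "finite (carrier G)"
    using ord p by (metis order_gt_0_iff_finite prime_gt_0_nat zero_less_power)
  moreover have "H r \<subseteq> carrier G" using H(1)[of r] normal_imp_subgroup subgroup.subset by blast
  ultimately have "H r = carrier G"
    using H(1)[of r] ord by (intro card_subset_eq) (auto simp: order_def)
  moreover obtain x where "\<And>j. j < r \<Longrightarrow> adjoins_central G p (x j) (H j) (H (Suc j))"
    using H(3) by metis
  ultimately show ?thesis using that H by blast
qed

end

section \<open>Ghosts on a module with trivial action of a central subgroup\<close>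

context finite_group_algebra
begin

abbreviation norm_module :: "(('g \<Rightarrow> 'k) \<Rightarrow> 'u) \<Rightarrow> 'g set \<Rightarrow> ('g \<Rightarrow> 'k, 'u) module" where
  "norm_module \<iota> H \<equiv> image_module \<iota> (principal_left_module R (\<N> H))"

lemma trivial_module_acted_trivially:
  assumes T: "T \<in> trivial_modules K G" and y: "y \<in> carrier G" and t: "t \<in> carrier T"
  shows "(\<delta> y \<ominus>\<^bsub>R\<^esub> \<one>\<^bsub>R\<^esub>) \<odot>\<^bsub>T\<^esub> t = \<zero>\<^bsub>T\<^esub>"
proof -
  obtain f where T': "left_module R T" and f: "f \<in> mod_hom R (trivial_module K G) T"
    and bij: "bij_betw f (carrier (trivial_module K G)) (carrier T)"
    using T by (auto simp: trivial_modules_def)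
  interpret T: left_module R T by fact
  obtain k where k: "k \<in> carrier K" "t = f k"
    using bij t by (auto simp: bij_betw_def trivial_module_def)
  have "(\<Oplus>\<^bsub>K\<^esub>g\<in>carrier G. \<delta> y g) = \<delta> y y"
    using y finite_G by (intro K.finsum_single) (auto simp: monomial_def)
  then have "\<delta> y \<odot>\<^bsub>trivial_module K G\<^esub> k = k"
    using y k by (simp add: trivial_module_def) (simp add: monomial_def)
  then have "\<delta> y \<odot>\<^bsub>T\<^esub> t = t"
    using mod_hom_smult[OF f, of "\<delta> y" k] k by (simp add: trivial_module_def)
  then show ?thesis using t by (simp add: T.smult_diff_left T.smult_one T.M.minus_eq_zero_iff)
qed

text \<open>
  Let \<open>W\<close> be an \<open>\<Omega>\<^sup>nk\<close>. By Frobenius reciprocity a homomorphism \<open>g\<close> from \<open>W\<close> to \<open>R \<N> H\<close> is the same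
  as a functional on \<open>W\<close> that is zero on the image of \<open>a = c - 1\<close>, namely the coordinate of \<open>g\<close> at \<open>1\<close>.
  As \<open>c\<close> is central, \<open>y - 1\<close> is zero on the homology of \<open>W\<close> and maps the kernel of \<open>\<N> H\<close> into the image
  of \<open>a\<close>. So the functional of \<open>g\<close> followed by \<open>y - 1\<close> is zero on the kernel of \<open>\<N> H\<close>, and it has the
  form \<open>w \<mapsto> l (\<N> H w)\<close>. The homomorphism from \<open>W\<close> to \<open>R\<close> given by \<open>l\<close>, followed by multiplication by
  \<open>\<N> H\<close>, is then a factorization through the regular module.
\<close>

lemma norm_module_ghost:
  fixes \<iota> :: "('g \<Rightarrow> 'k) \<Rightarrow> 'u"
  assumes inf: "infinite (UNIV :: 'u set)" and inj: "inj_on \<iota> (carrier R)"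
    and c: "c \<in> carrier G" and central: "\<And>g. g \<in> carrier G \<Longrightarrow> g \<bullet> c = c \<bullet> g"
    and H: "H \<lhd> G" and cH: "c \<in> H" and gen: "\<And>h. h \<in> H \<Longrightarrow> \<exists>i::nat. h = c [^]\<^bsub>G\<^esub> i"
    and N: "\<N> H = (\<delta> c \<ominus>\<^bsub>R\<^esub> \<one>\<^bsub>R\<^esub>) [^]\<^bsub>R\<^esub> (m::nat)" and y: "y \<in> carrier G"
  shows "ghost K G (norm_module \<iota> H) (norm_module \<iota> H)
    (copy_map \<iota> (principal_left_module R (\<N> H)) (\<lambda>x. x \<star> (\<delta> y \<ominus>\<^bsub>R\<^esub> \<one>\<^bsub>R\<^esub>)))"
    (is "ghost K G ?M ?M ?f")
proof -
  let ?L = "principal_left_module R (\<N> H)"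
  define a where "a = \<delta> c \<ominus>\<^bsub>R\<^esub> \<one>\<^bsub>R\<^esub>"
  define d where "d = \<delta> y \<ominus>\<^bsub>R\<^esub> \<one>\<^bsub>R\<^esub>"
  have a: "a \<in> carrier R" and d: "d \<in> carrier R" by (simp_all add: a_def d_def)
  have sub: "subgroup H G" using H by (rule normal_imp_subgroup)
  have Na: "\<N> H \<star> a = \<zero>\<^bsub>R\<^esub>" unfolding a_def by (rule norm_mult_delta_minus_one[OF sub cH])
  then have aN: "a \<star> \<N> H = \<zero>\<^bsub>R\<^esub>" using norm_central[OF H a] by simp
  have dN: "d \<star> \<N> H = \<N> H \<star> d" by (rule norm_central[OF H d])
  have "\<delta> y \<star> \<delta> c = \<delta> c \<star> \<delta> y" using y c central[OF y] by (simp add: monomial_mult)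
  then have da: "d \<star> a = a \<star> d"
    using y c by (simp add: a_def d_def R.minus_eq R.l_distr R.r_distr R.l_minus R.r_minus R.minus_add
        R.a_ac)
  have L: "left_module R ?L" by (rule R.left_module_principal) simp
  have LR: "carrier ?L \<subseteq> carrier R" by (rule R.principal_left_module_subset) simp
  have inj': "inj_on \<iota> (carrier ?L)" using inj LR by (rule inj_on_subset)
  note copy = image_module_inj[OF L inj']
  have reg: "left_module R (regular_module R)" "inj_on \<iota> (carrier (regular_module R))"
    using inj by (simp_all add: R.left_module_regular)
  have aL: "a \<star> x = \<zero>\<^bsub>R\<^esub>" if x: "x \<in> carrier ?L" for x
  proof -
    obtain r where r: "r \<in> carrier R" "x = r \<star> \<N> H"
      using x by (auto simp: carrier_principal_left_module)
    then have "a \<star> x = (a \<star> \<N> H) \<star> r"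
      using a norm_central[OF H r(1)] by (simp add: R.m_assoc)
    then show ?thesis using aN r(1) by simp
  qed
  have "\<N> H \<star> d \<in> carrier ?L"
    unfolding dN[symmetric] using d by (auto simp: carrier_principal_left_module)
  then have f: "?f \<in> mod_hom R ?M ?M"
    unfolding d_def by (intro copy_map_hom L inj' R.right_mult_hom) auto
  have "stably_zero R W ?M (?f \<circ> g)"
    if T: "T \<in> trivial_modules K G" and WT: "Omega_power R n T W" and g: "g \<in> mod_hom R W ?M"
    for n :: int and T W g
  proof -
    have T': "left_module R T" using T by (auto simp: trivial_modules_def)
    have W: "left_module R W" by (rule Omega_power_left_module[OF T' WT])
    interpret T: left_module R T by fact
    interpret W: left_module R W by fact
    note [simp] = W.smult_closed
    have "d \<odot>\<^bsub>T\<^esub> t = \<zero>\<^bsub>T\<^esub>" if "t \<in> carrier T" for t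
      unfolding d_def by (rule trivial_module_acted_trivially[OF T y that])
    then have "kills_homology R d a (\<N> H) T \<and> kills_homology R d (\<N> H) a T"
      unfolding kills_homology_def using a
      by (auto intro!: bexI[of _ "\<zero>\<^bsub>T\<^esub>"] simp: T.smult_zero_right)
    then have "kills_homology R d (\<N> H) a W"
      using kills_homology_Omega_power[OF a subset_sum_closed d aN Na da dN _ _ WT]
        projective_kills_homology[OF inf _ c sub gen N] unfolding a_def by blast
    note W0 = kills_homologyD[OF this]
    define g' where "g' = inv_into (carrier ?L) \<iota> \<circ> g"
    have g'L: "g' \<in> mod_hom R W ?L" unfolding g'_def by (rule mod_hom_comp[OF g copy(3)])
    have g': "g' \<in> mod_hom R W (regular_module R)"
      using g'L LR by (auto simp: mod_hom_def)
    have g'R: "g' w \<in> carrier R" if "w \<in> carrier W" for w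
      using mod_hom_closed[OF g' that] by simp
    have \<iota>g': "\<iota> (g' w) = g w" if "w \<in> carrier W" for w
      using mod_hom_closed[OF g that] unfolding g'_def by (simp add: carrier_image_module f_inv_into_f)
    let ?V = "scalar_restriction K G W"
    have V: "left_module K ?V" by (rule left_module_scalar_restriction[OF W])
    let ?\<psi> = "\<lambda>w. g' (d \<odot>\<^bsub>W\<^esub> w) \<one>\<^bsub>G\<^esub>"
    \<comment> \<open>multiples of the unit commute with all elements, so multiplication by \<open>r\<close> is linear\<close>
    have scalar: "r \<odot>\<^bsub>W\<^esub> (monomial K G k \<one>\<^bsub>G\<^esub> \<odot>\<^bsub>W\<^esub> w) = monomial K G k \<one>\<^bsub>G\<^esub> \<odot>\<^bsub>W\<^esub> (r \<odot>\<^bsub>W\<^esub> w)"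
      if "r \<in> carrier R" "k \<in> carrier K" "w \<in> carrier W" for r k w
    proof -
      have "r \<star> monomial K G k \<one>\<^bsub>G\<^esub> = monomial K G k \<one>\<^bsub>G\<^esub> \<star> r"
        by (rule central_of_commutes_monomials[OF _ that(1)])
          (use that in \<open>auto simp: monomial_mult K.m_comm\<close>)
      then show ?thesis using that by (simp add: W.smult_assoc[symmetric])
    qed
    have \<psi>: "?\<psi> \<in> mod_hom K ?V (regular_module K)"
    proof (rule mod_homI)
      show "?\<psi> (v \<oplus>\<^bsub>?V\<^esub> w) = ?\<psi> v \<oplus>\<^bsub>regular_module K\<^esub> ?\<psi> w"
        if "v \<in> carrier ?V" "w \<in> carrier ?V" for v w
        using that d by (simp add: W.smult_r_distr mod_hom_add[OF g'] add_R)
      show "?\<psi> (k \<odot>\<^bsub>?V\<^esub> w) = k \<odot>\<^bsub>regular_module K\<^esub> ?\<psi> w"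
        if "k \<in> carrier K" "w \<in> carrier ?V" for k w
        using that d g'R by (simp add: scalar mod_hom_smult[OF g'] monomial_mult_left)
    qed (use g'R d in simp)
    have norm: "(\<lambda>w. \<N> H \<odot>\<^bsub>W\<^esub> w) \<in> mod_hom K ?V ?V"
      by (rule mod_homI) (auto simp: W.smult_r_distr scalar)
    \<comment> \<open>this is where the trivial action on cohomology enters\<close>
    have "?\<psi> w = \<zero>\<^bsub>K\<^esub>" if w: "w \<in> carrier W" "\<N> H \<odot>\<^bsub>W\<^esub> w = \<zero>\<^bsub>W\<^esub>" for w
    proof -
      obtain u where u: "u \<in> carrier W" "d \<odot>\<^bsub>W\<^esub> w = a \<odot>\<^bsub>W\<^esub> u" using W0[OF w] by blast
      then have "g' (d \<odot>\<^bsub>W\<^esub> w) = a \<star> g' u" using a by (simp add: mod_hom_smult[OF g'])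
      then show ?thesis using aL mod_hom_closed[OF g'L u(1)] by (simp add: zero_R)
    qed
    then obtain l where l: "l \<in> mod_hom K ?V (regular_module K)"
      "\<And>w. w \<in> carrier W \<Longrightarrow> l (\<N> H \<odot>\<^bsub>W\<^esub> w) = ?\<psi> w"
      using linear_functional_factors[OF K.field_axioms V V norm \<psi>] by (metis scalar_restriction_simps(1,2))
    obtain h where h: "h \<in> mod_hom R W (regular_module R)"
      "\<And>w. w \<in> carrier W \<Longrightarrow> h w \<one>\<^bsub>G\<^esub> = l w"
      using functional_to_hom[OF W l(1)] by blast
    have hR: "h w \<in> carrier R" if "w \<in> carrier W" for w
      using mod_hom_closed[OF h(1) that] by simp
    have right: "(\<lambda>w. k w \<star> r) \<in> mod_hom R W (regular_module R)"
      if "k \<in> mod_hom R W (regular_module R)" "r \<in> carrier R" for k r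
      using that mod_hom_closed[OF that(1)]
      by (intro mod_homI) (auto simp: mod_hom_add[OF that(1)] mod_hom_smult[OF that(1)] R.l_distr R.m_assoc)
    have key: "h w \<star> \<N> H = g' w \<star> d" if w: "w \<in> carrier W" for w
    proof (rule hom_to_regular_eqI[OF right[OF h(1) subset_sum_closed] right[OF g' d] W _ w])
      fix v assume v: "v \<in> carrier W"
      have "(h v \<star> \<N> H) \<one>\<^bsub>G\<^esub> = (\<N> H \<star> h v) \<one>\<^bsub>G\<^esub>" using norm_central[OF H hR[OF v]] by simp
      also have "\<dots> = h (\<N> H \<odot>\<^bsub>W\<^esub> v) \<one>\<^bsub>G\<^esub>" using v by (simp add: mod_hom_smult[OF h(1)])
      also have "\<dots> = g' (d \<odot>\<^bsub>W\<^esub> v) \<one>\<^bsub>G\<^esub>" using v by (simp add: h(2) l(2))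
      also have "\<dots> = (d \<star> g' v) \<one>\<^bsub>G\<^esub>" using v d by (simp add: mod_hom_smult[OF g'])
      also have "\<dots> = (g' v \<star> d) \<one>\<^bsub>G\<^esub>"
        unfolding d_def by (rule delta_minus_one_trace[OF y g'R[OF v]])
      finally show "(h v \<star> \<N> H) \<one>\<^bsub>G\<^esub> = (g' v \<star> d) \<one>\<^bsub>G\<^esub>" .
    qed
    let ?P = "image_module \<iota> (regular_module R)"
    let ?s = "\<iota> \<circ> h" and ?t = "copy_map \<iota> (regular_module R) (\<lambda>r. r \<star> \<N> H)"
    have "projective_module R ?P" by (rule R.projective_regular_copy[OF inj])
    moreover have "?s \<in> mod_hom R W ?P" by (rule mod_hom_comp[OF h(1) image_module_inj(2)[OF reg]])
    moreover have "?t \<in> mod_hom R ?P ?M"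
      by (intro copy_map_hom reg L inj' mod_homI)
        (auto simp: R.l_distr R.m_assoc carrier_principal_left_module)
    moreover have "(?f \<circ> g) w = ?t (?s w)" if w: "w \<in> carrier W" for w
    proof -
      have "?f (g w) = \<iota> (g' w \<star> d)"
        using copy_map_apply[OF inj' mod_hom_closed[OF g'L w]] by (simp add: \<iota>g'[OF w] d_def)
      also have "\<dots> = ?t (\<iota> (h w))"
        using copy_map_apply[OF reg(2)] hR[OF w] by (simp add: key[OF w])
      finally show ?thesis by simp
    qed
    ultimately show ?thesis unfolding stably_zero_def by blast
  qed
  then show ?thesis unfolding ghost_def using f by blast
qed

section \<open>Norm modules lie in the thick subcategory\<close>

text \<open>
  The norm element of \<open>G\<close> is the constant function \<open>1\<close>, so the left ideal that it generates consists of
  the constant functions.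
\<close>

lemma norm_module_whole_group_trivial:
  fixes \<iota> :: "('g \<Rightarrow> 'k) \<Rightarrow> 'u"
  assumes inj: "inj_on \<iota> (carrier R)"
  shows "norm_module \<iota> (carrier G) \<in> trivial_modules K G"
proof -
  let ?N = "\<N> (carrier G)" and ?L = "principal_left_module R (\<N> (carrier G))"
  have L: "left_module R ?L" by (rule R.left_module_principal) simp
  have LR: "carrier ?L \<subseteq> carrier R" by (rule R.principal_left_module_subset) simp
  have inj': "inj_on \<iota> (carrier ?L)" using inj LR by (rule inj_on_subset)
  note copy = image_module_inj[OF L inj']
  let ?s = "\<lambda>k. \<lambda>x\<in>carrier G. k"
  have val: "r \<star> ?s k = ?s ((\<Oplus>\<^bsub>K\<^esub>g\<in>carrier G. r g) \<otimes>\<^bsub>K\<^esub> k)"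
    if r: "r \<in> carrier R" and k: "k \<in> carrier K" for r k
  proof (rule R_eqI)
    show sk: "?s ((\<Oplus>\<^bsub>K\<^esub>g\<in>carrier G. r g) \<otimes>\<^bsub>K\<^esub> k) \<in> carrier R"
      using r k by (auto simp: carrier_R PiE_iff intro!: K.m_closed K.finsum_closed)
    show "r \<star> ?s k \<in> carrier R" using r k by (intro R.m_closed) (auto simp: carrier_R)
    fix x assume x: "x \<in> carrier G"
    have "(r \<star> ?s k) x = (\<Oplus>\<^bsub>K\<^esub>g\<in>carrier G. r g \<otimes>\<^bsub>K\<^esub> k)"
      unfolding mult_R[OF x] using r k x by (intro K.finsum_cong') auto
    also have "\<dots> = (\<Oplus>\<^bsub>K\<^esub>g\<in>carrier G. r g) \<otimes>\<^bsub>K\<^esub> k"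
      using r k finite_G by (intro K.finsum_ldistr[symmetric]) auto
    finally show "(r \<star> ?s k) x = ?s ((\<Oplus>\<^bsub>K\<^esub>g\<in>carrier G. r g) \<otimes>\<^bsub>K\<^esub> k) x" using x by simp
  qed
  have N: "?N = ?s \<one>\<^bsub>K\<^esub>" by (auto simp: subset_sum_def)
  have carL: "carrier ?L = ?s ` carrier K"
  proof (intro equalityI subsetI)
    fix v assume "v \<in> carrier ?L"
    then obtain r where r: "r \<in> carrier R" "v = r \<star> ?N"
      by (auto simp: carrier_principal_left_module)
    then have "v = ?s (\<Oplus>\<^bsub>K\<^esub>g\<in>carrier G. r g)" using val[of r "\<one>\<^bsub>K\<^esub>"] by (simp add: N K.finsum_closed)
    then show "v \<in> ?s ` carrier K" using r by (intro image_eqI) (auto intro!: K.finsum_closed)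
  next
    fix v assume "v \<in> ?s ` carrier K"
    then obtain k where k: "k \<in> carrier K" "v = ?s k" by auto
    have "(\<Oplus>\<^bsub>K\<^esub>g\<in>carrier G. monomial K G k \<one>\<^bsub>G\<^esub> g) = monomial K G k \<one>\<^bsub>G\<^esub> \<one>\<^bsub>G\<^esub>"
      using k finite_G by (intro K.finsum_single) (auto simp: monomial_def)
    then have "v = monomial K G k \<one>\<^bsub>G\<^esub> \<star> ?N"
      using val[of "monomial K G k \<one>\<^bsub>G\<^esub>" "\<one>\<^bsub>K\<^esub>"] k unfolding N by simp (simp add: monomial_def)
    then show "v \<in> carrier ?L" using k by (auto simp: carrier_principal_left_module)
  qed
  have "\<iota> \<circ> ?s \<in> mod_hom R (trivial_module K G) (norm_module \<iota> (carrier G))"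
  proof (rule mod_hom_comp[OF _ copy(2)], rule mod_homI)
    show "?s k \<in> carrier ?L" if "k \<in> carrier (trivial_module K G)" for k
      using that carL by (auto simp: trivial_module_def)
    show "?s (k \<oplus>\<^bsub>trivial_module K G\<^esub> k') = ?s k \<oplus>\<^bsub>?L\<^esub> ?s k'"
      if "k \<in> carrier (trivial_module K G)" "k' \<in> carrier (trivial_module K G)" for k k'
      by (auto simp: trivial_module_def group_algebra_def)
    show "?s (r \<odot>\<^bsub>trivial_module K G\<^esub> k) = r \<odot>\<^bsub>?L\<^esub> ?s k"
      if "r \<in> carrier R" "k \<in> carrier (trivial_module K G)" for r k
      using val[of r k] that by (simp add: trivial_module_def)
  qed
  moreover have "bij_betw (\<iota> \<circ> ?s) (carrier (trivial_module K G)) (carrier (norm_module \<iota> (carrier G)))"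
  proof (rule bij_betw_trans)
    have "inj_on ?s (carrier K)"
    proof (rule inj_onI)
      fix k k' assume "?s k = ?s k'"
      then have "?s k \<one>\<^bsub>G\<^esub> = ?s k' \<one>\<^bsub>G\<^esub>" by (rule fun_cong)
      then show "k = k'" by simp
    qed
    then show "bij_betw ?s (carrier (trivial_module K G)) (carrier ?L)"
      unfolding carL by (simp add: bij_betw_def trivial_module_def)
    show "bij_betw \<iota> (carrier ?L) (carrier (norm_module \<iota> (carrier G)))"
      using inj' by (simp add: bij_betw_def carrier_image_module)
  qed
  ultimately show ?thesis using copy(1) unfolding trivial_modules_def by blast
qed

text \<open>
  With \<open>d = x - 1\<close> and \<open>\<N> H' = \<N> H d\<^sup>p\<^sup>-\<^sup>1\<close>, each \<open>R \<N> H d\<^sup>i\<close> is an extension of \<open>R \<N> H d\<^sup>i\<^sup>+\<^sup>1\<close> by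
  the kernel of \<open>d\<close>, which is the module \<open>R \<N> H'\<close> of \<open>H'\<close>-invariants.
\<close>

lemma thick_norm_module_step:
  fixes \<iota> :: "('g \<Rightarrow> 'k) \<Rightarrow> 'u"
  assumes inj: "inj_on \<iota> (carrier R)" and p: "Factorial_Ring.prime p"
    and char: "has_characteristic K p" and H: "H \<lhd> G" and H': "H' \<lhd> G"
    and adj: "adjoins_central G p x H H'"
    and T: "thick_subcategory R T" and mem: "norm_module \<iota> H' \<in> T"
  shows "norm_module \<iota> H \<in> T"
proof -
  let ?P = "principal_left_module R"
  define d where "d = \<delta> x \<ominus>\<^bsub>R\<^esub> \<one>\<^bsub>R\<^esub>"
  have x: "x \<in> carrier G" using adj by (simp add: adjoins_central_def)
  have d: "d \<in> carrier R" by (simp add: d_def)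
  have sub: "subgroup H G" "subgroup H' G" using H H' by (auto intro: normal_imp_subgroup)
  have p1: "1 < p" using p by (rule prime_gt_1_nat)
  have N': "\<N> H' = \<N> H \<star> d [^]\<^bsub>R\<^esub> (p - 1)"
    unfolding d_def using norm_extension[OF p char x, of H' H] adj by (auto simp: adjoins_central_def)
  have "x \<bullet> inv\<^bsub>G\<^esub> (x [^]\<^bsub>G\<^esub> (1::nat)) \<in> H"
    using x subgroup.one_closed[OF sub(1)] by simp
  then have xH': "x \<in> H'" using adj x p1 unfolding adjoins_central_def by blast
  have pow: "d [^]\<^bsub>R\<^esub> k \<in> carrier R" for k :: nat using d by simp
  let ?e = "\<lambda>k::nat. \<N> H \<star> d [^]\<^bsub>R\<^esub> k"
  have e: "?e k \<in> carrier R" for k using d by simp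
  have kernel: "y \<in> carrier (?P (?e k)) \<and> y \<star> d = \<zero>\<^bsub>R\<^esub> \<longleftrightarrow> y \<in> carrier (?P (\<N> H'))"
    if k: "k < p - 1" for k y
  proof
    assume "y \<in> carrier (?P (\<N> H'))"
    then obtain r where r: "r \<in> carrier R" "y = r \<star> \<N> H'" by (auto simp: carrier_principal_left_module)
    let ?dm = "d [^]\<^bsub>R\<^esub> (p - 1 - k)"
    have "d [^]\<^bsub>R\<^esub> (p - 1) = ?dm \<star> d [^]\<^bsub>R\<^esub> k" using k d by (simp add: R.nat_pow_mult)
    then have "\<N> H' = (\<N> H \<star> ?dm) \<star> d [^]\<^bsub>R\<^esub> k" using d by (simp add: N' R.m_assoc)
    also have "\<dots> = ?dm \<star> ?e k" using norm_central[OF H pow] d by (simp add: R.m_assoc[symmetric])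
    finally have "y = (r \<star> ?dm) \<star> ?e k" using r d by (simp add: R.m_assoc)
    moreover have "y \<star> d = r \<star> (\<N> H' \<star> d)" using r d by (simp add: R.m_assoc)
    moreover have "\<N> H' \<star> d = \<zero>\<^bsub>R\<^esub>"
      unfolding d_def by (rule norm_mult_delta_minus_one[OF sub(2) xH'])
    ultimately show "y \<in> carrier (?P (?e k)) \<and> y \<star> d = \<zero>\<^bsub>R\<^esub>"
      using r d by (auto simp: carrier_principal_left_module)
  next
    assume y: "y \<in> carrier (?P (?e k)) \<and> y \<star> d = \<zero>\<^bsub>R\<^esub>"
    then have yR: "y \<in> carrier R" using R.principal_left_module_subset[OF e] by blast
    obtain r where r: "r \<in> carrier R" "y = r \<star> ?e k" using y by (auto simp: carrier_principal_left_module)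
    then have y_eq: "y = (r \<star> d [^]\<^bsub>R\<^esub> k) \<star> \<N> H"
      using norm_central[OF H pow[of k]] d by (simp add: R.m_assoc)
    have yh: "y \<star> \<delta> h = y" if "h \<in> H" for h
      using norm_mult_delta[OF sub(1) that] r(1) d unfolding y_eq by (simp add: R.m_assoc)
    have yx: "y \<star> \<delta> x = y"
      using y delta_minus_one_annihilates_iff[OF yR x] by (simp add: d_def)
    have yxi: "y \<star> \<delta> (x [^]\<^bsub>G\<^esub> i) = y" for i :: nat
    proof (induction i)
      case 0
      show ?case using yR by (simp add: one_R[symmetric])
    next
      case (Suc i)
      have "y \<star> \<delta> (x [^]\<^bsub>G\<^esub> Suc i) = (y \<star> \<delta> (x [^]\<^bsub>G\<^esub> i)) \<star> \<delta> x"
        using x yR by (simp add: R.m_assoc monomial_mult)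
      then show ?case using Suc yx by simp
    qed
    show "y \<in> carrier (?P (\<N> H'))"
    proof (rule right_invariant_imp_norm_multiple[OF H' yR])
      fix s assume s: "s \<in> H'"
      then have sG: "s \<in> carrier G" using subgroup.mem_carrier[OF sub(2)] by blast
      obtain i :: nat where i: "s \<bullet> inv\<^bsub>G\<^esub> (x [^]\<^bsub>G\<^esub> i) \<in> H"
        using adj s unfolding adjoins_central_def by blast
      let ?h = "s \<bullet> inv\<^bsub>G\<^esub> (x [^]\<^bsub>G\<^esub> i)"
      have "\<delta> s = \<delta> ?h \<star> \<delta> (x [^]\<^bsub>G\<^esub> i)" using sG x by (simp add: monomial_mult G.m_assoc)
      then have "y \<star> \<delta> s = (y \<star> \<delta> ?h) \<star> \<delta> (x [^]\<^bsub>G\<^esub> i)"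
        using yR by (simp add: R.m_assoc)
      then show "y \<star> \<delta> s = y" using yh[OF i] yxi by simp
    qed
  qed
  have "image_module \<iota> (?P (?e k)) \<in> T" if "k \<le> p - 1" for k
    using that
  proof (induction k rule: inc_induct)
    case base
    show ?case using mem by (simp add: N')
  next
    case (step k)
    have "?e k \<star> d = ?e (Suc k)" using d by (simp add: R.m_assoc)
    then show ?case
      using R.principal_extension[OF inj e d subset_sum_closed kernel T mem, of k] step by simp
  qed
  from this[of 0] show ?thesis by simp
qed

section \<open>The lower bound\<close>

lemma trivial_subgroup_norm: "\<N> {\<one>\<^bsub>G\<^esub>} = \<one>\<^bsub>R\<^esub>"
  by (auto simp: one_R subset_sum_def monomial_def)

text \<open>
  Along a central series \<open>1 = H\<^sub>0 < \<dots> < H\<^sub>r = G\<close> the norm elements satisfy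
  \<open>\<N> H\<^sub>j\<^sub>+\<^sub>1 = \<N> H\<^sub>j (x\<^sub>j - 1)\<^sup>p\<^sup>-\<^sup>1\<close>. So \<open>\<N> G\<close> arises from \<open>\<N> H\<^sub>1\<close> by \<open>(r - 1)(p - 1)\<close> factors
  \<open>x\<^sub>j - 1\<close>, each of which is a ghost on \<open>R \<N> H\<^sub>1\<close>, and no partial product can be zero.
\<close>

lemma norm_module_ghost_length:
  fixes \<iota> :: "('g \<Rightarrow> 'k) \<Rightarrow> 'u"
  assumes inf: "infinite (UNIV :: 'u set)" and inj: "inj_on \<iota> (carrier R)"
    and p: "Factorial_Ring.prime p" and char: "has_characteristic K p"
    and ord: "order G = p ^ r" and r: "r \<ge> 1"
  obtains M :: "('g \<Rightarrow> 'k, 'u) module" where "M \<in> Thick_k K G"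
    "ghost_length K G M \<ge> enat ((r - 1) * (p - 1) + 1)"
proof -
  obtain H x where H0: "H 0 = {\<one>\<^bsub>G\<^esub>}" and H: "\<And>j. j \<le> r \<Longrightarrow> H j \<lhd> G" and Hr: "H r = carrier G"
    and adj: "\<And>j. j < r \<Longrightarrow> adjoins_central G p (x j) (H j) (H (Suc j))"
    by (rule G.central_series_exists[OF p ord]) blast
  have x: "x j \<in> carrier G" if "j < r" for j using adj[OF that] by (simp add: adjoins_central_def)
  have p1: "1 < p" using p by (rule prime_gt_1_nat)
  define d where "d = (\<lambda>j. \<delta> (x j) \<ominus>\<^bsub>R\<^esub> \<one>\<^bsub>R\<^esub>)"
  have d: "d j \<in> carrier R" for j by (simp add: d_def)
  have N_Suc: "\<N> (H (Suc j)) = \<N> (H j) \<star> d j [^]\<^bsub>R\<^esub> (p - 1)" if "j < r" for j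
    unfolding d_def using norm_extension[OF p char x[OF that], of "H (Suc j)" "H j"] adj[OF that]
    by (auto simp: adjoins_central_def)
  define c where "c = x 0"
  have c: "c \<in> carrier G" using x[of 0] r by (simp add: c_def)
  let ?H = "H 1"
  have H1: "?H \<lhd> G" using H[of 1] r by simp
  have adj0: "adjoins_central G p c {\<one>\<^bsub>G\<^esub>} ?H" using adj[of 0] r by (simp add: c_def H0)
  have N: "\<N> ?H = (\<delta> c \<ominus>\<^bsub>R\<^esub> \<one>\<^bsub>R\<^esub>) [^]\<^bsub>R\<^esub> (p - 1)"
    using N_Suc[of 0] r by (simp add: H0 trivial_subgroup_norm d_def c_def)
  have eq_of_quot: "s = t" if "s \<bullet> inv\<^bsub>G\<^esub> t = \<one>\<^bsub>G\<^esub>" "s \<in> carrier G" "t \<in> carrier G" for s t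
    using that G.inv_equality[of s "inv\<^bsub>G\<^esub> t"] by simp
  have central: "g \<bullet> c = c \<bullet> g" if g: "g \<in> carrier G" for g
  proof (rule eq_of_quot)
    show "g \<bullet> c \<bullet> inv\<^bsub>G\<^esub> (c \<bullet> g) = \<one>\<^bsub>G\<^esub>"
      using adj0 g unfolding adjoins_central_def by blast
  qed (use g c in simp_all)
  have gen: "\<exists>i::nat. h = c [^]\<^bsub>G\<^esub> i" if h: "h \<in> ?H" for h
  proof -
    have hG: "h \<in> carrier G" using h subgroup.mem_carrier[OF normal_imp_subgroup[OF H1]] by blast
    obtain i where "h \<bullet> inv\<^bsub>G\<^esub> (c [^]\<^bsub>G\<^esub> (i::nat)) = \<one>\<^bsub>G\<^esub>"
      using adj0 h unfolding adjoins_central_def by blast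
    then have "h = c [^]\<^bsub>G\<^esub> i" using eq_of_quot[of h "c [^]\<^bsub>G\<^esub> i"] hG c by simp
    then show ?thesis by blast
  qed
  have cH: "c \<in> ?H"
  proof -
    have "c \<bullet> inv\<^bsub>G\<^esub> (c [^]\<^bsub>G\<^esub> (1::nat)) \<in> {\<one>\<^bsub>G\<^esub>}" using c by simp
    then show ?thesis using adj0 c p1 unfolding adjoins_central_def by blast
  qed
  let ?L = "principal_left_module R (\<N> ?H)" and ?M = "norm_module \<iota> ?H"
  have L: "left_module R ?L" by (rule R.left_module_principal) simp
  have LR: "carrier ?L \<subseteq> carrier R" by (rule R.principal_left_module_subset) simp
  have inj': "inj_on \<iota> (carrier ?L)" using inj LR by (rule inj_on_subset)
  have M: "left_module R ?M" by (rule image_module_inj(1)[OF L inj'])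
  have thick: "norm_module \<iota> (H j) \<in> T"
    if T: "thick_subcategory R T" "trivial_modules K G \<subseteq> T" and "j \<le> r" for T j
    using \<open>j \<le> r\<close>
  proof (induction j rule: inc_induct)
    case base
    show ?case using norm_module_whole_group_trivial[OF inj] T(2) by (auto simp: Hr)
  next
    case (step j)
    then show ?case using thick_norm_module_step[OF inj p char H H adj T(1)] by auto
  qed
  have MT: "?M \<in> Thick_k K G"
    unfolding Thick_k_def Thick_def using thick r by blast
  define e where "e = (\<lambda>i. d (Suc (i div (p - 1))))"
  define y where "y = rec_nat \<one>\<^bsub>R\<^esub> (\<lambda>i u. u \<star> e i)"
  have y0: "y 0 = \<one>\<^bsub>R\<^esub>" and ySuc: "y (Suc i) = y i \<star> e i" for i by (simp_all add: y_def)
  have eR: "e i \<in> carrier R" for i using d by (simp add: e_def)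
  have yR: "y i \<in> carrier R" for i by (induction i) (simp_all add: y0 ySuc eR)
  have block: "y (j * (p - 1) + k) = y (j * (p - 1)) \<star> d (Suc j) [^]\<^bsub>R\<^esub> k" if "k \<le> p - 1" for j k
    using that
  proof (induction k)
    case (Suc k)
    have "(j * (p - 1) + k) div (p - 1) = j" using Suc.prems by simp
    then show ?case using Suc yR d by (simp add: ySuc e_def R.m_assoc)
  qed (use yR in simp)
  have norm_y: "\<N> ?H \<star> y (j * (p - 1)) = \<N> (H (Suc j))" if "j < r" for j
    using that
  proof (induction j)
    case (Suc j)
    have "y (Suc j * (p - 1)) = y (j * (p - 1)) \<star> d (Suc j) [^]\<^bsub>R\<^esub> (p - 1)"
      using block[of "p - 1" j] by (simp add: add.commute)
    then show ?case using Suc N_Suc[of "Suc j"] yR d by (simp add: R.m_assoc[symmetric])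
  qed (simp add: y0)
  have Ny: "\<N> ?H \<star> y n \<noteq> \<zero>\<^bsub>R\<^esub>" if n: "n \<le> (r - 1) * (p - 1)" for n
  proof
    assume zero: "\<N> ?H \<star> y n = \<zero>\<^bsub>R\<^esub>"
    have "\<N> ?H \<star> y m = \<zero>\<^bsub>R\<^esub>" if "n \<le> m" for m
      using that
    proof (induction m rule: dec_induct)
      case (step m)
      then show ?case using yR eR by (simp add: ySuc R.m_assoc[symmetric])
    qed (rule zero)
    then have "\<N> (carrier G) = \<zero>\<^bsub>R\<^esub>" using n norm_y[of "r - 1"] r Hr by simp
    then have "\<N> (carrier G) \<one>\<^bsub>G\<^esub> = \<zero>\<^bsub>K\<^esub>" by (simp add: zero_R)
    then show False by (simp add: subset_sum_def)
  qed
  define f where "f = (\<lambda>i. copy_map \<iota> ?L (\<lambda>x. x \<star> e i))"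
  have ghost_f: "ghost K G ?M ?M (f i)" if "i < (r - 1) * (p - 1)" for i
  proof -
    have "i div (p - 1) < r - 1" using that p1 by (simp add: less_mult_imp_div_less)
    then have "x (Suc (i div (p - 1))) \<in> carrier G" using x by simp
    then show ?thesis unfolding f_def e_def d_def
      by (intro norm_module_ghost[OF inf inj c _ H1 cH _ N] central gen)
  qed
  define F where "F = rec_nat id (\<lambda>i u. f i \<circ> u)"
  have F0: "F 0 = id" and FSuc: "F (Suc i) = f i \<circ> F i" for i by (simp_all add: F_def)
  have F_value: "F n (\<iota> (\<N> ?H)) = \<iota> (\<N> ?H \<star> y n)" for n
  proof (induction n)
    case (Suc n)
    have "\<N> ?H \<star> y n \<in> carrier ?L"
      using norm_central[OF H1 yR, of n] yR[of n]
      by (auto simp: carrier_principal_left_module intro!: image_eqI[of _ _ "y n"])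
    then show ?case
      using Suc yR eR copy_map_apply[OF inj'] by (simp add: FSuc f_def ySuc R.m_assoc)
  qed (simp add: F0 y0)
  have comp: "ghost_composite K G n ?M ?M (F n)" if "n \<le> (r - 1) * (p - 1)" for n
    using that
  proof (induction n)
    case 0
    show ?case unfolding F0 by (rule ghost_composite.none[OF MT MT mod_hom_id])
  next
    case (Suc n)
    have g: "ghost K G ?M ?M (f n)" using ghost_f Suc.prems by simp
    show ?case
    proof (cases "n = 0")
      case True
      then show ?thesis using ghost_composite.single[OF MT MT g] by (simp add: FSuc F0)
    next
      case False
      then show ?thesis
        unfolding FSuc using Suc by (intro ghost_composite.step[OF _ _ MT g]) auto
    qed
  qed
  have not_zero: "\<not> stably_zero R ?M ?M (F n)" if n: "n \<le> (r - 1) * (p - 1)" for n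
  proof
    assume sz: "stably_zero R ?M ?M (F n)"
    let ?a = "\<delta> c \<ominus>\<^bsub>R\<^esub> \<one>\<^bsub>R\<^esub>"
    have a: "?a \<in> carrier R" by simp
    have Na: "\<N> ?H \<star> ?a = \<zero>\<^bsub>R\<^esub>"
      by (rule norm_mult_delta_minus_one[OF normal_imp_subgroup[OF H1] cH])
    have aN: "?a \<star> \<N> ?H = \<zero>\<^bsub>R\<^esub>" using Na norm_central[OF H1 a] by simp
    have NN: "\<N> ?H \<star> \<N> ?H = \<zero>\<^bsub>R\<^esub>"
    proof -
      obtain m where "p - 1 = Suc m" using p1 by (cases "p - 1") auto
      then have "\<N> ?H = ?a \<star> ?a [^]\<^bsub>R\<^esub> m" using N a by (metis R.nat_pow_Suc2)
      then have "\<N> ?H \<star> \<N> ?H = (\<N> ?H \<star> ?a) \<star> ?a [^]\<^bsub>R\<^esub> m"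
        using a by (metis R.m_assoc R.nat_pow_closed subset_sum_closed)
      then show ?thesis using Na a by simp
    qed
    have kill: "s \<odot>\<^bsub>?M\<^esub> v = \<zero>\<^bsub>?M\<^esub>"
      if s: "s \<in> carrier R" "s \<star> \<N> ?H = \<zero>\<^bsub>R\<^esub>" and v: "v \<in> carrier ?M" for s v
    proof -
      obtain r where r: "r \<in> carrier R" "v = \<iota> (r \<star> \<N> ?H)"
        using v by (auto simp: carrier_image_module carrier_principal_left_module)
      then have rL: "r \<star> \<N> ?H \<in> carrier ?L" by (auto simp: carrier_principal_left_module)
      have "s \<star> (r \<star> \<N> ?H) = (s \<star> \<N> ?H) \<star> r"
        using norm_central[OF H1 r(1)] s(1) r(1) by (simp add: R.m_assoc)
      then show ?thesis
        using mod_hom_smult[OF image_module_inj(2)[OF L inj'] s(1) rL] s(2) r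
        by (simp add: zero_image_module)
    qed
    have \<iota>N: "\<iota> (\<N> ?H) \<in> carrier ?M"
      using R.self_mem_principal[of "\<N> ?H"] by (simp add: carrier_image_module)
    have "F n (\<iota> (\<N> ?H)) = \<zero>\<^bsub>?M\<^esub>"
    proof (rule stably_zero_imp_zero[OF M M a subset_sum_closed _ _ _ sz \<iota>N])
      show "kills_homology R \<one>\<^bsub>R\<^esub> ?a (\<N> ?H) J" if "projective_module R J" for J :: "('g \<Rightarrow> 'k, 'u) module"
        using projective_kills_homology[OF inf that c normal_imp_subgroup[OF H1] gen N] by blast
    qed (use kill a aN NN in auto)
    then have "\<iota> (\<N> ?H \<star> y n) = \<iota> \<zero>\<^bsub>R\<^esub>" using F_value[of n] by (simp add: zero_image_module)
    then have "\<N> ?H \<star> y n = \<zero>\<^bsub>R\<^esub>" using inj yR by (simp add: inj_on_eq_iff)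
    then show False using Ny[OF n] by simp
  qed
  have "enat ((r - 1) * (p - 1) + 1) \<le> ghost_length K G ?M"
    unfolding ghost_length_def
  proof (rule Inf_greatest, clarify)
    fix n assume n: "\<forall>N f. ghost_composite K G n ?M N f \<longrightarrow> stably_zero R ?M N f"
    then show "enat ((r - 1) * (p - 1) + 1) \<le> enat n"
      using comp[of n] not_zero[of n] by (cases "n \<le> (r - 1) * (p - 1)") auto
  qed
  then show ?thesis using that MT by blast
qed

end

theorem proposition4p33:
  fixes K :: "('k, 'c) ring_scheme" and G :: "('g, 'd) monoid_scheme" and p r :: nat
  assumes "module_universe TYPE('u) K"
    and "Factorial_Ring.prime p"
    and "field K" and "has_characteristic K p"
    and "group G" and "order G = p ^ r" and "r \<ge> 1"
  shows "ghost_number TYPE('u) K G \<ge> enat ((r - 1) * (p - 1) + 1)"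
proof -
  interpret G: group G by fact
  have "finite (carrier G)"
    using assms(2,6) G.order_gt_0_iff_finite prime_gt_0_nat[of p] by simp
  then interpret finite_group_algebra K G
    using assms(3,5) by (simp add: finite_group_algebra_def finite_group_algebra_axioms_def)
  have inf: "infinite (UNIV :: 'u set)" using assms(1) by (simp add: module_universe_def)
  obtain i :: "'k \<Rightarrow> 'u" where i: "inj_on i (carrier K)"
    using assms(1) by (auto simp: module_universe_def)
  obtain \<iota> :: "('g \<Rightarrow> 'u) \<Rightarrow> 'u" where \<iota>: "inj_on \<iota> (carrier G \<rightarrow>\<^sub>E UNIV)"
    by (rule finite_power_embedding[OF inf finite_G])
  have "inj_on (\<lambda>a. \<iota> (\<lambda>x\<in>carrier G. i (a x))) (carrier R)"
  proof (rule inj_onI)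
    fix a b assume ab: "a \<in> carrier R" "b \<in> carrier R"
      and eq: "\<iota> (\<lambda>x\<in>carrier G. i (a x)) = \<iota> (\<lambda>x\<in>carrier G. i (b x))"
    have "(\<lambda>x\<in>carrier G. i (a x)) = (\<lambda>x\<in>carrier G. i (b x))"
      using \<iota> eq by (simp add: inj_on_eq_iff)
    then have "i (a x) = i (b x)" if "x \<in> carrier G" for x using that by (metis restrict_apply')
    then show "a = b" using ab i by (intro R_eqI) (auto simp: inj_on_eq_iff)
  qed
  then obtain M :: "('g \<Rightarrow> 'k, 'u) module" where M: "M \<in> Thick_k K G"
    "ghost_length K G M \<ge> enat ((r - 1) * (p - 1) + 1)"
    using norm_module_ghost_length[OF inf _ assms(2,4,6,7)] by blast
  have "ghost_length K G M \<le> ghost_number TYPE('u) K G"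
    unfolding ghost_number_def by (rule SUP_upper[OF M(1)])
  then show ?thesis using M(2) order_trans by blast
qed

end
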